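(* Let $G$ be a second countable, non-abelian, unimodular, type I locally compact group, and let $\psi,\varphi\in L^2(G)$ be two nonzero functions (window functions) such that $\langle\varphi,\psi\rangle_{L^2(G)}\neq0$. Then for each $f\in L^2(G)$, $$f=\langle\varphi,\psi\rangle^{-1}_{L^2(G)}\int_{G\times\widehat{G}}\mathrm{tr}[\mathcal{G}_\psi f(y,\pi)M_\pi(L_y\varphi)]\,d\sigma(y,\pi),$$ where the integral is understood in the weak sense: for $K\in\mathcal{H}^2(G\times\widehat G)$, $\int_{G\times\widehat{G}}\mathrm{tr}[K(y,\pi)M_\pi(L_y\varphi)]\,d\sigma(y,\pi)$ denotes the unique element of $L^2(G)$ whose inner product with every $g\in L^2(G)$ equals $\int_{G\times\widehat{G}}\mathrm{tr}[K(y,\pi)\mathcal{G}_\varphi g(y,\pi)^*]\,d\sigma(y,\pi)$.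
   Context: Inner products are linear in the first variable. $\mathcal{C}_c(G)$ is the space of continuous compactly supported complex functions on $G$; $dx$ is a fixed Haar measure on $G$. $\widehat{G}$ is the set of equivalence classes of irreducible continuous unitary representations $\pi$ of $G$, on Hilbert spaces $\mathcal{H}_\pi$, and $d\pi$ is the Plancherel measure on $\widehat{G}$ associated with $dx$, i.e. the unique measure for which $f\mapsto\widehat f$, $\widehat{f}(\pi)=\int_G f(x)\pi(x)^*dx$, maps $L^1(G)\cap L^2(G)$ into $\int^{\oplus}_{\widehat G}\mathrm{HS}(\mathcal{H}_\pi)\,d\pi$ and extends to a unitary map of $L^2(G)$ onto $\int^{\oplus}_{\widehat G}\mathrm{HS}(\mathcal{H}_\pi)\,d\pi$; here $\mathrm{HS}(\mathcal{H}_\pi)$ is the space of Hilbert–Schmidt operators on $\mathcal{H}_\pi$ with inner product $\mathrm{tr}(S^*T)$. $d\sigma$ is the product of $dx$ and $d\pi$ on $G\times\widehat G$. For $(x,\pi)\in G\times\widehat G$ let $\mathcal{H}_{(x,\pi)}=\pi(x)\mathrm{HS}(\mathcal{H}_\pi)=\{\pi(x)T:T\in \mathrm{HS}(\mathcal{H}_\pi)\}$ with inner product $\langle\pi(x)T,\pi(x)S\rangle=\mathrm{tr}(S^*T)$. $\mathcal{H}^2(G\times\widehat G)$ is the direct integral of the spaces $\mathcal{H}_{(x,\pi)}$ with respect to $\sigma$, a Hilbert space with inner product $\langle F,K\rangle_{\mathcal{H}^2(G\times\widehat G)}=\int_{G\times\widehat G}\mathrm{tr}[K(x,\pi)^*F(x,\pi)]\,d\sigma(x,\pi)$.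 Continuous Gabor transform: for a window function $\psi$ (nonzero element of $L^2(G)$) and $f\in\mathcal{C}_c(G)$, $\mathcal{G}_\psi f(x,\pi)=\int_G f(y)\overline{\psi(x^{-1}y)}\pi(y)^*\,dy$, with the operator-valued integral understood weakly. On $\mathcal{C}_c(G)$ one has $\|\mathcal{G}_\psi f\|_{\mathcal{H}^2(G\times\widehat{G})}=\|f\|_{L^2(G)}\|\psi\|_{L^2(G)}$, and $\mathcal{G}_\psi: L^2(G)\to\mathcal{H}^2(G\times\widehat G)$ denotes the unique bounded linear extension to $L^2(G)$. $L_y\varphi(x)=\varphi(y^{-1}x)$ is left translation and $M_\pi$ is the modulation $(M_\pi\varphi)(x)=\varphi(x)\pi(x)$. For $K\in\mathcal{H}^2(G\times\widehat G)$ the map $g\mapsto\int_{G\times\widehat{G}}\mathrm{tr}[K(y,\pi)\mathcal{G}_\varphi g(y,\pi)^*]\,d\sigma(y,\pi)$ is a bounded conjugate-linear functional on $L^2(G)$, so the weak integral in the claim is well defined. *)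

theory Defs
  imports "HOL-Analysis.Analysis"
begin

text \<open>
  A locally compact group is a type of class \<^class>\<open>topological_group_add\<close>, the topological groups of
  the library, which need not be commutative: the product is written \<open>x + y\<close>, the inverse
  \<open>- x\<close>, the unit \<open>0\<close>.
\<close>

section \<open>Standard separable Hilbert spaces and their operators\<close>

text \<open>
  All Hilbert spaces on which representations act are the standard ones: \<open>hil n\<close> is
  \<open>\<complex>\<^sup>n\<close> for finite \<open>n\<close> and \<open>\<ell>\<^sup>2\<close> for \<open>n = \<infinity>\<close>, realised as the square-summable sequences
  supported in the first \<open>n\<close> coordinates. As the groups are second countable,
  irreducible representations live on separable spaces, so nothing is lost.
\<close>

type_synonym cseq = "nat \<Rightarrow> complex"
type_synonym cop = "cseq \<Rightarrow> cseq"

definition ix :: "enat \<Rightarrow> nat set" where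
  "ix n = {i. enat i < n}"

definition hil :: "enat \<Rightarrow> cseq set" where
  "hil n = {u. summable (\<lambda>i. (cmod (u i))\<^sup>2) \<and> (\<forall>i. i \<notin> ix n \<longrightarrow> u i = 0)}"

definition cinner :: "cseq \<Rightarrow> cseq \<Rightarrow> complex" where
  "cinner u v = (\<Sum>i. u i * cnj (v i))"

definition hnorm :: "cseq \<Rightarrow> real" where
  "hnorm u = sqrt (Re (cinner u u))"

definition unitvec :: "nat \<Rightarrow> cseq" where
  "unitvec i = (\<lambda>j. if j = i then 1 else 0)"

definition linear_on_hil :: "enat \<Rightarrow> enat \<Rightarrow> cop \<Rightarrow> bool" where
  "linear_on_hil n m T \<longleftrightarrow>
     T ` hil n \<subseteq> hil m \<and>
     (\<forall>u\<in>hil n. \<forall>v\<in>hil n. \<forall>a b. T (\<lambda>i. a * u i + b * v i) = (\<lambda>i. a * T u i + b * T v i))"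

text \<open>Operators on \<open>hil n\<close> vanish outside \<open>hil n\<close>, so that equal operators are equal functions.\<close>

definition bounded_ops :: "enat \<Rightarrow> cop set" where
  "bounded_ops n = {T. linear_on_hil n n T \<and> (\<forall>u. u \<notin> hil n \<longrightarrow> T u = (\<lambda>_. 0)) \<and>
     (\<exists>C. \<forall>u\<in>hil n. hnorm (T u) \<le> C * hnorm u)}"

definition isometry_hil :: "enat \<Rightarrow> enat \<Rightarrow> cop \<Rightarrow> bool" where
  "isometry_hil n m V \<longleftrightarrow>
     linear_on_hil n m V \<and> (\<forall>u\<in>hil n. \<forall>v\<in>hil n. cinner (V u) (V v) = cinner u v)"

definition unitary_hil :: "enat \<Rightarrow> enat \<Rightarrow> cop \<Rightarrow> bool" where
  "unitary_hil n m V \<longleftrightarrow> isometry_hil n m V \<and> V ` hil n = hil m"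

definition adj :: "enat \<Rightarrow> cop \<Rightarrow> cop" where
  "adj n T = (\<lambda>v. if v \<in> hil n
      then (THE w. w \<in> hil n \<and> (\<forall>u\<in>hil n. cinner (T u) v = cinner u w))
      else (\<lambda>_. 0))"

definition tr :: "enat \<Rightarrow> cop \<Rightarrow> complex" where
  "tr n T = (\<Sum>\<^sub>\<infinity>i\<in>ix n. cinner (T (unitvec i)) (unitvec i))"

definition HS :: "enat \<Rightarrow> cop set" where
  "HS n = {T \<in> bounded_ops n. (\<lambda>i. (hnorm (T (unitvec i)))\<^sup>2) summable_on ix n}"

text \<open>The operator \<open>\<integral> F y dy\<close> in the weak sense: \<open>\<langle>(\<integral> F y dy) u, v\<rangle> = \<integral> \<langle>F y u, v\<rangle> dy\<close>.\<close>

definition weak_op_integral :: "enat \<Rightarrow> 'a measure \<Rightarrow> ('a \<Rightarrow> cop) \<Rightarrow> cop" where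
  "weak_op_integral n M F = (\<lambda>u. if u \<in> hil n
      then (THE w. w \<in> hil n \<and> (\<forall>v\<in>hil n. cinner w v = (LINT y|M. cinner (F y u) v)))
      else (\<lambda>_. 0))"


section \<open>Unitary representations, the dual, type I\<close>

text \<open>A representation is a pair of the dimension of its space \<open>hil n\<close> and the operators.\<close>

type_synonym 'g rep = "enat \<times> ('g \<Rightarrow> cop)"

definition unitary_rep :: "'g::topological_group_add rep \<Rightarrow> bool" where
  "unitary_rep r \<longleftrightarrow> (case r of (n, \<pi>) \<Rightarrow>
     (\<forall>x. \<pi> x \<in> bounded_ops n \<and> unitary_hil n n (\<pi> x)) \<and>
     (\<forall>x y. \<pi> (x + y) = \<pi> x \<circ> \<pi> y) \<and>
     (\<forall>u\<in>hil n. \<forall>x. ((\<lambda>y. hnorm (\<lambda>i. \<pi> y u i - \<pi> x u i)) \<longlongrightarrow> 0) (at x)))"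

definition closed_subspace :: "enat \<Rightarrow> cseq set \<Rightarrow> bool" where
  "closed_subspace n W \<longleftrightarrow>
     W \<subseteq> hil n \<and> (\<lambda>_. 0) \<in> W \<and>
     (\<forall>u\<in>W. \<forall>v\<in>W. \<forall>a b. (\<lambda>i. a * u i + b * v i) \<in> W) \<and>
     (\<forall>s u. (\<forall>k. s k \<in> W) \<longrightarrow> u \<in> hil n \<longrightarrow>
        (\<lambda>k::nat. hnorm (\<lambda>i. s k i - u i)) \<longlonglongrightarrow> 0 \<longrightarrow> u \<in> W)"

definition irreducible_rep :: "'g::topological_group_add rep \<Rightarrow> bool" where
  "irreducible_rep r \<longleftrightarrow> unitary_rep r \<and> (case r of (n, \<pi>) \<Rightarrow>
     n \<noteq> 0 \<and>
     (\<forall>W. closed_subspace n W \<and> (\<forall>x. \<pi> x ` W \<subseteq> W) \<longrightarrow> W = {\<lambda>_. 0} \<or> W = hil n))"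

definition rep_equivalent :: "'g rep \<Rightarrow> 'g rep \<Rightarrow> bool" where
  "rep_equivalent r s \<longleftrightarrow> (\<exists>V. unitary_hil (fst r) (fst s) V \<and>
     (\<forall>x. \<forall>u\<in>hil (fst r). V (snd r x u) = snd s x (V u)))"

definition Irr :: "'g::topological_group_add rep set" where
  "Irr = {r. irreducible_rep r}"

definition dual_group :: "'g::topological_group_add rep set set" where
  "dual_group = Irr // {(r, s). r \<in> Irr \<and> s \<in> Irr \<and> rep_equivalent r s}"

text \<open>
  The Mackey Borel structure: the irreducible representations on each \<open>hil n\<close> carry the smallest
  \<open>\<sigma>\<close>-algebra making all \<open>r \<mapsto> \<langle>r(x) u, v\<rangle>\<close> measurable, \<open>Irr\<close> is their disjoint union (the sets
  with \<open>B = UNIV\<close> below are its pieces), and the dual carries the quotient \<open>\<sigma>\<close>-algebra; note that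
  \<open>\<Union>E\<close> is the preimage of \<open>E\<close> under the quotient map.
\<close>

definition Irr_borel :: "'g::topological_group_add rep measure" where
  "Irr_borel = sigma Irr
     {{r \<in> Irr. fst r = n \<and> cinner (snd r x u) v \<in> B} | n x u v B.
        u \<in> hil n \<and> v \<in> hil n \<and> open B}"

definition mackey_borel :: "'g::topological_group_add rep set measure" where
  "mackey_borel = sigma dual_group {E. E \<subseteq> dual_group \<and> \<Union>E \<in> sets Irr_borel}"

text \<open>
  A choice of a representative for each class in the dual, measurable in the class; this is what
  makes \<open>\<H>\<^sub>\<pi>\<close> and \<open>\<pi>(x)\<close> meaningful for a class \<open>\<pi>\<close>, and the \<open>HS(\<H>\<^sub>\<pi>)\<close> a measurable field.
\<close>

definition measurable_section :: "('g::topological_group_add rep set \<Rightarrow> 'g rep) \<Rightarrow> bool" where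
  "measurable_section \<rho> \<longleftrightarrow>
     \<rho> \<in> measurable mackey_borel Irr_borel \<and> (\<forall>p\<in>dual_group. \<rho> p \<in> p)"

definition commutant :: "'g rep \<Rightarrow> cop set" where
  "commutant r = {T \<in> bounded_ops (fst r). \<forall>x. T \<circ> snd r x = snd r x \<circ> T}"

text \<open>Primary (factor) representations: the centre of the commutant consists of the scalars.\<close>

definition primary_rep :: "'g::topological_group_add rep \<Rightarrow> bool" where
  "primary_rep r \<longleftrightarrow> unitary_rep r \<and> fst r \<noteq> 0 \<and>
     (\<forall>T\<in>commutant r. (\<forall>S\<in>commutant r. T \<circ> S = S \<circ> T) \<longrightarrow>
        (\<exists>c. \<forall>u\<in>hil (fst r). T u = (\<lambda>i. c * u i)))"

text \<open>
  \<open>r\<close> is a Hilbert space direct sum of copies of \<open>s\<close>, embedded by the intertwining isometries \<open>V k\<close>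
  with mutually orthogonal ranges that together are total.
\<close>

definition multiple_of :: "'g rep \<Rightarrow> 'g rep \<Rightarrow> bool" where
  "multiple_of r s \<longleftrightarrow> (\<exists>(J :: nat set) V.
     (\<forall>k\<in>J. isometry_hil (fst s) (fst r) (V k) \<and>
        (\<forall>x. \<forall>w\<in>hil (fst s). V k (snd s x w) = snd r x (V k w))) \<and>
     (\<forall>k\<in>J. \<forall>l\<in>J. k \<noteq> l \<longrightarrow>
        (\<forall>w\<in>hil (fst s). \<forall>w'\<in>hil (fst s). cinner (V k w) (V l w') = 0)) \<and>
     (\<forall>u\<in>hil (fst r). (\<forall>k\<in>J. \<forall>w\<in>hil (fst s). cinner u (V k w) = 0) \<longrightarrow> u = (\<lambda>_. 0)))"

text \<open>
  Type I: every primary representation is a multiple of an irreducible one. For second countable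
  groups it suffices to consider separable Hilbert spaces.
\<close>

definition type_I_group :: "'g::topological_group_add itself \<Rightarrow> bool" where
  "type_I_group _ \<longleftrightarrow>
     (\<forall>r :: 'g rep. primary_rep r \<longrightarrow> (\<exists>s. irreducible_rep s \<and> multiple_of r s))"


section \<open>Haar measure and \<open>L\<^sup>2(G)\<close>\<close>

text \<open>Regularity is automatic, as the groups are second countable.\<close>

definition haar_measure :: "'g::topological_group_add measure \<Rightarrow> bool" where
  "haar_measure \<mu> \<longleftrightarrow> sets \<mu> = sets borel \<and>
     (\<forall>a. distr \<mu> borel (\<lambda>x. a + x) = \<mu>) \<and>
     (\<forall>C. compact C \<longrightarrow> emeasure \<mu> C < \<infinity>) \<and> emeasure \<mu> UNIV \<noteq> 0"

definition right_invariant :: "'g::topological_group_add measure \<Rightarrow> bool" where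
  "right_invariant \<mu> \<longleftrightarrow> (\<forall>a. distr \<mu> borel (\<lambda>x. x + a) = \<mu>)"

definition unimodular :: "'g::topological_group_add itself \<Rightarrow> bool" where
  "unimodular _ \<longleftrightarrow> (\<forall>\<mu> :: 'g measure. haar_measure \<mu> \<longrightarrow> right_invariant \<mu>)"

text \<open>Elements of \<open>L\<^sup>1\<close>, \<open>L\<^sup>2\<close> are functions; they represent classes modulo equality a.e.\<close>

definition L1 :: "'a measure \<Rightarrow> ('a \<Rightarrow> complex) set" where
  "L1 M = {f. integrable M f}"

definition L2 :: "'a measure \<Rightarrow> ('a \<Rightarrow> complex) set" where
  "L2 M = {f \<in> borel_measurable M. integrable M (\<lambda>x. (cmod (f x))\<^sup>2)}"

definition L2_inner :: "'a measure \<Rightarrow> ('a \<Rightarrow> complex) \<Rightarrow> ('a \<Rightarrow> complex) \<Rightarrow> complex" where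
  "L2_inner M f g = (LINT x|M. f x * cnj (g x))"

definition L2_norm :: "'a measure \<Rightarrow> ('a \<Rightarrow> complex) \<Rightarrow> real" where
  "L2_norm M f = sqrt (Re (L2_inner M f f))"

definition Cc :: "('g::topological_space \<Rightarrow> complex) set" where
  "Cc = {f. continuous_on UNIV f \<and> compact (closure {x. f x \<noteq> 0})}"


section \<open>Direct integrals of spaces of operators\<close>

text \<open>
  Square-integrable measurable fields \<open>K\<close> with \<open>K z\<close> in the fibre \<open>A z\<close>, a space of Hilbert-Schmidt
  operators on \<open>hil (d z)\<close>; they represent classes modulo equality a.e. Note that \<open>K z (unitvec i) j\<close>
  is the matrix coefficient of \<open>K z\<close>, and is 0 unless both \<open>i\<close> and \<open>j\<close> are in \<open>ix (d z)\<close>.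
\<close>

definition direct_integral ::
    "'z measure \<Rightarrow> ('z \<Rightarrow> enat) \<Rightarrow> ('z \<Rightarrow> cop set) \<Rightarrow> ('z \<Rightarrow> cop) set" where
  "direct_integral M d A = {K.
     (\<forall>z\<in>space M. K z \<in> A z) \<and>
     (\<forall>i j. (\<lambda>z. K z (unitvec i) j) \<in> borel_measurable M) \<and>
     integrable M (\<lambda>z. tr (d z) (adj (d z) (K z) \<circ> K z))}"

definition di_inner ::
    "'z measure \<Rightarrow> ('z \<Rightarrow> enat) \<Rightarrow> ('z \<Rightarrow> cop) \<Rightarrow> ('z \<Rightarrow> cop) \<Rightarrow> complex" where
  "di_inner M d F K = (LINT z|M. tr (d z) (adj (d z) (K z) \<circ> F z))"

definition di_norm :: "'z measure \<Rightarrow> ('z \<Rightarrow> enat) \<Rightarrow> ('z \<Rightarrow> cop) \<Rightarrow> real" where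
  "di_norm M d F = sqrt (Re (di_inner M d F F))"

definition linear_L2_fields ::
    "'a measure \<Rightarrow> 'z measure \<Rightarrow> (('a \<Rightarrow> complex) \<Rightarrow> 'z \<Rightarrow> cop) \<Rightarrow> bool" where
  "linear_L2_fields \<mu> M U \<longleftrightarrow>
     (\<forall>f\<in>L2 \<mu>. \<forall>g\<in>L2 \<mu>. \<forall>a b. AE z in M.
        U (\<lambda>x. a * f x + b * g x) z = (\<lambda>u i. a * U f z u i + b * U g z u i))"


section \<open>Fourier transform and Plancherel measure\<close>

definition fourier ::
    "'g measure \<Rightarrow> ('g rep set \<Rightarrow> 'g rep) \<Rightarrow> ('g \<Rightarrow> complex) \<Rightarrow> 'g rep set \<Rightarrow> cop" where
  "fourier \<mu> \<rho> f p = weak_op_integral (fst (\<rho> p)) \<mu>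
     (\<lambda>x u i. f x * adj (fst (\<rho> p)) (snd (\<rho> p) x) u i)"

definition dual_dim :: "('g rep set \<Rightarrow> 'g rep) \<Rightarrow> 'g rep set \<Rightarrow> enat" where
  "dual_dim \<rho> p = fst (\<rho> p)"

text \<open>
  \<open>\<integral>\<^sup>\<oplus> HS(\<H>\<^sub>\<pi>) d\<pi>\<close>. The transform of a function in \<open>L\<^sup>1 \<inter> L\<^sup>2\<close> is in general Hilbert-Schmidt only
  almost everywhere; hence it is required to agree a.e. with a member.
\<close>

definition dual_L2 ::
    "('g rep set \<Rightarrow> 'g rep) \<Rightarrow> 'g rep set measure \<Rightarrow> ('g rep set \<Rightarrow> cop) set" where
  "dual_L2 \<rho> P = direct_integral P (dual_dim \<rho>) (\<lambda>p. HS (dual_dim \<rho> p))"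

definition plancherel_measure ::
    "'g::topological_group_add measure \<Rightarrow> ('g rep set \<Rightarrow> 'g rep) \<Rightarrow> 'g rep set measure \<Rightarrow> bool" where
  "plancherel_measure \<mu> \<rho> P \<longleftrightarrow> sets P = sets mackey_borel \<and>
     (\<exists>U. (\<forall>f\<in>L2 \<mu>. U f \<in> dual_L2 \<rho> P) \<and>
          linear_L2_fields \<mu> P U \<and>
          (\<forall>f\<in>L2 \<mu>. \<forall>g\<in>L2 \<mu>. di_inner P (dual_dim \<rho>) (U f) (U g) = L2_inner \<mu> f g) \<and>
          (\<forall>K\<in>dual_L2 \<rho> P. \<exists>f\<in>L2 \<mu>. AE p in P. U f p = K p) \<and>
          (\<forall>f\<in>L1 \<mu> \<inter> L2 \<mu>. AE p in P. U f p = fourier \<mu> \<rho> f p))"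


section \<open>The continuous Gabor transform\<close>

definition gabor_fibre ::
    "('g rep set \<Rightarrow> 'g rep) \<Rightarrow> 'g \<times> 'g rep set \<Rightarrow> cop set" where
  "gabor_fibre \<rho> = (\<lambda>(x, p). {snd (\<rho> p) x \<circ> T | T. T \<in> HS (fst (\<rho> p))})"

definition gabor_dim :: "('g rep set \<Rightarrow> 'g rep) \<Rightarrow> 'g \<times> 'g rep set \<Rightarrow> enat" where
  "gabor_dim \<rho> z = fst (\<rho> (snd z))"

definition H2_space ::
    "'g measure \<Rightarrow> ('g rep set \<Rightarrow> 'g rep) \<Rightarrow> 'g rep set measure \<Rightarrow> ('g \<times> 'g rep set \<Rightarrow> cop) set" where
  "H2_space \<mu> \<rho> P = direct_integral (\<mu> \<Otimes>\<^sub>M P) (gabor_dim \<rho>) (gabor_fibre \<rho>)"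

definition gabor_Cc ::
    "'g::topological_group_add measure \<Rightarrow> ('g rep set \<Rightarrow> 'g rep) \<Rightarrow> ('g \<Rightarrow> complex) \<Rightarrow>
       ('g \<Rightarrow> complex) \<Rightarrow> 'g \<times> 'g rep set \<Rightarrow> cop" where
  "gabor_Cc \<mu> \<rho> \<psi> f = (\<lambda>(x, p). weak_op_integral (fst (\<rho> p)) \<mu>
     (\<lambda>y u i. f y * cnj (\<psi> (- x + y)) * adj (fst (\<rho> p)) (snd (\<rho> p) y) u i))"

definition gabor_extension ::
    "'g::topological_group_add measure \<Rightarrow> ('g rep set \<Rightarrow> 'g rep) \<Rightarrow> 'g rep set measure \<Rightarrow>
       ('g \<Rightarrow> complex) \<Rightarrow> (('g \<Rightarrow> complex) \<Rightarrow> 'g \<times> 'g rep set \<Rightarrow> cop) \<Rightarrow> bool" where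
  "gabor_extension \<mu> \<rho> P \<psi> \<Gamma> \<longleftrightarrow>
     (\<forall>f\<in>L2 \<mu>. \<Gamma> f \<in> H2_space \<mu> \<rho> P) \<and>
     linear_L2_fields \<mu> (\<mu> \<Otimes>\<^sub>M P) \<Gamma> \<and>
     (\<exists>C. \<forall>f\<in>L2 \<mu>. di_norm (\<mu> \<Otimes>\<^sub>M P) (gabor_dim \<rho>) (\<Gamma> f) \<le> C * L2_norm \<mu> f) \<and>
     (\<forall>f\<in>Cc. AE z in \<mu> \<Otimes>\<^sub>M P. \<Gamma> f z = gabor_Cc \<mu> \<rho> \<psi> f z)"

text \<open>The extension is unique only modulo equality a.e., hence \<open>SOME\<close> rather than \<open>THE\<close>.\<close>

definition gabor ::
    "'g::topological_group_add measure \<Rightarrow> ('g rep set \<Rightarrow> 'g rep) \<Rightarrow> 'g rep set measure \<Rightarrow>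
       ('g \<Rightarrow> complex) \<Rightarrow> ('g \<Rightarrow> complex) \<Rightarrow> 'g \<times> 'g rep set \<Rightarrow> cop" where
  "gabor \<mu> \<rho> P \<psi> = (SOME \<Gamma>. gabor_extension \<mu> \<rho> P \<psi> \<Gamma>)"

text \<open>
  \<open>\<integral> tr[K(y,\<pi>) M\<^sub>\<pi>(L\<^sub>y \<phi>)] d\<sigma>(y,\<pi>)\<close> in the weak sense; again unique only modulo equality a.e.
\<close>

definition weak_gabor_integral ::
    "'g::topological_group_add measure \<Rightarrow> ('g rep set \<Rightarrow> 'g rep) \<Rightarrow> 'g rep set measure \<Rightarrow>
       ('g \<Rightarrow> complex) \<Rightarrow> ('g \<times> 'g rep set \<Rightarrow> cop) \<Rightarrow> 'g \<Rightarrow> complex" where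
  "weak_gabor_integral \<mu> \<rho> P \<phi> K = (SOME h. h \<in> L2 \<mu> \<and>
     (\<forall>g\<in>L2 \<mu>. L2_inner \<mu> h g =
        (LINT z|(\<mu> \<Otimes>\<^sub>M P). tr (gabor_dim \<rho> z) (K z \<circ> adj (gabor_dim \<rho> z) (gabor \<mu> \<rho> P \<phi> g z)))))"

end

theory Submission
  imports Defs
begin

text \<open>
  The reconstruction formula is the weak form of the orthogonality relation
  \<open>\<langle>G\<^sub>\<psi> f, G\<^sub>\<phi> g\<rangle> = \<langle>f, g\<rangle> \<langle>\<phi>, \<psi>\<rangle>\<close> (\<open>gabor_orthogonality\<close>): it says that \<open>\<langle>\<phi>, \<psi>\<rangle> f\<close> has the inner
  products by which the weak integral is specified, and dividing by \<open>\<langle>\<phi>, \<psi>\<rangle>\<close> gives \<open>f\<close>.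

  The relation holds because \<open>G\<^sub>\<psi> f(x, \<cdot>)\<close> is the Fourier transform of the windowed function
  \<open>y \<mapsto> f(y) cnj(\<psi>(x\<^sup>-\<^sup>1y))\<close>, which is integrable for every \<open>x\<close> by Cauchy-Schwarz and
  square-integrable for almost every \<open>x\<close> by Tonelli. So for almost every \<open>x\<close> the Plancherel theorem turns
  the integral over the dual into \<open>\<integral> f(y) cnj(g(y)) \<phi>(x\<^sup>-\<^sup>1y) cnj(\<psi>(x\<^sup>-\<^sup>1y)) dy\<close>, and Fubini separates this
  into \<open>\<langle>f, g\<rangle> \<langle>\<phi>, \<psi>\<rangle>\<close> once \<open>x \<mapsto> x\<^sup>-\<^sup>1y\<close> preserves the measure. The latter is where unimodularity
  enters (\<open>left_diff_distr\<close>); it follows from two-sided invariance by a Fubini argument.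

  Three points need care. Fubini on the product with the dual requires that the Plancherel measure is
  \<open>\<sigma>\<close>-finite (\<open>sigma_finite_plancherel\<close>), which is a consequence of the Plancherel theorem itself: the
  transforms of indicators of small neighbourhoods of the unit are square-integrable fields that do
  not vanish simultaneously anywhere. It also requires that the field \<open>(x, \<pi>) \<mapsto> G\<^sub>\<psi> f(x, \<pi>)\<close> has measurable matrix
  entries, which reduces to joint measurability of the matrix entries of \<open>\<pi>(y)\<close>, continuous in \<open>y\<close> and
  measurable in \<open>\<pi>\<close> (\<open>borel_measurable_caratheodory\<close>). Finally, the transform on \<open>L2\<close> is specified as a
  bounded extension from \<open>Cc\<close> only; the explicit formula defines one such extension, and any
  two agree almost everywhere because \<open>Cc\<close> is dense (\<open>L2_induct_Cc\<close>, \<open>gabor_extension_unique\<close>).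
\<close>

section \<open>Square-summable sequences and Riesz representation\<close>

lemma hil_summable: "u \<in> hil n \<Longrightarrow> summable (\<lambda>i. (cmod (u i))\<^sup>2)"
  by (simp add: hil_def)

lemma hil_outside: "u \<in> hil n \<Longrightarrow> i \<notin> ix n \<Longrightarrow> u i = 0"
  by (simp add: hil_def)

lemma zero_in_hil [simp]: "(\<lambda>_. 0) \<in> hil n"
  by (simp add: hil_def)

lemma unitvec_in_hil_iff [simp]: "unitvec i \<in> hil n \<longleftrightarrow> i \<in> ix n"
proof -
  have "(\<lambda>j. (cmod (unitvec i j))\<^sup>2) = (\<lambda>j. if j = i then 1 else 0)"
    by (auto simp: unitvec_def)
  then have "summable (\<lambda>j. (cmod (unitvec i j))\<^sup>2)"
    by simp
  then show ?thesis
    by (auto simp: hil_def unitvec_def)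
qed

lemma norm_lincomb_power2_le:
  fixes a b x y :: complex
  shows "(cmod (a * x + b * y))\<^sup>2 \<le> 2 * (cmod a)\<^sup>2 * (cmod x)\<^sup>2 + 2 * (cmod b)\<^sup>2 * (cmod y)\<^sup>2"
proof -
  have "(cmod (a * x + b * y))\<^sup>2 \<le> (cmod (a * x) + cmod (b * y))\<^sup>2"
    by (intro power_mono norm_triangle_ineq) auto
  also have "\<dots> \<le> 2 * (cmod (a * x))\<^sup>2 + 2 * (cmod (b * y))\<^sup>2"
    using sum_squares_bound[of "cmod (a * x)" "cmod (b * y)"] by (simp add: power2_sum)
  finally show ?thesis
    by (simp add: norm_mult power_mult_distrib mult.assoc)
qed

lemma hil_lincomb:
  assumes "u \<in> hil n" "v \<in> hil n"
  shows "(\<lambda>i. a * u i + b * v i) \<in> hil n"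
proof -
  have "summable (\<lambda>i. 2 * (cmod a)\<^sup>2 * (cmod (u i))\<^sup>2 + 2 * (cmod b)\<^sup>2 * (cmod (v i))\<^sup>2)"
    using assms by (intro summable_add summable_mult hil_summable)
  then have "summable (\<lambda>i. (cmod (a * u i + b * v i))\<^sup>2)"
    by (rule summable_comparison_test[rotated]) (auto intro: norm_lincomb_power2_le)
  then show ?thesis
    using assms by (simp add: hil_def)
qed

lemma hil_diff: "u \<in> hil n \<Longrightarrow> v \<in> hil n \<Longrightarrow> (\<lambda>i. u i - v i) \<in> hil n"
  using hil_lincomb[of u n v 1 "-1"] by simp

lemma mult_le_half_squares: "x * y \<le> (x\<^sup>2 + y\<^sup>2) / (2 :: real)"
  using sum_squares_bound[of x y] by simp

lemma norm_mult_cnj_le: "cmod (x * cnj y) \<le> ((cmod x)\<^sup>2 + (cmod y)\<^sup>2) / 2"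
  using mult_le_half_squares[of "cmod x" "cmod y"] by (simp add: norm_mult)

lemma cinner_summable_norm:
  assumes "u \<in> hil n" "v \<in> hil m"
  shows "summable (\<lambda>i. cmod (u i * cnj (v i)))"
proof -
  have "summable (\<lambda>i. ((cmod (u i))\<^sup>2 + (cmod (v i))\<^sup>2) / 2)"
    using assms by (intro summable_divide summable_add hil_summable)
  then show ?thesis
    by (rule summable_comparison_test[rotated]) (use norm_mult_cnj_le in \<open>auto simp: norm_mult\<close>)
qed

lemma cinner_sums: "u \<in> hil n \<Longrightarrow> v \<in> hil n \<Longrightarrow> (\<lambda>i. u i * cnj (v i)) sums cinner u v"
  unfolding cinner_def by (rule summable_sums[OF summable_norm_cancel[OF cinner_summable_norm]])

lemma cinner_lincomb_left:
  assumes "u \<in> hil n" "v \<in> hil n" "w \<in> hil n"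
  shows "cinner (\<lambda>i. a * u i + b * v i) w = a * cinner u w + b * cinner v w"
proof -
  have "(\<lambda>i. a * (u i * cnj (w i)) + b * (v i * cnj (w i))) sums (a * cinner u w + b * cinner v w)"
    using assms by (intro sums_add sums_mult cinner_sums[of _ n])
  then have "(\<lambda>i. (a * u i + b * v i) * cnj (w i)) sums (a * cinner u w + b * cinner v w)"
    by (simp add: distrib_right mult.assoc)
  then show ?thesis
    unfolding cinner_def[of "\<lambda>i. a * u i + b * v i"] by (rule sums_unique[symmetric])
qed

lemma cinner_diff_left:
  assumes "u \<in> hil n" "v \<in> hil n" "w \<in> hil n"
  shows "cinner (\<lambda>i. u i - v i) w = cinner u w - cinner v w"
  using cinner_lincomb_left[OF assms, of 1 "-1"] by simp

lemma cinner_commute: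
  assumes "u \<in> hil n" "v \<in> hil n"
  shows "cinner v u = cnj (cinner u v)"
proof -
  have "(\<lambda>i. cnj (u i * cnj (v i))) sums cnj (cinner u v)"
    unfolding sums_cnj using assms by (rule cinner_sums)
  then have "(\<lambda>i. v i * cnj (u i)) sums cnj (cinner u v)"
    by (simp add: mult.commute)
  then show ?thesis
    unfolding cinner_def[of v u] by (rule sums_unique[symmetric])
qed

lemma cinner_self: "u \<in> hil n \<Longrightarrow> cinner u u = of_real (\<Sum>i. (cmod (u i))\<^sup>2)"
  unfolding cinner_def
  by (simp add: complex_norm_square[symmetric] suminf_of_real[OF hil_summable, symmetric] flip: of_real_power)

lemma hnorm_power2: "u \<in> hil n \<Longrightarrow> (hnorm u)\<^sup>2 = (\<Sum>i. (cmod (u i))\<^sup>2)"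
  by (simp add: hnorm_def cinner_self suminf_nonneg hil_summable)

lemma hnorm_nonneg: "u \<in> hil n \<Longrightarrow> 0 \<le> hnorm u"
  by (simp add: hnorm_def cinner_self suminf_nonneg hil_summable)

lemma cinner_self_hnorm: "u \<in> hil n \<Longrightarrow> cinner u u = of_real ((hnorm u)\<^sup>2)"
  by (simp add: cinner_self hnorm_power2 del: of_real_power)

lemma sum_cmod_power2_le:
  assumes "u \<in> hil n"
  shows "(\<Sum>i<N. (cmod (u i))\<^sup>2) \<le> (hnorm u)\<^sup>2"
  unfolding hnorm_power2[OF assms] using hil_summable[OF assms] by (rule sum_le_suminf) auto

text \<open>The finite Cauchy-Schwarz inequality, applied to partial sums, is uniform in their length.\<close>

lemma cinner_Cauchy_Schwarz:
  assumes "u \<in> hil n" "v \<in> hil n"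
  shows "cmod (cinner u v) \<le> hnorm u * hnorm v"
proof -
  have *: "summable (\<lambda>i. cmod (u i * cnj (v i)))"
    using assms by (rule cinner_summable_norm)
  have L2: "L2_set (\<lambda>i. cmod (u i)) {..<N} \<le> hnorm u" if "u \<in> hil n" for u N
    unfolding L2_set_def using sum_cmod_power2_le[OF that, of N] hnorm_nonneg[OF that]
    by (simp add: real_le_lsqrt)
  have "(\<Sum>i<N. cmod (u i * cnj (v i))) \<le> hnorm u * hnorm v" for N
  proof -
    have "(\<Sum>i<N. cmod (u i * cnj (v i))) = (\<Sum>i<N. \<bar>cmod (u i)\<bar> * \<bar>cmod (v i)\<bar>)"
      by (simp add: norm_mult)
    also have "\<dots> \<le> L2_set (\<lambda>i. cmod (u i)) {..<N} * L2_set (\<lambda>i. cmod (v i)) {..<N}"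
      by (rule L2_set_mult_ineq)
    also have "\<dots> \<le> hnorm u * hnorm v"
      using assms by (intro mult_mono L2 L2_set_nonneg hnorm_nonneg)
    finally show ?thesis .
  qed
  then have "(\<Sum>i. cmod (u i * cnj (v i))) \<le> hnorm u * hnorm v"
    using * by (intro suminf_le_const)
  moreover have "cmod (cinner u v) \<le> (\<Sum>i. cmod (u i * cnj (v i)))"
    unfolding cinner_def using * by (rule summable_norm)
  ultimately show ?thesis
    by linarith
qed

lemma cinner_unitvec_right [simp]: "cinner u (unitvec i) = u i"
proof -
  have "(\<lambda>j. u j * cnj (unitvec i j)) = (\<lambda>j. if j = i then u j else 0)"
    by (auto simp: unitvec_def)
  then show ?thesis
    unfolding cinner_def using sums_single[of i u] by (simp add: sums_iff)
qed

text \<open>The representing vector is read off from the values at the unit vectors. Testing the functional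
  on the truncations of this candidate shows that it is square summable; the formula then passes from
  truncations to all vectors by continuity. Both adjoints and weak integrals of operators are obtained
  from this lemma, so that the \<open>THE\<close> in their definitions is justified once.\<close>

lemma riesz_hil:
  assumes lin: "\<And>u v a b. u \<in> hil n \<Longrightarrow> v \<in> hil n \<Longrightarrow>
      l (\<lambda>i. a * u i + b * v i) = a * l u + b * l v"
    and bound: "\<And>u. u \<in> hil n \<Longrightarrow> cmod (l u) \<le> C * hnorm u"
  shows "\<exists>!w. w \<in> hil n \<and> (\<forall>u\<in>hil n. l u = cinner u w)"
proof -
  define w where "w = (\<lambda>i. if i \<in> ix n then cnj (l (unitvec i)) else 0)"
  define trunc :: "nat \<Rightarrow> cseq \<Rightarrow> cseq" where "trunc N u = (\<lambda>i. if i < N then u i else 0)" for N u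
  have trunc_sums: "(\<lambda>i. (cmod (trunc N u i))\<^sup>2) sums (\<Sum>i<N. (cmod (u i))\<^sup>2)" for N u
  proof -
    have "(\<lambda>i. (cmod (trunc N u i))\<^sup>2) = (\<lambda>i. if i \<in> {..<N} then (cmod (u i))\<^sup>2 else 0)"
      by (auto simp: trunc_def)
    then show ?thesis
      using sums_If_finite_set[of "{..<N}" "\<lambda>i. (cmod (u i))\<^sup>2"] by simp
  qed
  have trunc_hil: "trunc N u \<in> hil n" if "\<And>i. i \<notin> ix n \<Longrightarrow> u i = 0" for N u
    using trunc_sums[of N u] that by (auto simp: hil_def sums_iff trunc_def)
  have l_trunc: "l (trunc N u) = (\<Sum>i<N. u i * cnj (w i))" if "\<And>i. i \<notin> ix n \<Longrightarrow> u i = 0" for N u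
  proof (induction N)
    case 0
    have "trunc 0 u = (\<lambda>i. 0 * (0::complex) + 0 * 0)"
      by (simp add: trunc_def)
    then show ?case
      using lin[of "\<lambda>_. 0" "\<lambda>_. 0" 0 0] by simp
  next
    case (Suc N)
    show ?case
    proof (cases "N \<in> ix n")
      case True
      have "trunc (Suc N) u = (\<lambda>i. 1 * trunc N u i + u N * unitvec N i)"
        by (auto simp: trunc_def unitvec_def less_Suc_eq)
      then have "l (trunc (Suc N) u) = 1 * l (trunc N u) + u N * l (unitvec N)"
        using lin[of "trunc N u" "unitvec N" 1 "u N"] trunc_hil[OF that] True by simp
      then show ?thesis
        using Suc True by (simp add: w_def)
    next
      case False
      then have "trunc (Suc N) u = trunc N u"
        using that by (auto simp: trunc_def less_Suc_eq)
      then show ?thesis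
        using Suc False that by simp
    qed
  qed
  have w0: "w i = 0" if "i \<notin> ix n" for i
    using that by (simp add: w_def)
  have tw: "trunc N w \<in> hil n" for N
    using trunc_hil w0 by blast
  have lw: "l (trunc N w) = (\<Sum>i<N. w i * cnj (w i))" for N
    using l_trunc w0 by blast
  have "(\<Sum>i<N. (cmod (w i))\<^sup>2) \<le> C\<^sup>2" for N
  proof -
    define S where "S = (\<Sum>i<N. (cmod (w i))\<^sup>2)"
    have S0: "0 \<le> S" by (auto simp: S_def intro: sum_nonneg)
    have "hnorm (trunc N w) = sqrt S"
      using hnorm_power2[OF tw, of N] trunc_sums[of N w] hnorm_nonneg[OF tw, of N]
      by (simp add: sums_iff S_def real_sqrt_unique)
    moreover have "l (trunc N w) = of_real S"
      unfolding lw S_def of_real_sum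
      by (intro sum.cong) (auto simp: complex_norm_square simp flip: of_real_power)
    ultimately have "S \<le> C * sqrt S"
      using bound[OF tw, of N] S0 by simp
    \<comment> \<open>Cancelling one factor \<open>sqrt S\<close> bounds \<open>S\<close> independently of \<open>N\<close>.\<close>
    then have "sqrt S * sqrt S \<le> C * sqrt S"
      using S0 by simp
    then have "sqrt S \<le> C \<or> S = 0"
      using S0 by (metis dual_order.antisym less_eq_real_def mult_le_cancel_right real_sqrt_eq_zero_cancel real_sqrt_ge_zero)
    then show ?thesis
      unfolding S_def[symmetric] using S0 by (metis real_sqrt_ge_zero real_sqrt_pow2 power_mono zero_le_power2)
  qed
  then have "summable (\<lambda>i. (cmod (w i))\<^sup>2)"
    by (intro summableI_nonneg_bounded[where x = "C\<^sup>2"]) auto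
  then have w: "w \<in> hil n"
    using w0 by (simp add: hil_def)
  have "l u = cinner u w" if u: "u \<in> hil n" for u
  proof -
    have u0: "\<And>i. i \<notin> ix n \<Longrightarrow> u i = 0"
      using u by (rule hil_outside)
    define d where "d N = (\<lambda>i. u i - trunc N u i)" for N
    have tu: "trunc N u \<in> hil n" for N
      using trunc_hil u0 by blast
    have d: "d N \<in> hil n" for N
      unfolding d_def using u tu by (rule hil_diff)
    have ld: "l (d N) = l u - (\<Sum>i<N. u i * cnj (w i))" for N
      using lin[OF u tu, of 1 "-1" N] l_trunc[of u N] u0 by (simp add: d_def)
    have dn: "(hnorm (d N))\<^sup>2 = (\<Sum>i. (cmod (u i))\<^sup>2) - (\<Sum>i<N. (cmod (u i))\<^sup>2)" for N
    proof -
      have "(\<lambda>i. (cmod (u i))\<^sup>2 - (cmod (trunc N u i))\<^sup>2) sums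
          ((\<Sum>i. (cmod (u i))\<^sup>2) - (\<Sum>i<N. (cmod (u i))\<^sup>2))"
        by (intro sums_diff trunc_sums summable_sums hil_summable[OF u])
      moreover have "(\<lambda>i. (cmod (u i))\<^sup>2 - (cmod (trunc N u i))\<^sup>2) = (\<lambda>i. (cmod (d N i))\<^sup>2)"
        by (auto simp: trunc_def d_def)
      ultimately show ?thesis
        by (simp add: hnorm_power2[OF d] sums_iff)
    qed
    have "(\<lambda>N. (hnorm (d N))\<^sup>2) \<longlonglongrightarrow> (\<Sum>i. (cmod (u i))\<^sup>2) - (\<Sum>i. (cmod (u i))\<^sup>2)"
      unfolding dn by (intro tendsto_diff tendsto_const summable_LIMSEQ hil_summable[OF u])
    then have "(\<lambda>N. sqrt ((hnorm (d N))\<^sup>2)) \<longlonglongrightarrow> sqrt 0"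
      by (intro tendsto_real_sqrt) simp
    then have "(\<lambda>N. C * hnorm (d N)) \<longlonglongrightarrow> C * 0"
      using hnorm_nonneg[OF d] by (intro tendsto_mult) auto
    then have "(\<lambda>N. l (d N)) \<longlonglongrightarrow> 0"
      by (rule Lim_null_comparison[rotated, OF tendsto_eq_rhs]) (auto intro!: always_eventually bound d)
    then have "(\<lambda>N. l u - l (d N)) \<longlonglongrightarrow> l u - 0"
      by (intro tendsto_diff tendsto_const)
    moreover have "(\<lambda>N. l u - l (d N)) \<longlonglongrightarrow> cinner u w"
      unfolding ld using cinner_sums[OF u w] by (simp add: sums_def)
    ultimately show ?thesis
      using LIMSEQ_unique by fastforce
  qed
  moreover have "w' = w" if "w' \<in> hil n" "\<forall>u\<in>hil n. l u = cinner u w'" for w'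
  proof
    fix i
    show "w' i = w i"
    proof (cases "i \<in> ix n")
      case True
      then have "cinner (unitvec i) w' = l (unitvec i)"
        using that by simp
      then show ?thesis
        using that True cinner_commute[of w' n "unitvec i"] cinner_unitvec_right[of w' i]
        by (auto simp: w_def)
    qed (use that w0 hil_outside in auto)
  qed
  ultimately show ?thesis
    using w by blast
qed

section \<open>Bounded and Hilbert-Schmidt operators\<close>

lemma bounded_ops_in_hil: "T \<in> bounded_ops n \<Longrightarrow> T u \<in> hil n"
  unfolding bounded_ops_def linear_on_hil_def
  by (cases "u \<in> hil n") auto

lemma bounded_ops_outside: "T \<in> bounded_ops n \<Longrightarrow> u \<notin> hil n \<Longrightarrow> T u = (\<lambda>_. 0)"
  unfolding bounded_ops_def by auto

lemma bounded_ops_lincomb: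
  "T \<in> bounded_ops n \<Longrightarrow> u \<in> hil n \<Longrightarrow> v \<in> hil n \<Longrightarrow>
    T (\<lambda>i. a * u i + b * v i) = (\<lambda>i. a * T u i + b * T v i)"
  unfolding bounded_ops_def linear_on_hil_def by auto

lemma bounded_ops_bound:
  assumes "T \<in> bounded_ops n"
  obtains C where "\<And>u. u \<in> hil n \<Longrightarrow> hnorm (T u) \<le> C * hnorm u"
proof -
  obtain C where "\<forall>u\<in>hil n. hnorm (T u) \<le> C * hnorm u"
    using assms unfolding bounded_ops_def by auto
  then show thesis
    using that by blast
qed

lemma adj_exists:
  assumes T: "T \<in> bounded_ops n" and v: "v \<in> hil n"
  shows "\<exists>!w. w \<in> hil n \<and> (\<forall>u\<in>hil n. cinner (T u) v = cinner u w)"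
proof -
  obtain C where C: "\<And>u. u \<in> hil n \<Longrightarrow> hnorm (T u) \<le> C * hnorm u"
    using bounded_ops_bound[OF T] by metis
  show ?thesis
  proof (rule riesz_hil)
    fix u u' a b assume u: "u \<in> hil n" "u' \<in> hil n"
    show "cinner (T (\<lambda>i. a * u i + b * u' i)) v = a * cinner (T u) v + b * cinner (T u') v"
      unfolding bounded_ops_lincomb[OF T u]
      using bounded_ops_in_hil[OF T] bounded_ops_in_hil[OF T] v by (rule cinner_lincomb_left)
  next
    fix u assume u: "u \<in> hil n"
    have "cmod (cinner (T u) v) \<le> hnorm (T u) * hnorm v"
      using bounded_ops_in_hil[OF T] v by (rule cinner_Cauchy_Schwarz)
    also have "\<dots> \<le> (C * hnorm u) * hnorm v"
      using C[OF u] hnorm_nonneg[OF v] by (rule mult_right_mono)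
    finally show "cmod (cinner (T u) v) \<le> (C * hnorm v) * hnorm u"
      by (simp add: mult_ac)
  qed
qed

lemma adj_in_hil: "T \<in> bounded_ops n \<Longrightarrow> v \<in> hil n \<Longrightarrow> adj n T v \<in> hil n"
  and cinner_adj_right: "T \<in> bounded_ops n \<Longrightarrow> v \<in> hil n \<Longrightarrow> u \<in> hil n \<Longrightarrow> cinner u (adj n T v) = cinner (T u) v"
  using theI'[OF adj_exists, of T n v] unfolding adj_def by auto

lemma cinner_adj_left:
  "T \<in> bounded_ops n \<Longrightarrow> v \<in> hil n \<Longrightarrow> u \<in> hil n \<Longrightarrow> cinner (adj n T v) u = cinner v (T u)"
  by (metis cinner_adj_right cinner_commute adj_in_hil bounded_ops_in_hil)

lemma adj_entry:
  assumes "T \<in> bounded_ops n" "i \<in> ix n" "j \<in> ix n"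
  shows "adj n T (unitvec j) i = cnj (T (unitvec i) j)"
proof -
  have "adj n T (unitvec j) i = cinner (adj n T (unitvec j)) (unitvec i)" by simp
  also have "\<dots> = cinner (unitvec j) (T (unitvec i))"
    using assms by (intro cinner_adj_left) auto
  also have "\<dots> = cnj (cinner (T (unitvec i)) (unitvec j))"
    using assms by (intro cinner_commute) (auto intro: bounded_ops_in_hil)
  finally show ?thesis by simp
qed

lemma bounded_ops_entry_outside: "T \<in> bounded_ops n \<Longrightarrow> i \<notin> ix n \<or> j \<notin> ix n \<Longrightarrow> T (unitvec i) j = 0"
  using bounded_ops_outside[of T n "unitvec i"] hil_outside[OF bounded_ops_in_hil] by auto

text \<open>A bounded operator is determined by its matrix: the adjoint at a unit vector has the conjugate entries as
  its components, and it determines the components of all values.\<close>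

lemma bounded_ops_eqI:
  assumes T: "T \<in> bounded_ops n" and S: "S \<in> bounded_ops n"
    and eq: "\<And>i j. T (unitvec i) j = S (unitvec i) j"
  shows "T = S"
proof (intro ext)
  fix u j
  consider "u \<notin> hil n" | "j \<notin> ix n" | "u \<in> hil n" "j \<in> ix n" by blast
  then show "T u j = S u j"
  proof cases
    case 1
    then show ?thesis using T S by (simp add: bounded_ops_outside)
  next
    case 2
    then show ?thesis using T S by (simp add: hil_outside[OF bounded_ops_in_hil])
  next
    case 3
    have "adj n T (unitvec j) = adj n S (unitvec j)"
    proof
      fix i
      show "adj n T (unitvec j) i = adj n S (unitvec j) i"
        using 3 T S eq hil_outside[OF adj_in_hil[of _ n "unitvec j"], of _ i] by (cases "i \<in> ix n") (auto simp: adj_entry)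
    qed
    then have "cinner (T u) (unitvec j) = cinner (S u) (unitvec j)"
      using 3 T S by (metis cinner_adj_right unitvec_in_hil_iff)
    then show ?thesis by simp
  qed
qed

text \<open>The squared Hilbert-Schmidt norm, with values in \<open>[0, \<infinity>]\<close> so that it makes sense for every
  operator and is a measurable function of the matrix entries.\<close>

definition hs_norm2 :: "cop \<Rightarrow> ennreal" where
  "hs_norm2 T = (\<Sum>i. \<Sum>j. ennreal ((cmod (T (unitvec i) j))\<^sup>2))"

lemma hs_norm2_hnorm:
  assumes "T \<in> bounded_ops n"
  shows "hs_norm2 T = (\<Sum>i. ennreal ((hnorm (T (unitvec i)))\<^sup>2))"
  unfolding hs_norm2_def hnorm_power2[OF bounded_ops_in_hil[OF assms]]
  by (simp add: suminf_ennreal2 hil_summable[OF bounded_ops_in_hil[OF assms]])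

lemma HS_summable_iff:
  assumes T: "T \<in> bounded_ops n"
  shows "(\<lambda>i. (hnorm (T (unitvec i)))\<^sup>2) summable_on ix n \<longleftrightarrow> summable (\<lambda>i. (hnorm (T (unitvec i)))\<^sup>2)"
proof -
  have "hnorm (T (unitvec i)) = 0" if "i \<notin> ix n" for i
    using T that by (simp add: bounded_ops_outside hnorm_def cinner_def)
  then have "(\<lambda>i. (hnorm (T (unitvec i)))\<^sup>2) summable_on ix n \<longleftrightarrow> (\<lambda>i. (hnorm (T (unitvec i)))\<^sup>2) summable_on UNIV"
    by (intro summable_on_cong_neutral) auto
  then show ?thesis
    by (simp add: summable_on_UNIV_nonneg_real_iff)
qed

lemma HS_iff: "T \<in> HS n \<longleftrightarrow> T \<in> bounded_ops n \<and> hs_norm2 T < \<infinity>"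
proof (cases "T \<in> bounded_ops n")
  case True
  let ?h = "\<lambda>i. (hnorm (T (unitvec i)))\<^sup>2"
  have "hs_norm2 T < \<infinity>" if "summable ?h"
  proof -
    have "hs_norm2 T = ennreal (\<Sum>i. ?h i)"
      unfolding hs_norm2_hnorm[OF True] using that by (rule suminf_ennreal2[OF zero_le_power2])
    then show ?thesis
      by simp
  qed
  moreover have "summable ?h" if "hs_norm2 T < \<infinity>"
  proof (rule summable_suminf_not_top[OF zero_le_power2])
    show "(\<Sum>i. ennreal (?h i)) \<noteq> top"
      using that unfolding hs_norm2_hnorm[OF True] by (metis infinity_ennreal_def less_irrefl)
  qed
  ultimately have "summable ?h \<longleftrightarrow> hs_norm2 T < \<infinity>"
    by blast
  then show ?thesis
    using True HS_summable_iff[OF True] by (simp add: HS_def)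
qed (simp add: HS_def)

lemma HS_bounded_ops: "T \<in> HS n \<Longrightarrow> T \<in> bounded_ops n"
  by (simp add: HS_def)

lemma HS_summable_on:
  assumes "T \<in> HS n"
  shows "(\<lambda>(i, j). (cmod (T (unitvec i) j))\<^sup>2) summable_on UNIV \<times> UNIV"
proof -
  have T: "T \<in> bounded_ops n"
    using assms by (rule HS_bounded_ops)
  have 1: "(\<lambda>j. (cmod (T (unitvec i) j))\<^sup>2) summable_on UNIV" for i
    using hil_summable[OF bounded_ops_in_hil[OF T]] by (simp add: summable_on_UNIV_nonneg_real_iff)
  have "(\<Sum>\<^sub>\<infinity>j. (cmod (T (unitvec i) j))\<^sup>2) = (hnorm (T (unitvec i)))\<^sup>2" for i
    unfolding hnorm_power2[OF bounded_ops_in_hil[OF T]]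
    using has_sum_imp_sums[OF has_sum_infsum[OF 1]] by (simp add: sums_iff)
  then have 2: "(\<lambda>i. \<Sum>\<^sub>\<infinity>j. (cmod (T (unitvec i) j))\<^sup>2) summable_on UNIV"
    using assms HS_summable_iff[OF T] by (simp add: summable_on_UNIV_nonneg_real_iff HS_def)
  let ?g = "\<lambda>(i, j). (cmod (T (unitvec i) j))\<^sup>2"
  have "(\<lambda>x. norm (?g x)) summable_on UNIV \<times> UNIV"
  proof (rule Infinite_Sum.abs_summable_on_Sigma_iff[THEN iffD2], intro conjI ballI)
    show "(\<lambda>j. norm (?g (i, j))) summable_on UNIV" for i
      using 1 by simp
    have "infsum (\<lambda>j. norm (?g (i, j))) UNIV = (\<Sum>\<^sub>\<infinity>j. (cmod (T (unitvec i) j))\<^sup>2)" for i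
      by simp
    moreover have "norm (\<Sum>\<^sub>\<infinity>j. (cmod (T (unitvec i) j))\<^sup>2) = (\<Sum>\<^sub>\<infinity>j. (cmod (T (unitvec i) j))\<^sup>2)" for i
      unfolding real_norm_def by (rule abs_of_nonneg) (auto intro: infsum_nonneg)
    ultimately show "(\<lambda>i. norm (infsum (\<lambda>j. norm (?g (i, j))) UNIV)) summable_on UNIV"
      using 2 by presburger
  qed
  then show ?thesis
    by (rule abs_summable_summable)
qed

lemma HS_pairing_abs_summable:
  assumes "F \<in> HS n" "K \<in> HS n"
  shows "(\<lambda>x. norm ((\<lambda>(i, j). F (unitvec i) j * cnj (K (unitvec i) j)) x)) summable_on UNIV \<times> UNIV"
proof (rule Infinite_Sum.abs_summable_on_comparison_test')
  show "(\<lambda>x. (1/2) * ((\<lambda>(i, j). (cmod (F (unitvec i) j))\<^sup>2) x + (\<lambda>(i, j). (cmod (K (unitvec i) j))\<^sup>2) x))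
      summable_on UNIV \<times> UNIV"
    using assms by (intro summable_on_cmult_right summable_on_add HS_summable_on)
qed (use norm_mult_cnj_le in \<open>auto simp: norm_mult\<close>)

lemma infsum_eq_suminf: "f summable_on UNIV \<Longrightarrow> infsum f UNIV = (\<Sum>i::nat. f i)"
  using has_sum_imp_sums[OF has_sum_infsum, of f] by (simp add: sums_iff)

text \<open>Both traces are the absolutely convergent double sum of products of matrix entries, with the two
  summations in different orders. The first form shows that the trace is a measurable function of the
  entries; the second one reconciles the order of factors in the weak integral with that in the inner
  product.\<close>

lemma HS_tr_adj_comp:
  assumes "F \<in> HS n" "K \<in> HS n"
  shows "tr n (adj n K \<circ> F) = (\<Sum>i. \<Sum>j. F (unitvec i) j * cnj (K (unitvec i) j))"
    and "tr n (F \<circ> adj n K) = tr n (adj n K \<circ> F)"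
proof -
  note F = HS_bounded_ops[OF assms(1)] and K = HS_bounded_ops[OF assms(2)]
  define c where "c i j = F (unitvec i) j * cnj (K (unitvec i) j)" for i j
  have "(\<lambda>x. norm ((\<lambda>(i, j). c i j) x)) summable_on UNIV \<times> UNIV"
    using HS_pairing_abs_summable[OF assms] by (simp add: c_def)
  then have abs: "(\<lambda>(i, j). c i j) summable_on UNIV \<times> UNIV"
    by (rule abs_summable_summable)
  have inner: "(\<Sum>\<^sub>\<infinity>j. c i j) = cinner (F (unitvec i)) (K (unitvec i))" for i
    unfolding c_def cinner_def
    using cinner_summable_norm[OF bounded_ops_in_hil[OF F] bounded_ops_in_hil[OF K]]
    by (intro infsum_eq_suminf norm_summable_imp_summable_on)
  have "tr n (adj n K \<circ> F) = (\<Sum>\<^sub>\<infinity>i\<in>ix n. \<Sum>\<^sub>\<infinity>j. c i j)"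
    unfolding tr_def inner
    by (intro infsum_cong) (auto intro!: cinner_adj_left simp: K bounded_ops_in_hil[OF F] simp del: cinner_unitvec_right)
  also have "\<dots> = (\<Sum>\<^sub>\<infinity>i. \<Sum>\<^sub>\<infinity>j. c i j)"
    unfolding c_def by (intro infsum_cong_neutral) (auto simp: bounded_ops_entry_outside[OF F])
  finally have 1: "tr n (adj n K \<circ> F) = (\<Sum>\<^sub>\<infinity>i. \<Sum>\<^sub>\<infinity>j. c i j)" .
  also have "\<dots> = (\<Sum>i. \<Sum>\<^sub>\<infinity>j. c i j)"
    using summable_on_Sigma_banach[OF abs] by (rule infsum_eq_suminf)
  also have "\<dots> = (\<Sum>i. \<Sum>j. c i j)"
    unfolding inner by (simp add: c_def cinner_def)
  finally show "tr n (adj n K \<circ> F) = (\<Sum>i. \<Sum>j. F (unitvec i) j * cnj (K (unitvec i) j))"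
    by (simp add: c_def)
  have "tr n (F \<circ> adj n K) = (\<Sum>\<^sub>\<infinity>j\<in>ix n. \<Sum>\<^sub>\<infinity>i. c i j)"
    unfolding tr_def
  proof (rule infsum_cong)
    fix j assume j: "j \<in> ix n"
    then have a: "adj n F (unitvec j) \<in> hil n" "adj n K (unitvec j) \<in> hil n"
      using F K by (auto intro: adj_in_hil)
    have "cinner ((F \<circ> adj n K) (unitvec j)) (unitvec j) = cinner (adj n K (unitvec j)) (adj n F (unitvec j))"
      using j a F by (simp add: cinner_adj_right del: cinner_unitvec_right)
    also have "\<dots> = (\<Sum>\<^sub>\<infinity>i. adj n K (unitvec j) i * cnj (adj n F (unitvec j) i))"
      unfolding cinner_def using cinner_summable_norm[OF a(2,1)]
      by (intro infsum_eq_suminf[symmetric] norm_summable_imp_summable_on)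
    also have "\<dots> = (\<Sum>\<^sub>\<infinity>i. c i j)"
    proof (rule infsum_cong)
      fix i
      show "adj n K (unitvec j) i * cnj (adj n F (unitvec j) i) = c i j"
        using j F K a by (cases "i \<in> ix n")
          (auto simp: adj_entry c_def hil_outside bounded_ops_entry_outside)
    qed
    finally show "cinner ((F \<circ> adj n K) (unitvec j)) (unitvec j) = (\<Sum>\<^sub>\<infinity>i. c i j)" .
  qed
  also have "\<dots> = (\<Sum>\<^sub>\<infinity>j. \<Sum>\<^sub>\<infinity>i. c i j)"
    unfolding c_def by (intro infsum_cong_neutral) (auto simp: bounded_ops_entry_outside[OF F])
  also have "\<dots> = (\<Sum>\<^sub>\<infinity>i. \<Sum>\<^sub>\<infinity>j. c i j)"
    using infsum_swap_banach[OF abs] by simp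
  finally show "tr n (F \<circ> adj n K) = tr n (adj n K \<circ> F)"
    using 1 by simp
qed

lemma HS_summable: "T \<in> HS n \<Longrightarrow> summable (\<lambda>i. (hnorm (T (unitvec i)))\<^sup>2)"
  using HS_summable_iff[OF HS_bounded_ops, of T n] by (simp add: HS_def)

lemma tr_adj_comp_self:
  assumes "T \<in> HS n"
  shows "tr n (adj n T \<circ> T) = of_real (\<Sum>i. (hnorm (T (unitvec i)))\<^sup>2)"
proof -
  note T = HS_bounded_ops[OF assms]
  have "tr n (adj n T \<circ> T) = (\<Sum>i. cinner (T (unitvec i)) (T (unitvec i)))"
    using HS_tr_adj_comp(1)[OF assms assms] by (simp add: cinner_def)
  also have "\<dots> = (\<Sum>i. complex_of_real ((hnorm (T (unitvec i)))\<^sup>2))"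
    unfolding cinner_self_hnorm[OF bounded_ops_in_hil[OF T]] ..
  also have "\<dots> = of_real (\<Sum>i. (hnorm (T (unitvec i)))\<^sup>2)"
    using HS_summable[OF assms] by (rule suminf_of_real[symmetric])
  finally show ?thesis .
qed

lemma hs_norm2_HS:
  assumes "T \<in> HS n"
  shows "hs_norm2 T = ennreal (\<Sum>i. (hnorm (T (unitvec i)))\<^sup>2)"
  unfolding hs_norm2_hnorm[OF HS_bounded_ops[OF assms]]
  by (rule suminf_ennreal2[OF zero_le_power2 HS_summable[OF assms]])

lemma HS_tr_self:
  assumes "T \<in> HS n"
  shows "tr n (adj n T \<circ> T) = of_real (enn2real (hs_norm2 T))"
    and "ennreal (Re (tr n (adj n T \<circ> T))) = hs_norm2 T"
proof -
  define S where "S = (\<Sum>i. (hnorm (T (unitvec i)))\<^sup>2)"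
  have "0 \<le> S"
    unfolding S_def using HS_summable[OF assms] by (rule suminf_nonneg) simp
  then show "tr n (adj n T \<circ> T) = of_real (enn2real (hs_norm2 T))"
    "ennreal (Re (tr n (adj n T \<circ> T))) = hs_norm2 T"
    unfolding tr_adj_comp_self[OF assms] hs_norm2_HS[OF assms] S_def[symmetric] by simp_all
qed

text \<open>The dominating function for pairings of two square-integrable fields.\<close>

lemma HS_tr_adj_comp_bound:
  assumes "F \<in> HS n" "K \<in> HS n"
  shows "cmod (tr n (adj n K \<circ> F)) \<le> (Re (tr n (adj n F \<circ> F)) + Re (tr n (adj n K \<circ> K))) / 2"
proof -
  note FK = HS_bounded_ops[OF assms(1), THEN bounded_ops_in_hil] HS_bounded_ops[OF assms(2), THEN bounded_ops_in_hil]
  define f k where "f = (\<lambda>i. (hnorm (F (unitvec i)))\<^sup>2)" and "k = (\<lambda>i. (hnorm (K (unitvec i)))\<^sup>2)"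
  have s: "summable f" "summable k"
    unfolding f_def k_def using HS_summable[OF assms(1)] HS_summable[OF assms(2)] by auto
  have le: "cmod (cinner (F (unitvec i)) (K (unitvec i))) \<le> (f i + k i) / 2" for i
  proof -
    have "cmod (cinner (F (unitvec i)) (K (unitvec i))) \<le> hnorm (F (unitvec i)) * hnorm (K (unitvec i))"
      using FK by (rule cinner_Cauchy_Schwarz)
    also have "\<dots> \<le> (f i + k i) / 2"
      unfolding f_def k_def by (rule mult_le_half_squares)
    finally show ?thesis .
  qed
  have sd: "summable (\<lambda>i. (f i + k i) / 2)"
    by (rule summable_divide[OF summable_add[OF s]])
  have sn: "summable (\<lambda>i. cmod (cinner (F (unitvec i)) (K (unitvec i))))"
    by (rule summable_comparison_test[OF _ sd]) (use le in auto)
  have "cmod (\<Sum>i. cinner (F (unitvec i)) (K (unitvec i))) \<le> (\<Sum>i. cmod (cinner (F (unitvec i)) (K (unitvec i))))"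
    using sn by (rule summable_norm)
  also have "\<dots> \<le> (\<Sum>i. (f i + k i) / 2)"
    using sn sd by (intro suminf_le le)
  also have "\<dots> = ((\<Sum>i. f i) + (\<Sum>i. k i)) / 2"
    using suminf_divide[OF summable_add[OF s], of 2] suminf_add[OF s] by simp
  finally show ?thesis
    unfolding HS_tr_adj_comp(1)[OF assms] tr_adj_comp_self[OF assms(1)] tr_adj_comp_self[OF assms(2)]
      cinner_def[symmetric] f_def k_def Re_complex_of_real .
qed

lemma ennreal_term_le_suminf: "f i \<le> (\<Sum>i. f i)" for f :: "nat \<Rightarrow> ennreal"
  using sum_le_suminf[OF summableI, of "{i}" f] by simp

lemma entry_le_hs_norm2: "ennreal ((cmod (T (unitvec i) j))\<^sup>2) \<le> hs_norm2 T"
  unfolding hs_norm2_def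
  by (rule order_trans[OF ennreal_term_le_suminf[of _ j]
      ennreal_term_le_suminf[of "\<lambda>i. \<Sum>j. ennreal ((cmod (T (unitvec i) j))\<^sup>2)" i]])

section \<open>Unitary representations and their weak integrals\<close>

context
  fixes n :: enat and \<pi> :: "'g::topological_group_add \<Rightarrow> cop"
  assumes rep: "unitary_rep (n, \<pi>)"
begin

lemma rep_bounded_ops: "\<pi> x \<in> bounded_ops n"
  using rep by (simp add: unitary_rep_def)

lemma rep_in_hil: "\<pi> x u \<in> hil n"
  by (rule bounded_ops_in_hil[OF rep_bounded_ops])

lemma rep_add: "\<pi> (x + y) = \<pi> x \<circ> \<pi> y"
  using rep by (simp add: unitary_rep_def)

lemma rep_cinner: "u \<in> hil n \<Longrightarrow> v \<in> hil n \<Longrightarrow> cinner (\<pi> x u) (\<pi> x v) = cinner u v"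
  using rep by (simp add: unitary_rep_def unitary_hil_def isometry_hil_def)

lemma rep_hnorm: "u \<in> hil n \<Longrightarrow> hnorm (\<pi> x u) = hnorm u"
  by (simp add: hnorm_def rep_cinner)

lemma rep_zero:
  assumes u: "u \<in> hil n"
  shows "\<pi> 0 u = u"
proof -
  have "\<pi> 0 ` hil n = hil n"
    using rep by (simp add: unitary_rep_def unitary_hil_def)
  then obtain v where v: "v \<in> hil n" "u = \<pi> 0 v"
    using u by blast
  have "\<pi> 0 (\<pi> 0 v) = \<pi> 0 v"
    using rep_add[of 0 0] by (metis add.right_neutral comp_apply)
  then show ?thesis
    using v by simp
qed

text \<open>\<open>\<pi>(x)\<close> cancels \<open>\<pi>(-x)\<close> only on \<open>hil n\<close>, which contains the range of \<open>T\<close>.\<close>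

lemma rep_minus_comp:
  assumes T: "T \<in> bounded_ops n"
  shows "\<pi> x \<circ> (\<pi> (- x) \<circ> T) = T"
proof
  fix u
  have "(\<pi> x \<circ> (\<pi> (- x) \<circ> T)) u = \<pi> (x + (- x)) (T u)"
    unfolding rep_add by simp
  also have "\<dots> = T u"
    using rep_zero[OF bounded_ops_in_hil[OF T]] by simp
  finally show "(\<pi> x \<circ> (\<pi> (- x) \<circ> T)) u = T u" .
qed

lemma rep_comp_bounded_ops:
  assumes T: "T \<in> bounded_ops n"
  shows "\<pi> x \<circ> T \<in> bounded_ops n"
proof -
  have "linear_on_hil n n (\<pi> x \<circ> T)"
    unfolding linear_on_hil_def
    using bounded_ops_lincomb[OF T] bounded_ops_lincomb[OF rep_bounded_ops] bounded_ops_in_hil[OF T] rep_in_hil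
    by auto
  moreover have "(\<pi> x \<circ> T) u = (\<lambda>_. 0)" if "u \<notin> hil n" for u
  proof -
    have "\<pi> x (\<lambda>_. 0) = (\<lambda>i. 0 * \<pi> x (\<lambda>_. 0) i + 0 * \<pi> x (\<lambda>_. 0) i)"
      using bounded_ops_lincomb[OF rep_bounded_ops zero_in_hil zero_in_hil, of x 0 0] by simp
    then show ?thesis
      using bounded_ops_outside[OF T that] by simp
  qed
  moreover obtain C where "\<And>u. u \<in> hil n \<Longrightarrow> hnorm (T u) \<le> C * hnorm u"
    using bounded_ops_bound[OF T] by metis
  then have "\<forall>u\<in>hil n. hnorm ((\<pi> x \<circ> T) u) \<le> C * hnorm u"
    by (simp add: rep_hnorm[OF bounded_ops_in_hil[OF T]])
  ultimately show ?thesis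
    unfolding bounded_ops_def by blast
qed

lemma rep_comp_HS:
  assumes T: "T \<in> HS n"
  shows "\<pi> x \<circ> T \<in> HS n"
  using T rep_comp_bounded_ops[OF HS_bounded_ops[OF T]]
  by (simp add: HS_def rep_hnorm[OF bounded_ops_in_hil[OF HS_bounded_ops[OF T]]])

text \<open>As \<open>\<pi>(x)\<close> is unitary, the fibre \<open>\<pi>(x) HS\<close> is as a set just \<open>HS\<close>.\<close>

lemma rep_comp_HS_eq: "{\<pi> x \<circ> T | T. T \<in> HS n} = HS n"
proof (intro equalityI subsetI)
  fix T assume T: "T \<in> HS n"
  show "T \<in> {\<pi> x \<circ> T | T. T \<in> HS n}"
    using rep_minus_comp[OF HS_bounded_ops[OF T], of x] rep_comp_HS[OF T, of "- x"]
    unfolding mem_Collect_eq by metis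
next
  fix T assume "T \<in> {\<pi> x \<circ> T | T. T \<in> HS n}"
  then show "T \<in> HS n"
    using rep_comp_HS by blast
qed

text \<open>Strong continuity of \<open>\<pi>\<close> implies weak continuity by Cauchy-Schwarz.\<close>

lemma rep_cinner_continuous:
  assumes u: "u \<in> hil n" and v: "v \<in> hil n"
  shows "continuous_on UNIV (\<lambda>y. cinner u (\<pi> y v))"
  unfolding continuous_on_def
proof
  fix x :: 'g
  have "((\<lambda>y. hnorm (\<lambda>i. \<pi> y v i - \<pi> x v i)) \<longlongrightarrow> 0) (at x)"
    using rep v by (simp add: unitary_rep_def)
  then have lim: "((\<lambda>y. hnorm u * hnorm (\<lambda>i. \<pi> y v i - \<pi> x v i)) \<longlongrightarrow> 0) (at x)"
    by (rule tendsto_mult_right_zero)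
  have "cmod (cinner u (\<pi> y v) - cinner u (\<pi> x v)) \<le> hnorm u * hnorm (\<lambda>i. \<pi> y v i - \<pi> x v i)" for y
  proof -
    have d: "(\<lambda>i. \<pi> y v i - \<pi> x v i) \<in> hil n"
      by (intro hil_diff rep_in_hil)
    have "cinner u (\<pi> y v) - cinner u (\<pi> x v) = cnj (cinner (\<lambda>i. \<pi> y v i - \<pi> x v i) u)"
      by (simp only: cinner_diff_left[OF rep_in_hil rep_in_hil u] complex_cnj_diff cinner_commute[OF rep_in_hil u])
    also have "\<dots> = cinner u (\<lambda>i. \<pi> y v i - \<pi> x v i)"
      by (rule cinner_commute[OF d u, symmetric])
    finally show ?thesis
      using cinner_Cauchy_Schwarz[OF u d] by simp
  qed
  then have "((\<lambda>y. cinner u (\<pi> y v) - cinner u (\<pi> x v)) \<longlongrightarrow> 0) (at x)"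
    by (intro Lim_null_comparison[OF _ lim] always_eventually) auto
  then show "((\<lambda>y. cinner u (\<pi> y v)) \<longlongrightarrow> cinner u (\<pi> x v)) (at x within UNIV)"
    by (simp add: LIM_zero_iff)
qed

lemma rep_cinner_bound: "u \<in> hil n \<Longrightarrow> v \<in> hil n \<Longrightarrow> cmod (cinner u (\<pi> y v)) \<le> hnorm u * hnorm v"
  using cinner_Cauchy_Schwarz[OF _ rep_in_hil, of u y v] by (simp add: rep_hnorm)

context
  fixes \<mu> :: "'g measure" and a :: "'g \<Rightarrow> complex"
  assumes borel: "sets \<mu> = sets borel" and a: "integrable \<mu> a"
begin

lemma rep_integrable:
  assumes u: "u \<in> hil n" and v: "v \<in> hil n"
  shows "integrable \<mu> (\<lambda>y. a y * cinner u (\<pi> y v))"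
proof (rule Bochner_Integration.integrable_bound)
  show "integrable \<mu> (\<lambda>y. (hnorm u * hnorm v) * norm (a y))"
    using a by (intro integrable_mult_right integrable_norm)
  have "(\<lambda>y. cinner u (\<pi> y v)) \<in> borel_measurable \<mu>"
    using borel_measurable_continuous_onI[OF rep_cinner_continuous[OF u v]] measurable_cong_sets[OF borel refl]
    by blast
  then show "(\<lambda>y. a y * cinner u (\<pi> y v)) \<in> borel_measurable \<mu>"
    using borel_measurable_integrable[OF a] by (rule borel_measurable_times[rotated])
  show "AE y in \<mu>. norm (a y * cinner u (\<pi> y v)) \<le> norm ((hnorm u * hnorm v) * norm (a y))"
  proof (rule AE_I2)
    fix y
    have "norm (a y * cinner u (\<pi> y v)) \<le> norm (a y) * (hnorm u * hnorm v)"
      unfolding norm_mult by (intro mult_left_mono rep_cinner_bound u v norm_ge_zero)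
    also have "\<dots> = norm ((hnorm u * hnorm v) * norm (a y))"
      using hnorm_nonneg[OF u] hnorm_nonneg[OF v] by (simp add: norm_mult abs_mult)
    finally show "norm (a y * cinner u (\<pi> y v)) \<le> norm ((hnorm u * hnorm v) * norm (a y))" .
  qed
qed

lemma norm_integral_rep_le:
  assumes u: "u \<in> hil n" and v: "v \<in> hil n"
  shows "cmod (LINT y|\<mu>. a y * cinner u (\<pi> y v)) \<le> (LINT y|\<mu>. norm (a y)) * hnorm u * hnorm v"
proof -
  have "cmod (LINT y|\<mu>. a y * cinner u (\<pi> y v)) \<le> (LINT y|\<mu>. (hnorm u * hnorm v) * norm (a y))"
  proof (rule order_trans[OF integral_norm_bound integral_mono])
    show "integrable \<mu> (\<lambda>y. norm (a y * cinner u (\<pi> y v)))"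
      by (intro integrable_norm rep_integrable u v)
    show "integrable \<mu> (\<lambda>y. (hnorm u * hnorm v) * norm (a y))"
      using a by (intro integrable_mult_right integrable_norm)
    show "norm (a y * cinner u (\<pi> y v)) \<le> (hnorm u * hnorm v) * norm (a y)" for y
      using mult_left_mono[OF rep_cinner_bound[OF u v, of y] norm_ge_zero[of "a y"]]
      by (simp add: norm_mult mult_ac)
  qed
  then show ?thesis
    by (simp add: mult_ac)
qed

text \<open>The operator \<open>\<integral> a(y) \<pi>(y)\<^sup>* dy\<close>, the common form of the Fourier and the Gabor transform.\<close>

definition "rep_integral = weak_op_integral n \<mu> (\<lambda>y u i. a y * adj n (\<pi> y) u i)"

lemma cinner_adj_rep:
  assumes u: "u \<in> hil n" and v: "v \<in> hil n"
  shows "cinner (\<lambda>i. a y * adj n (\<pi> y) u i) v = a y * cinner u (\<pi> y v)"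
proof -
  have A: "adj n (\<pi> y) u \<in> hil n"
    using adj_in_hil[OF rep_bounded_ops u] .
  show ?thesis
    using cinner_lincomb_left[OF A A v, of "a y" 0] cinner_adj_left[OF rep_bounded_ops u v] by simp
qed

text \<open>The conjugate of the integral is a bounded linear functional of \<open>v\<close>.\<close>

lemma rep_integral_exists:
  assumes u: "u \<in> hil n"
  shows "\<exists>!w. w \<in> hil n \<and> (\<forall>v\<in>hil n. cinner w v = (LINT y|\<mu>. cinner (\<lambda>i. a y * adj n (\<pi> y) u i) v))"
proof -
  define l where "l v = cnj (LINT y|\<mu>. a y * cinner u (\<pi> y v))" for v
  have "\<exists>!w. w \<in> hil n \<and> (\<forall>v\<in>hil n. l v = cinner v w)"
  proof (rule riesz_hil)
    fix v v' c c' assume v: "v \<in> hil n" "v' \<in> hil n"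
    have "cinner u (\<pi> y (\<lambda>i. c * v i + c' * v' i)) = cnj c * cinner u (\<pi> y v) + cnj c' * cinner u (\<pi> y v')" for y
    proof -
      have "cinner u (\<pi> y (\<lambda>i. c * v i + c' * v' i)) = cnj (cinner (\<lambda>i. c * \<pi> y v i + c' * \<pi> y v' i) u)"
        unfolding bounded_ops_lincomb[OF rep_bounded_ops v]
        by (rule cinner_commute[OF hil_lincomb[OF rep_in_hil rep_in_hil] u])
      then show ?thesis
        by (simp only: cinner_lincomb_left[OF rep_in_hil rep_in_hil u] complex_cnj_add complex_cnj_mult
            cinner_commute[OF u rep_in_hil] complex_cnj_cnj)
    qed
    then have "(LINT y|\<mu>. a y * cinner u (\<pi> y (\<lambda>i. c * v i + c' * v' i))) =
        (LINT y|\<mu>. cnj c * (a y * cinner u (\<pi> y v)) + cnj c' * (a y * cinner u (\<pi> y v')))"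
      by (simp add: algebra_simps)
    also have "\<dots> = cnj c * (LINT y|\<mu>. a y * cinner u (\<pi> y v)) + cnj c' * (LINT y|\<mu>. a y * cinner u (\<pi> y v'))"
      using rep_integrable[OF u v(1)] rep_integrable[OF u v(2)] by simp
    finally show "l (\<lambda>i. c * v i + c' * v' i) = c * l v + c' * l v'"
      by (simp add: l_def)
  next
    fix v assume "v \<in> hil n"
    then show "cmod (l v) \<le> ((LINT y|\<mu>. norm (a y)) * hnorm u) * hnorm v"
      unfolding l_def complex_mod_cnj by (rule norm_integral_rep_le[OF u])
  qed
  moreover have "l v = cinner v w \<longleftrightarrow> cinner w v = (LINT y|\<mu>. cinner (\<lambda>i. a y * adj n (\<pi> y) u i) v)"
    if "w \<in> hil n" "v \<in> hil n" for w v
    unfolding l_def cinner_adj_rep[OF u \<open>v \<in> hil n\<close>] cinner_commute[OF that]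
    by (metis complex_cnj_cnj)
  then have "(\<forall>v\<in>hil n. l v = cinner v w) \<longleftrightarrow>
      (\<forall>v\<in>hil n. cinner w v = (LINT y|\<mu>. cinner (\<lambda>i. a y * adj n (\<pi> y) u i) v))"
    if "w \<in> hil n" for w
    using that by (intro ball_cong) auto
  ultimately show ?thesis
    by (simp cong: conj_cong)
qed

lemma rep_integral_in_hil: "u \<in> hil n \<Longrightarrow> rep_integral u \<in> hil n"
  and cinner_rep_integral: "u \<in> hil n \<Longrightarrow> v \<in> hil n \<Longrightarrow>
    cinner (rep_integral u) v = (LINT y|\<mu>. a y * cinner u (\<pi> y v))"
  using theI'[OF rep_integral_exists, of u] cinner_adj_rep[of u v]
  unfolding rep_integral_def weak_op_integral_def by auto

lemma rep_integral_component:
  assumes u: "u \<in> hil n"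
  shows "rep_integral u i = (if i \<in> ix n then LINT y|\<mu>. a y * cinner u (\<pi> y (unitvec i)) else 0)"
  using cinner_rep_integral[OF u, of "unitvec i"] hil_outside[OF rep_integral_in_hil[OF u], of i] by simp

lemma rep_integral_bounded_ops: "rep_integral \<in> bounded_ops n"
proof -
  have "linear_on_hil n n rep_integral"
    unfolding linear_on_hil_def
  proof (intro conjI ballI allI)
    show "rep_integral ` hil n \<subseteq> hil n"
      using rep_integral_in_hil by blast
    fix u v b c assume u: "u \<in> hil n" and v: "v \<in> hil n"
    show "rep_integral (\<lambda>i. b * u i + c * v i) = (\<lambda>i. b * rep_integral u i + c * rep_integral v i)"
    proof
      fix i
      show "rep_integral (\<lambda>i. b * u i + c * v i) i = b * rep_integral u i + c * rep_integral v i"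
      proof (cases "i \<in> ix n")
        case True
        then have e: "unitvec i \<in> hil n" by simp
        have "(LINT y|\<mu>. a y * cinner (\<lambda>i. b * u i + c * v i) (\<pi> y (unitvec i))) =
          (LINT y|\<mu>. b * (a y * cinner u (\<pi> y (unitvec i))) + c * (a y * cinner v (\<pi> y (unitvec i))))"
          by (simp only: cinner_lincomb_left[OF u v rep_in_hil] distrib_left mult_ac)
        also have "\<dots> = b * (LINT y|\<mu>. a y * cinner u (\<pi> y (unitvec i))) + c * (LINT y|\<mu>. a y * cinner v (\<pi> y (unitvec i)))"
          using rep_integrable[OF u e] rep_integrable[OF v e] by simp
        finally show ?thesis
          using True by (simp add: rep_integral_component u v hil_lincomb)
      qed (simp add: rep_integral_component u v hil_lincomb)
    qed
  qed
  moreover have "\<forall>u. u \<notin> hil n \<longrightarrow> rep_integral u = (\<lambda>_. 0)"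
    by (simp add: rep_integral_def weak_op_integral_def)
  moreover have "hnorm (rep_integral u) \<le> (LINT y|\<mu>. norm (a y)) * hnorm u" if u: "u \<in> hil n" for u
  proof -
    note W = rep_integral_in_hil[OF u]
    have "hnorm (rep_integral u) * hnorm (rep_integral u) = cmod (cinner (rep_integral u) (rep_integral u))"
      by (simp add: cinner_self_hnorm[OF W] power2_eq_square norm_mult)
    also have "\<dots> \<le> (LINT y|\<mu>. norm (a y)) * hnorm u * hnorm (rep_integral u)"
      unfolding cinner_rep_integral[OF u W] by (rule norm_integral_rep_le[OF u W])
    finally have "hnorm (rep_integral u) \<le> (LINT y|\<mu>. norm (a y)) * hnorm u \<or> hnorm (rep_integral u) = 0"
      using hnorm_nonneg[OF W] by (metis less_eq_real_def mult_right_le_imp_le)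
    moreover have "0 \<le> (LINT y|\<mu>. norm (a y)) * hnorm u"
      using hnorm_nonneg[OF u] by (intro mult_nonneg_nonneg integral_nonneg_AE) auto
    ultimately show ?thesis
      by auto
  qed
  ultimately show ?thesis
    unfolding bounded_ops_def by blast
qed

end
end

section \<open>Locally compact second countable groups\<close>

text \<open>Second countability gives a countable subcover of the cover by all translates of \<open>V\<close>.\<close>

lemma group_countable_translates:
  fixes V :: "'g::{topological_group_add, second_countable_topology} set"
  assumes V: "open V" "0 \<in> V"
  obtains a :: "nat \<Rightarrow> 'g" where "\<And>x. \<exists>m. - a m + x \<in> V"
proof -
  define T where "T c = (\<lambda>x. - c + x) -` V" for c
  have "open (T c)" for c
    unfolding T_def by (intro open_vimage V continuous_intros)
  then obtain \<F> where \<F>: "\<F> \<subseteq> range T" "countable \<F>" "\<Union>\<F> = \<Union>(range T)"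
    using Lindelof[of "range T"] by (metis rangeE)
  have "x \<in> T x" for x
    using V by (simp add: T_def)
  then have "x \<in> \<Union>(range T)" for x
    by (intro UN_I) auto
  then have cover: "\<Union>\<F> = UNIV"
    using \<F>(3) by (intro equalityI subsetI) auto
  obtain C where C: "countable C" "\<F> = T ` C"
    using \<F>(1,2) by (metis countable_subset_image)
  have "\<exists>m. - from_nat_into C m + x \<in> V" for x
  proof -
    have "x \<in> \<Union>(T ` C)"
      using cover C(2) by simp
    then obtain c where c: "c \<in> C" "- c + x \<in> V"
      by (auto simp: T_def)
    then show ?thesis
      using from_nat_into_surj[OF C(1) c(1)] by auto
  qed
  then show thesis
    by (rule that)
qed

text \<open>Joint measurability of a map that is continuous in the group variable and measurable in a
  parameter. Closeness in the group is measured by translates of shrinking neighbourhoods \<open>V\<^sub>k\<close> of the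
  unit: \<open>c(y, p)\<close> is the limit of \<open>c(a\<^sub>k, p)\<close>, where \<open>a\<^sub>k\<close> is the first member of a countable set
  with \<open>y \<in> a\<^sub>k + V\<^sub>k\<close>.\<close>

lemma borel_measurable_caratheodory:
  fixes c :: "'g::{topological_group_add, second_countable_topology} \<Rightarrow> 'p \<Rightarrow> complex"
  assumes cont: "\<And>p. p \<in> space M \<Longrightarrow> continuous_on UNIV (\<lambda>y. c y p)"
    and meas: "\<And>y. c y \<in> borel_measurable M"
  shows "(\<lambda>(y, p). c y p) \<in> borel_measurable (borel \<Otimes>\<^sub>M M)"
proof -
  obtain V :: "nat \<Rightarrow> 'g set" where V: "\<And>i. open (V i)" "\<And>i. 0 \<in> V i"
    "\<And>S. open S \<Longrightarrow> 0 \<in> S \<Longrightarrow> eventually (\<lambda>i. V i \<subseteq> S) sequentially"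
    using countable_basis_at_decseq[of "0::'g"] by metis
  have "\<exists>a :: nat \<Rightarrow> 'g. \<forall>x. \<exists>m. - a m + x \<in> V k" for k
    using group_countable_translates[OF V(1,2)[of k]] by metis
  then obtain a :: "nat \<Rightarrow> nat \<Rightarrow> 'g" where a: "\<And>k x. \<exists>m. - a k m + x \<in> V k"
    by metis
  define m where "m k x = (LEAST m. - a k m + x \<in> V k)" for k x
  have m: "- a k (m k x) + x \<in> V k" for k x
    unfolding m_def using a[of k x] by (rule LeastI_ex)
  have m_meas [measurable]: "m k \<in> measurable borel (count_space UNIV)" for k
  proof -
    have "(\<lambda>x. - a k j + x \<in> V k) \<in> measurable borel (count_space UNIV)" for j
    proof -
      have "open {x. - a k j + x \<in> V k}"
        using open_vimage[OF V(1)[of k], of "\<lambda>x. - a k j + x"] by (simp add: vimage_def continuous_intros)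
      then show ?thesis
        by (simp add: pred_def)
    qed
    then show ?thesis
      unfolding m_def by measurable
  qed
  show ?thesis
  proof (rule borel_measurable_LIMSEQ_metric)
    fix k
    have [measurable]: "c y \<in> borel_measurable M" for y
      by (rule meas)
    have "(\<lambda>z. c (a k (m k (fst z))) (snd z)) \<in> borel_measurable (borel \<Otimes>\<^sub>M M)"
      by (rule measurable_compose_countable[where f = "\<lambda>i z. c (a k i) (snd z)"]) measurable
    then show "(\<lambda>(y, p). c (a k (m k y)) p) \<in> borel_measurable (borel \<Otimes>\<^sub>M M)"
      by (simp add: case_prod_unfold)
  next
    fix z assume z: "z \<in> space (borel \<Otimes>\<^sub>M M :: ('g \<times> 'p) measure)"
    obtain y p where yp: "z = (y, p)" "p \<in> space M"
      using z by (cases z) (auto simp: space_pair_measure)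
    have "(\<lambda>k. a k (m k y)) \<longlonglongrightarrow> y"
    proof (rule topological_tendstoI)
      fix S assume S: "open S" "y \<in> S"
      have "open ((\<lambda>v. y + - v) -` S)"
        by (intro open_vimage S continuous_intros)
      then have "\<forall>\<^sub>F k in sequentially. V k \<subseteq> (\<lambda>v. y + - v) -` S"
        using S by (intro V(3)) auto
      then show "\<forall>\<^sub>F k in sequentially. a k (m k y) \<in> S"
      proof (eventually_elim)
        case (elim k)
        then have "y + - (- a k (m k y) + y) \<in> S"
          using m by blast
        then show ?case
          by (simp add: minus_add add.assoc[symmetric])
      qed
    qed
    then have "(\<lambda>k. c (a k (m k y)) p) \<longlonglongrightarrow> c y p"
      by (rule continuous_on_tendsto_compose[OF cont[OF yp(2)]]) auto
    then show "(\<lambda>k. (\<lambda>(y, p). c (a k (m k y)) p) z) \<longlonglongrightarrow> (\<lambda>(y, p). c y p) z"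
      by (simp add: yp(1))
  qed
qed

lemma compact_neighbourhood:
  fixes x :: "'g::t2_space"
  assumes "locally_compact_space (euclidean :: 'g topology)" "open U" "x \<in> U"
  obtains V where "open V" "x \<in> V" "compact (closure V)" "closure V \<subseteq> U"
proof -
  have "Hausdorff_space (euclidean :: 'g topology)"
    unfolding Hausdorff_space_def using hausdorff by (auto simp: disjnt_def)
  then have "neighbourhood_base_of (compactin euclidean) (euclidean :: 'g topology)"
    using assms(1) locally_compact_space_neighbourhood_base by blast
  then obtain V C where VC: "open V" "compact C" "x \<in> V" "V \<subseteq> C" "C \<subseteq> U"
    using assms(2,3) unfolding neighbourhood_base_of by (metis compactin_euclidean_iff open_openin)
  have "closure V \<subseteq> C"
    by (rule closure_minimal[OF VC(4) compact_imp_closed[OF VC(2)]])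
  moreover from this have "compact (closure V)"
    using compact_Int_closed[OF VC(2) closed_closure, of V] by (simp add: Int_absorb1)
  ultimately show thesis
    using that[OF VC(1,3)] VC(5) by blast
qed

lemma open_relatively_compact_exhaustion:
  fixes U :: "'g::{t2_space, second_countable_topology} set"
  assumes "locally_compact_space (euclidean :: 'g topology)" "open U"
  obtains W :: "nat \<Rightarrow> 'g set" where "\<forall>k. open (W k) \<and> compact (closure (W k)) \<and> closure (W k) \<subseteq> U"
    "incseq W" "(\<Union>k. W k) = U"
proof -
  define \<F> where "\<F> = {V. open V \<and> compact (closure V) \<and> closure V \<subseteq> U}"
  obtain \<F>' where \<F>': "\<F>' \<subseteq> \<F>" "countable \<F>'" "\<Union>\<F>' = \<Union>\<F>"
  proof (rule Lindelof)
    show "open V" if "V \<in> \<F>" for V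
      using that by (simp add: \<F>_def)
  qed
  have "x \<in> \<Union>\<F>" if x: "x \<in> U" for x
  proof -
    obtain V where "open V" "x \<in> V" "compact (closure V)" "closure V \<subseteq> U"
      using compact_neighbourhood[OF assms x] .
    then show ?thesis
      by (auto simp: \<F>_def)
  qed
  then have cov: "U \<subseteq> \<Union>\<F>'"
    unfolding \<F>'(3) by (rule subsetI)
  define B where "B = from_nat_into (insert {} \<F>')"
  have B: "range B = insert {} \<F>'"
    unfolding B_def using \<F>'(2) by (intro range_from_nat_into) auto
  define W where "W k = (\<Union>i\<le>k. B i)" for k
  have closure_W: "closure (W k) = (\<Union>i\<le>k. closure (B i))" for k
    unfolding W_def by (induction k) (simp_all add: atMost_Suc closure_Un)
  have Bi: "open (B i)" "compact (closure (B i))" "closure (B i) \<subseteq> U" for i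
  proof -
    have "B i \<in> insert {} \<F>'"
      using B by blast
    then show "open (B i)" "compact (closure (B i))" "closure (B i) \<subseteq> U"
      using \<F>'(1) by (auto simp: \<F>_def)
  qed
  show thesis
  proof (rule that)
    show "\<forall>k. open (W k) \<and> compact (closure (W k)) \<and> closure (W k) \<subseteq> U"
      unfolding closure_W
    proof (intro allI conjI)
      show "open (W k)" for k
        unfolding W_def using Bi(1) by (intro open_UN ballI)
      show "compact (\<Union>i\<le>k. closure (B i))" for k
        by (intro compact_UN finite_atMost Bi)
      show "(\<Union>i\<le>k. closure (B i)) \<subseteq> U" for k
        using Bi(3) by (rule UN_least)
    qed
    show "incseq W"
      unfolding W_def incseq_def by (intro allI impI UN_mono) auto
    show "(\<Union>k. W k) = U"
    proof (intro equalityI subsetI)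
      fix x assume "x \<in> (\<Union>k. W k)"
      then show "x \<in> U"
        using Bi(3) closure_subset by (fastforce simp: W_def)
    next
      fix x assume "x \<in> U"
      then have "x \<in> \<Union>(range B)"
        using cov unfolding B by auto
      then show "x \<in> (\<Union>k. W k)"
        by (auto simp: W_def)
    qed
  qed
qed

section \<open>Haar measure of a unimodular group\<close>

locale haar_group =
  fixes \<mu> :: "'g::{topological_group_add, t2_space, second_countable_topology} measure"
  assumes locally_compact: "locally_compact_space (euclidean :: 'g topology)"
    and haar: "haar_measure \<mu>"
    and right_inv: "right_invariant \<mu>"
begin

lemma sets_haar [measurable_cong, simp]: "sets \<mu> = sets borel"
  using haar by (simp add: haar_measure_def)

lemma space_haar [simp]: "space \<mu> = UNIV"
  using sets_eq_imp_space_eq[OF sets_haar] by simp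

lemma left_translate_distr: "distr \<mu> borel (\<lambda>x. a + x) = \<mu>"
  using haar by (simp add: haar_measure_def)

lemma right_translate_distr: "distr \<mu> borel (\<lambda>x. x + a) = \<mu>"
  using right_inv by (simp add: right_invariant_def)

lemma emeasure_compact_finite: "compact C \<Longrightarrow> emeasure \<mu> C < \<infinity>"
  using haar by (simp add: haar_measure_def)

sublocale sigma_finite_measure \<mu>
proof
  obtain W :: "nat \<Rightarrow> 'g set" where W: "\<forall>k. open (W k) \<and> compact (closure (W k)) \<and> closure (W k) \<subseteq> UNIV"
    "incseq W" "(\<Union>k. W k) = UNIV"
    by (rule open_relatively_compact_exhaustion[OF locally_compact open_UNIV])
  have "(\<Union>k. W k) \<subseteq> (\<Union>k. closure (W k))"
    by (intro UN_mono closure_subset subset_refl)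
  then have "(\<Union>k. closure (W k)) = UNIV"
    unfolding W(3) by (rule top.extremum_uniqueI)
  moreover have "\<forall>k. emeasure \<mu> (closure (W k)) \<noteq> \<infinity>"
    using emeasure_compact_finite W(1) by (simp add: less_top)
  ultimately show "\<exists>A. countable A \<and> A \<subseteq> sets \<mu> \<and> \<Union>A = space \<mu> \<and> (\<forall>a\<in>A. emeasure \<mu> a \<noteq> \<infinity>)"
    by (intro exI[of _ "range (\<lambda>k. closure (W k))"]) auto
qed

lemma borel_measurable_translates [measurable]:
  "(\<lambda>x::'g. a + x) \<in> borel_measurable borel" "(\<lambda>x::'g. x + a) \<in> borel_measurable borel"
  "(\<lambda>x::'g. - x) \<in> borel_measurable borel"
  by (intro borel_measurable_continuous_onI continuous_intros)+

lemma borel_measurable_left_diff [measurable (raw)]: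
  assumes [measurable]: "f \<in> borel_measurable M" "g \<in> borel_measurable M"
  shows "(\<lambda>z. - f z + g z :: 'g) \<in> borel_measurable M"
  by (rule borel_measurable_continuous_Pair) (auto intro!: continuous_intros)

lemma nn_integral_left_translate:
  assumes [measurable]: "f \<in> borel_measurable borel"
  shows "(\<integral>\<^sup>+x. f (a + x) \<partial>\<mu>) = (\<integral>\<^sup>+x. f x \<partial>\<mu>)"
  using nn_integral_distr[of "\<lambda>x. a + x" \<mu> borel f] by (simp add: left_translate_distr)

lemma nn_integral_right_translate:
  assumes [measurable]: "f \<in> borel_measurable borel"
  shows "(\<integral>\<^sup>+x. f (x + a) \<partial>\<mu>) = (\<integral>\<^sup>+x. f x \<partial>\<mu>)"
  using nn_integral_distr[of "\<lambda>x. x + a" \<mu> borel f] by (simp add: right_translate_distr)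

text \<open>Countably many translates of \<open>U\<close> cover the group, so if \<open>U\<close> were null then so would be the whole
  group, and a Haar measure is not zero.\<close>

lemma emeasure_open_pos:
  assumes U: "open U" "x0 \<in> U"
  shows "emeasure \<mu> U > 0"
proof (rule ccontr)
  assume "\<not> emeasure \<mu> U > 0"
  then have 0: "emeasure \<mu> U = 0"
    by simp
  obtain a :: "nat \<Rightarrow> 'g" where a: "\<And>x. \<exists>m. - a m + x \<in> (\<lambda>v. x0 + v) -` U"
  proof (rule group_countable_translates)
    show "open ((\<lambda>v. x0 + v) -` U)"
      by (intro open_vimage U continuous_intros)
  qed (use U in auto)
  define N where "N m = (\<lambda>x. (x0 + - a m) + x) -` U" for m
  have "emeasure \<mu> (N m) = 0" for m
  proof -
    have "emeasure (distr \<mu> borel (\<lambda>x. (x0 + - a m) + x)) U = emeasure \<mu> (N m)"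
      using U(1) by (simp add: emeasure_distr N_def)
    then show ?thesis
      using 0 by (simp only: left_translate_distr)
  qed
  moreover have N: "N m \<in> sets \<mu>" for m
    unfolding N_def using U(1) by (simp add: continuous_intros open_vimage)
  ultimately have "(\<Union>m. N m) \<in> null_sets \<mu>"
    by (intro null_sets_UN) auto
  moreover have "(\<Union>m. N m) = UNIV"
    using a by (auto simp: N_def add.assoc simp del: add_uminus_conv_diff)
  ultimately show False
    using haar by (auto simp: haar_measure_def null_sets_def)
qed

text \<open>Evaluate \<open>\<integral>\<integral> f(x) g(y\<^sup>-\<^sup>1x) dy dx\<close> in both orders. Substituting \<open>y \<mapsto> xy\<close> gives \<open>\<integral>f\<close> times the
  integral of \<open>g\<close> composed with inversion; substituting \<open>x \<mapsto> yx\<close> and using right invariance gives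
  \<open>\<integral>f \<integral>g\<close>.
  Cancelling \<open>\<integral>f\<close> is possible when \<open>f\<close> is the indicator of a relatively compact open set.\<close>

lemma nn_integral_uminus:
  assumes g [measurable]: "g \<in> borel_measurable borel"
  shows "(\<integral>\<^sup>+x. g (- x) \<partial>\<mu>) = (\<integral>\<^sup>+x. g x \<partial>\<mu>)"
proof -
  interpret P: pair_sigma_finite \<mu> \<mu> ..
  obtain V where V: "open V" "(0::'g) \<in> V" "compact (closure V)"
    using compact_neighbourhood[OF locally_compact open_UNIV, of 0] by blast
  define f :: "'g \<Rightarrow> ennreal" where "f = indicator V"
  have [measurable]: "f \<in> borel_measurable borel"
    unfolding f_def using V(1) by simp
  have fV: "(\<integral>\<^sup>+x. f x \<partial>\<mu>) = emeasure \<mu> V"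
    unfolding f_def using V(1) by simp
  have fin: "emeasure \<mu> V \<noteq> \<infinity>"
    using emeasure_mono[OF closure_subset, of V \<mu>] emeasure_compact_finite[OF V(3)]
    by (auto simp: top_unique)
  have pos: "emeasure \<mu> V \<noteq> 0"
    using emeasure_open_pos[OF V(1,2)] by simp
  have "(\<integral>\<^sup>+x. (\<integral>\<^sup>+y. f x * g (- y + x) \<partial>\<mu>) \<partial>\<mu>) = (\<integral>\<^sup>+x. f x * (\<integral>\<^sup>+y. g (- y) \<partial>\<mu>) \<partial>\<mu>)"
  proof (rule nn_integral_cong)
    fix x
    have "(\<integral>\<^sup>+y. g (- y + x) \<partial>\<mu>) = (\<integral>\<^sup>+y. g (- (x + y) + x) \<partial>\<mu>)"
      by (rule nn_integral_left_translate[symmetric]) measurable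
    also have "\<dots> = (\<integral>\<^sup>+y. g (- y) \<partial>\<mu>)"
      by (simp add: minus_add add.assoc)
    finally show "(\<integral>\<^sup>+y. f x * g (- y + x) \<partial>\<mu>) = f x * (\<integral>\<^sup>+y. g (- y) \<partial>\<mu>)"
      by (simp add: nn_integral_cmult)
  qed
  also have "\<dots> = emeasure \<mu> V * (\<integral>\<^sup>+y. g (- y) \<partial>\<mu>)"
    by (simp add: nn_integral_multc fV)
  finally have 1: "(\<integral>\<^sup>+x. (\<integral>\<^sup>+y. f x * g (- y + x) \<partial>\<mu>) \<partial>\<mu>) = emeasure \<mu> V * (\<integral>\<^sup>+y. g (- y) \<partial>\<mu>)" .
  have "(\<integral>\<^sup>+x. (\<integral>\<^sup>+y. f x * g (- y + x) \<partial>\<mu>) \<partial>\<mu>) = (\<integral>\<^sup>+y. (\<integral>\<^sup>+x. f x * g (- y + x) \<partial>\<mu>) \<partial>\<mu>)"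
    by (rule P.Fubini'[symmetric]) measurable
  also have "\<dots> = (\<integral>\<^sup>+y. (\<integral>\<^sup>+x. f (y + x) * g x \<partial>\<mu>) \<partial>\<mu>)"
  proof (rule nn_integral_cong)
    fix y
    have "(\<integral>\<^sup>+x. f x * g (- y + x) \<partial>\<mu>) = (\<integral>\<^sup>+x. f (y + x) * g (- y + (y + x)) \<partial>\<mu>)"
      by (rule nn_integral_left_translate[symmetric]) measurable
    then show "(\<integral>\<^sup>+x. f x * g (- y + x) \<partial>\<mu>) = (\<integral>\<^sup>+x. f (y + x) * g x \<partial>\<mu>)"
      by (simp add: add.assoc[symmetric])
  qed
  also have "\<dots> = (\<integral>\<^sup>+x. (\<integral>\<^sup>+y. f (y + x) * g x \<partial>\<mu>) \<partial>\<mu>)"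
  proof (rule P.Fubini')
    have "(\<lambda>z. f (- (- fst z) + snd z) * g (snd z)) \<in> borel_measurable (\<mu> \<Otimes>\<^sub>M \<mu>)"
      by measurable
    then show "(\<lambda>(x, y). f (y + x) * g x) \<in> borel_measurable (\<mu> \<Otimes>\<^sub>M \<mu>)"
      using measurable_pair_swap by (simp add: case_prod_unfold) 
  qed
  also have "\<dots> = (\<integral>\<^sup>+x. emeasure \<mu> V * g x \<partial>\<mu>)"
    by (simp add: nn_integral_multc nn_integral_right_translate fV)
  also have "\<dots> = emeasure \<mu> V * (\<integral>\<^sup>+x. g x \<partial>\<mu>)"
    by (simp add: nn_integral_cmult)
  finally show ?thesis
    using 1 fin pos ennreal_mult_cancel_left[of "emeasure \<mu> V"] by simp
qed

text \<open>Inversion invariance combined with right invariance. The window enters as \<open>\<psi>(x\<^sup>-\<^sup>1y)\<close> and has to be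
  integrated over \<open>x\<close>, not over \<open>y\<close>.\<close>

lemma left_diff_distr: "distr \<mu> borel (\<lambda>x. - x + y) = \<mu>"
proof (rule measure_eqI)
  fix A assume "A \<in> sets (distr \<mu> borel (\<lambda>x. - x + y))"
  then have [measurable]: "A \<in> sets borel"
    by simp
  have "emeasure (distr \<mu> borel (\<lambda>x. - x + y)) A = (\<integral>\<^sup>+x. indicator A (- x + y) \<partial>\<mu>)"
    using nn_integral_distr[of "\<lambda>x. - x + y" \<mu> borel "indicator A"] by simp
  also have "\<dots> = (\<integral>\<^sup>+x. indicator A (x + y) \<partial>\<mu>)"
    by (rule nn_integral_uminus) measurable
  also have "\<dots> = (\<integral>\<^sup>+x. indicator A x \<partial>\<mu>)"
    by (rule nn_integral_right_translate) measurable
  finally show "emeasure (distr \<mu> borel (\<lambda>x. - x + y)) A = emeasure \<mu> A"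
    by simp
qed simp

end

section \<open>Square-integrable functions and approximation by \<open>Cc\<close>\<close>

lemma borel_measurable_cnj [measurable (raw)]:
  "f \<in> borel_measurable M \<Longrightarrow> (\<lambda>x. cnj (f x)) \<in> borel_measurable M"
  by (rule borel_measurable_continuous_on[of cnj]) (auto intro: continuous_intros)

lemma L2_measurable: "f \<in> L2 M \<Longrightarrow> f \<in> borel_measurable M"
  by (simp add: L2_def)

lemma L2_integrable_power2: "f \<in> L2 M \<Longrightarrow> integrable M (\<lambda>x. (cmod (f x))\<^sup>2)"
  by (simp add: L2_def)

lemma L2_I_bound:
  assumes "f \<in> borel_measurable M" "integrable M h" "\<And>x. (cmod (f x))\<^sup>2 \<le> h x"
  shows "f \<in> L2 M"
proof -
  have [measurable]: "f \<in> borel_measurable M" by fact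
  have "integrable M (\<lambda>x. (cmod (f x))\<^sup>2)"
  proof (rule Bochner_Integration.integrable_bound[OF assms(2)])
    show "AE x in M. norm ((cmod (f x))\<^sup>2) \<le> norm (h x)"
      using assms(3) by (auto intro: order_trans[OF _ abs_ge_self])
  qed measurable
  then show ?thesis
    by (simp add: L2_def)
qed

lemma L2_lincomb:
  assumes f: "f \<in> L2 M" and g: "g \<in> L2 M"
  shows "(\<lambda>x. a * f x + b * g x) \<in> L2 M"
proof (rule L2_I_bound)
  show "(\<lambda>x. a * f x + b * g x) \<in> borel_measurable M"
    using f g by (auto simp: L2_def)
  show "integrable M (\<lambda>x. 2 * (cmod a)\<^sup>2 * (cmod (f x))\<^sup>2 + 2 * (cmod b)\<^sup>2 * (cmod (g x))\<^sup>2)"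
    using f g by (intro Bochner_Integration.integrable_add integrable_mult_right L2_integrable_power2)
qed (rule norm_lincomb_power2_le)

lemma L2_mult_cnj_integrable:
  assumes f: "f \<in> L2 M" and g: "g \<in> L2 M"
  shows "integrable M (\<lambda>x. f x * cnj (g x))"
proof (rule Bochner_Integration.integrable_bound)
  show "integrable M (\<lambda>x. ((cmod (f x))\<^sup>2 + (cmod (g x))\<^sup>2) / 2)"
    using f g by (intro integrable_divide Bochner_Integration.integrable_add L2_integrable_power2)
  show "(\<lambda>x. f x * cnj (g x)) \<in> borel_measurable M"
    using L2_measurable[OF f] L2_measurable[OF g] by measurable
  show "AE x in M. norm (f x * cnj (g x)) \<le> norm (((cmod (f x))\<^sup>2 + (cmod (g x))\<^sup>2) / 2)"
    by (intro AE_I2 order_trans[OF norm_mult_cnj_le]) simp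
qed

lemma L2_inner_self: "L2_inner M f f = of_real (LINT x|M. (cmod (f x))\<^sup>2)"
  unfolding L2_inner_def complex_norm_square[symmetric] integral_complex_of_real ..

lemma L2_norm_power2: "(L2_norm M f)\<^sup>2 = (LINT x|M. (cmod (f x))\<^sup>2)"
  by (simp add: L2_norm_def L2_inner_self)

lemma L2_orthogonal_imp_AE_0:
  assumes f: "f \<in> L2 M" and "L2_inner M f f = 0"
  shows "AE x in M. f x = 0"
proof -
  have "(LINT x|M. (cmod (f x))\<^sup>2) = 0"
    using assms(2) by (simp add: L2_inner_self)
  then show ?thesis
    using integral_nonneg_eq_0_iff_AE[OF L2_integrable_power2[OF f]] by simp
qed

context haar_group
begin

lemma Cc_L2: "f \<in> Cc \<Longrightarrow> f \<in> L2 \<mu>"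
proof -
  assume f: "f \<in> Cc"
  define C where "C = closure {x. f x \<noteq> 0}"
  have C: "compact C" and cont: "continuous_on UNIV f"
    using f by (auto simp: Cc_def C_def)
  have out: "f x = 0" if "x \<notin> C" for x
    using that closure_subset[of "{x. f x \<noteq> 0}"] by (auto simp: C_def)
  have "compact (f ` C)"
    using compact_continuous_image[OF continuous_on_subset[OF cont] C] by simp
  then obtain B where B: "\<forall>x\<in>C. cmod (f x) \<le> B"
    by (meson bounded_iff compact_imp_bounded imageI)
  show "f \<in> L2 \<mu>"
  proof (rule L2_I_bound)
    show "f \<in> borel_measurable \<mu>"
      using borel_measurable_continuous_onI[OF cont] by simp
    have "integrable \<mu> (indicat_real C)"
      using emeasure_compact_finite[OF C] C by (intro integrable_real_indicator) (auto simp: borel_closed compact_imp_closed)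
    then show "integrable \<mu> (\<lambda>x. B\<^sup>2 * indicator C x)"
      by (rule integrable_mult_right)
    show "(cmod (f x))\<^sup>2 \<le> B\<^sup>2 * indicator C x" for x
      using B out[of x] by (cases "x \<in> C") (auto intro: power_mono)
  qed
qed

text \<open>In place of density of \<open>Cc\<close> in \<open>L2\<close>, an induction rule: a property of functions that is
  preserved by linear combinations and by limits in \<open>L2\<close> and holds on \<open>Cc\<close> holds on \<open>L2\<close>.\<close>

context
  fixes Q :: "('g \<Rightarrow> complex) \<Rightarrow> bool"
  assumes Q_Cc: "\<And>f. f \<in> Cc \<Longrightarrow> Q f"
    and Q_lincomb: "\<And>f g a b. f \<in> L2 \<mu> \<Longrightarrow> g \<in> L2 \<mu> \<Longrightarrow> Q f \<Longrightarrow> Q g \<Longrightarrow> Q (\<lambda>x. a * f x + b * g x)"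
    and Q_limit: "\<And>s f. (\<And>k::nat. s k \<in> L2 \<mu>) \<Longrightarrow> (\<And>k. Q (s k)) \<Longrightarrow> f \<in> L2 \<mu> \<Longrightarrow>
      (\<lambda>k. LINT x|\<mu>. (cmod (f x - s k x))\<^sup>2) \<longlonglongrightarrow> 0 \<Longrightarrow> Q f"
begin

text \<open>By dominated convergence, pointwise limits with a common square-integrable bound are limits in \<open>L2\<close>.\<close>

lemma Q_dominated_limit:
  assumes s: "\<And>k::nat. s k \<in> L2 \<mu>" "\<And>k. Q (s k)"
    and f: "f \<in> borel_measurable \<mu>" and lim: "\<And>x. (\<lambda>k. s k x) \<longlonglongrightarrow> f x"
    and h: "integrable \<mu> h" "\<And>k x. (cmod (s k x))\<^sup>2 \<le> h x"
  shows "f \<in> L2 \<mu> \<and> Q f"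
proof -
  have fh: "(cmod (f x))\<^sup>2 \<le> h x" for x
    by (rule tendsto_upperbound[OF tendsto_power[OF tendsto_norm[OF lim]]]) (auto intro!: always_eventually h(2))
  have fL: "f \<in> L2 \<mu>"
    using f h(1) fh by (rule L2_I_bound)
  have "(\<lambda>k. LINT x|\<mu>. (cmod (f x - s k x))\<^sup>2) \<longlonglongrightarrow> (LINT x|\<mu>. 0)"
  proof (rule integral_dominated_convergence)
    show "(\<lambda>x. (cmod (f x - s k x))\<^sup>2) \<in> borel_measurable \<mu>" for k
      using f L2_measurable[OF s(1)] by measurable
    show "integrable \<mu> (\<lambda>x. 4 * h x)"
      using h(1) by simp
    show "AE x in \<mu>. (\<lambda>k. (cmod (f x - s k x))\<^sup>2) \<longlonglongrightarrow> 0"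
    proof (rule AE_I2)
      fix x
      have "(\<lambda>k. (cmod (f x - s k x))\<^sup>2) \<longlonglongrightarrow> (cmod (f x - f x))\<^sup>2"
        by (intro tendsto_intros lim)
      then show "(\<lambda>k. (cmod (f x - s k x))\<^sup>2) \<longlonglongrightarrow> 0"
        by simp
    qed
    show "AE x in \<mu>. norm ((cmod (f x - s k x))\<^sup>2) \<le> 4 * h x" for k
      using norm_lincomb_power2_le[of 1 "f _" "-1" "s k _"] fh h(2)[of k]
      by (intro AE_I2) (simp, smt (verit))
  qed simp
  then have "Q f"
    by (intro Q_limit[OF s fL]) simp
  with fL show ?thesis
    by blast
qed

lemma indicator_L2:
  assumes "A \<in> sets borel" "A \<subseteq> W" "compact (closure W)"
  shows "indicator A \<in> L2 \<mu>"
proof (rule L2_I_bound)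
  show "(indicator A :: 'g \<Rightarrow> complex) \<in> borel_measurable \<mu>"
    using assms(1) by (intro borel_measurable_indicator) simp
  show "integrable \<mu> (indicat_real (closure W))"
    using emeasure_compact_finite[OF assms(3)] by (intro integrable_real_indicator) auto
  show "(cmod (indicator A x))\<^sup>2 \<le> indicat_real (closure W) x" for x
    using assms(2) closure_subset[of W] by (auto simp: indicator_def)
qed

text \<open>Urysohn functions that are 1 on the closures of an exhaustion of \<open>U\<close> and 0 outside \<open>U\<close> are in \<open>Cc\<close> and
  converge to the indicator of \<open>U\<close>.\<close>

lemma Q_indicator_open:
  assumes U: "open U" "compact (closure U)"
  shows "Q (indicator U)"
proof -
  have reg: "completely_regular_space (euclidean :: 'g topology)"
  proof (rule locally_compact_regular_imp_completely_regular_space[OF locally_compact])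
    have "Hausdorff_space (euclidean :: 'g topology)"
      unfolding Hausdorff_space_def using hausdorff by (auto simp: disjnt_def)
    then show "Hausdorff_space (euclidean :: 'g topology) \<or> regular_space (euclidean :: 'g topology)"
      by blast
  qed
  obtain W :: "nat \<Rightarrow> 'g set" where W: "\<forall>k. open (W k) \<and> compact (closure (W k)) \<and> closure (W k) \<subseteq> U"
    "incseq W" "(\<Union>k. W k) = U"
    by (rule open_relatively_compact_exhaustion[OF locally_compact U(1)])
  have "\<exists>g :: 'g \<Rightarrow> real. continuous_on UNIV g \<and> range g \<subseteq> {0..1} \<and> g ` (- U) \<subseteq> {0} \<and> g ` closure (W k) \<subseteq> {1}" for k
  proof -
    have C: "compactin euclidean (closure (W k))" "closedin euclidean (- U)" "disjnt (closure (W k)) (- U)"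
      using W(1) U(1) by (auto simp: disjnt_def)
    obtain g :: "'g \<Rightarrow> real" where "continuous_map euclidean (top_of_set {0..1}) g" "g ` (- U) \<subseteq> {0}" "g ` closure (W k) \<subseteq> {1}"
      using Urysohn_completely_regular_compact_closed[OF zero_le_one reg C] by metis
    then show ?thesis
      by (intro exI[of _ g]) (simp add: continuous_map_in_subtopology image_subset_iff_funcset)
  qed
  then obtain g :: "nat \<Rightarrow> 'g \<Rightarrow> real" where g: "\<And>k. continuous_on UNIV (g k)" "\<And>k. range (g k) \<subseteq> {0..1}"
    "\<And>k. g k ` (- U) \<subseteq> {0}" "\<And>k. g k ` closure (W k) \<subseteq> {1}"
    by metis
  have g01: "0 \<le> g k x" "g k x \<le> 1" for k x
    using g(2)[of k] by (auto simp: image_subset_iff)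
  have gU: "x \<notin> U \<Longrightarrow> g k x = 0" for k x
    using g(3)[of k] by auto
  have gW: "x \<in> W k \<Longrightarrow> g k x = 1" for k x
    using g(4)[of k] closure_subset[of "W k"] by auto
  have Cc: "(\<lambda>x. complex_of_real (g k x)) \<in> Cc" for k
  proof -
    have "{x. complex_of_real (g k x) \<noteq> 0} \<subseteq> U"
      using gU by auto
    then have "closure {x. complex_of_real (g k x) \<noteq> 0} \<subseteq> closure U"
      by (rule closure_mono)
    then have "compact (closure {x. complex_of_real (g k x) \<noteq> 0})"
      using compact_Int_closed[OF U(2) closed_closure, of "{x. complex_of_real (g k x) \<noteq> 0}"]
      by (simp add: Int_absorb1)
    then show ?thesis
      using g(1)[of k] by (simp add: Cc_def continuous_on_of_real)
  qed
  have "indicator U \<in> L2 \<mu> \<and> Q (indicator U)"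
  proof (rule Q_dominated_limit[where s = "\<lambda>k x. complex_of_real (g k x)"])
    show "(\<lambda>x. complex_of_real (g k x)) \<in> L2 \<mu>" "Q (\<lambda>x. complex_of_real (g k x))" for k
      using Cc[of k] Cc_L2 Q_Cc by blast+
    show "(indicator U :: 'g \<Rightarrow> complex) \<in> borel_measurable \<mu>"
      using U(1) by (intro borel_measurable_indicator) simp
    show "integrable \<mu> (indicat_real (closure U))"
      using emeasure_compact_finite[OF U(2)] by (intro integrable_real_indicator) auto
    show "(cmod (complex_of_real (g k x)))\<^sup>2 \<le> indicat_real (closure U) x" for k x
      using g01[of k x] gU[of x k] closure_subset[of U] by (cases "x \<in> U") (auto simp: power_le_one)
    show "(\<lambda>k. complex_of_real (g k x)) \<longlonglongrightarrow> indicator U x" for x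
    proof (cases "x \<in> U")
      case True
      then obtain k0 where "x \<in> W k0"
        using W(3) by blast
      then have "x \<in> W k" if "k \<ge> k0" for k
        using W(2) that by (auto simp: incseq_def)
      then have "\<forall>\<^sub>F k in sequentially. complex_of_real (g k x) = indicator U x"
        using gW True by (intro eventually_sequentiallyI[of k0]) auto
      then show ?thesis
        by (rule tendsto_eventually)
    qed (simp add: gU)
  qed
  then show ?thesis by blast
qed

text \<open>Open sets generate the Borel sets and are stable under intersection, so Dynkin's theorem applies.
  The intersection with \<open>W\<close> keeps all measures finite.\<close>

lemma Q_indicator_borel:
  assumes W: "open W" "compact (closure W)" and A: "A \<in> sets borel"
  shows "Q (indicator (A \<inter> W))"
proof -
  have ind: "indicator (B \<inter> W) \<in> L2 \<mu>" if "B \<in> sets borel" for B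
    using that W by (intro indicator_L2[of _ W]) auto
  have "Int_stable {S :: 'g set. open S}" "{S :: 'g set. open S} \<subseteq> Pow UNIV"
      "A \<in> sigma_sets UNIV {S :: 'g set. open S}"
    using A by (auto simp: Int_stable_def borel_def)
  then show ?thesis
  proof (induction A rule: sigma_sets_induct_disjoint)
    case (basic A)
    have "closure (A \<inter> W) \<subseteq> closure W"
      by (intro closure_mono) auto
    then have "compact (closure (A \<inter> W))"
      using compact_Int_closed[OF W(2) closed_closure, of "A \<inter> W"] by (simp add: Int_absorb1)
    then show ?case
      using basic W(1) by (intro Q_indicator_open) auto
  next
    case empty
    show ?case
      using Q_indicator_open[of "{}"] by (simp only: Int_empty_left lessThan_0 UN_empty open_empty closure_empty compact_empty)
  next
    case (compl A)
    then have A: "A \<in> sets borel"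
      by (simp add: borel_def)
    have "Q (\<lambda>x. 1 * indicator (UNIV \<inter> W) x + (-1) * indicator (A \<inter> W) x)"
      using compl(2) Q_indicator_open[OF W] ind[OF A] ind[of UNIV] by (intro Q_lincomb) auto
    moreover have "(\<lambda>x. 1 * indicator (UNIV \<inter> W) x + (-1) * indicator (A \<inter> W) x :: complex) = indicator ((UNIV - A) \<inter> W)"
      by (auto simp: indicator_def)
    ultimately show ?case
      by simp
  next
    case (union A)
    have A: "A i \<in> sets borel" for i
      using union(2) by (auto simp: borel_def)
    have fin: "(\<Union>i<k. A i) \<in> sets borel" for k
      using A by auto
    have "Q (indicator ((\<Union>i<k. A i) \<inter> W))" for k
    proof (induction k)
      case 0
      show ?case
        using Q_indicator_open[of "{}"] by (simp only: Int_empty_left lessThan_0 UN_empty open_empty closure_empty compact_empty)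
    next
      case (Suc k)
      have disj: "x \<notin> A k" if x: "x \<in> (\<Union>i<k. A i)" for x
      proof -
        obtain i where "i < k" "x \<in> A i"
          using x by blast
        then show ?thesis
          using disjoint_family_onD[OF union(1), of i k] by auto
      qed
      have "Q (\<lambda>x. 1 * indicator ((\<Union>i<k. A i) \<inter> W) x + 1 * indicator (A k \<inter> W) x)"
        using Suc union(3) ind[OF A] ind[OF fin] by (intro Q_lincomb) auto
      moreover have "(\<lambda>x. 1 * indicator ((\<Union>i<k. A i) \<inter> W) x + 1 * indicator (A k \<inter> W) x :: complex) =
          indicator ((\<Union>i<Suc k. A i) \<inter> W)"
        using disj by (auto simp: indicator_def lessThan_Suc fun_eq_iff)
      ultimately show ?case
        by simp
    qed
    then have "indicator ((\<Union>i. A i) \<inter> W) \<in> L2 \<mu> \<and> Q (indicator ((\<Union>i. A i) \<inter> W))"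
    proof (intro Q_dominated_limit[where s = "\<lambda>k. indicator ((\<Union>i<k. A i) \<inter> W)"])
      show "indicator ((\<Union>i<k. A i) \<inter> W) \<in> L2 \<mu>" for k
        by (rule ind[OF fin])
      show "(indicator ((\<Union>i. A i) \<inter> W) :: 'g \<Rightarrow> complex) \<in> borel_measurable \<mu>"
        using A W(1) by (intro borel_measurable_indicator) auto
      show "integrable \<mu> (indicat_real (closure W))"
        using emeasure_compact_finite[OF W(2)] by (intro integrable_real_indicator) auto
      show "(cmod (indicator ((\<Union>i<k. A i) \<inter> W) x))\<^sup>2 \<le> indicat_real (closure W) x" for k x
        using closure_subset[of W] by (auto simp: indicator_def)
      show "(\<lambda>k. indicator ((\<Union>i<k. A i) \<inter> W) x :: complex) \<longlonglongrightarrow> indicator ((\<Union>i. A i) \<inter> W) x" for x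
      proof (cases "\<exists>i. x \<in> A i")
        case True
        then obtain i where i: "x \<in> A i" by blast
        then have "\<forall>\<^sub>F k in sequentially. (indicator ((\<Union>i<k. A i) \<inter> W) x :: complex) = indicator ((\<Union>i. A i) \<inter> W) x"
          by (intro eventually_sequentiallyI[of "Suc i"]) (auto simp: indicator_def)
        then show ?thesis
          by (rule tendsto_eventually)
      qed (simp add: indicator_def)
    qed
    then show ?case by blast
  qed
qed

lemma Q_simple_function:
  assumes s: "simple_function \<mu> s" and W: "open W" "compact (closure W)"
  shows "(\<lambda>x. s x * indicator W x) \<in> L2 \<mu> \<and> Q (\<lambda>x. s x * indicator W x)"
proof -
  have fin: "finite (range s)"
    using simple_functionD(1)[OF s] by simp
  have meas: "s -` {y} \<in> sets borel" for y
    using simple_functionD(2)[OF s, of "{y}"] by simp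
  have "(\<lambda>x. \<Sum>y\<in>Y. y * indicator (s -` {y} \<inter> W) x) \<in> L2 \<mu> \<and> Q (\<lambda>x. \<Sum>y\<in>Y. y * indicator (s -` {y} \<inter> W) x)"
    if "finite Y" for Y
    using that
  proof (induction Y rule: finite_induct)
    case empty
    have "(\<lambda>_. 0 :: complex) \<in> (Cc :: ('g \<Rightarrow> complex) set)"
      by (simp add: Cc_def)
    then show ?case
      using Cc_L2 Q_Cc by simp
  next
    case (insert y Y)
    have i: "indicator (s -` {y} \<inter> W) \<in> L2 \<mu>" "Q (indicator (s -` {y} \<inter> W))"
      using meas[of y] W Q_indicator_borel by (auto intro: indicator_L2[of _ W])
    show ?case
      unfolding sum.insert[OF insert(1,2)]
      using insert(3) L2_lincomb[OF i(1), of "\<lambda>x. \<Sum>y\<in>Y. y * indicator (s -` {y} \<inter> W) x" y 1]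
        Q_lincomb[OF i(1) _ i(2), of "\<lambda>x. \<Sum>y\<in>Y. y * indicator (s -` {y} \<inter> W) x" y 1]
      by (simp only: mult_1_left simp_thms)
  qed
  note this[OF fin]
  moreover have "(\<Sum>y\<in>range s. y * indicator (s -` {y} \<inter> W) x) = s x * indicator W x" for x
  proof -
    have "(\<Sum>y\<in>range s. y * indicator (s -` {y} \<inter> W) x) = (\<Sum>y\<in>range s. if y = s x then s x * indicator W x else 0)"
      by (intro sum.cong) (auto simp: indicator_def)
    then show ?thesis
      using fin by simp
  qed
  ultimately show ?thesis
    by (simp only:)
qed

lemma L2_induct_Cc:
  assumes f: "f \<in> L2 \<mu>"
  shows "Q f"
proof -
  note [measurable] = L2_measurable[OF f]
  obtain W :: "nat \<Rightarrow> 'g set" where W: "\<forall>k. open (W k) \<and> compact (closure (W k)) \<and> closure (W k) \<subseteq> UNIV"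
    "incseq W" "(\<Union>k. W k) = UNIV"
    by (rule open_relatively_compact_exhaustion[OF locally_compact open_UNIV])
  obtain s where s: "\<And>k. simple_function \<mu> (s k)" "\<And>x. (\<lambda>k. s k x) \<longlonglongrightarrow> f x" "\<And>k x. cmod (s k x) \<le> 2 * cmod (f x)"
    using borel_measurable_implies_sequence_metric[OF L2_measurable[OF f], of 0] by auto
  have "f \<in> L2 \<mu> \<and> Q f"
  proof (rule Q_dominated_limit[where s = "\<lambda>k x. s k x * indicator (W k) x"])
    show "(\<lambda>x. s k x * indicator (W k) x) \<in> L2 \<mu>" "Q (\<lambda>x. s k x * indicator (W k) x)" for k
      using Q_simple_function[OF s(1), of "W k" k] W(1) by auto
    show "integrable \<mu> (\<lambda>x. 4 * (cmod (f x))\<^sup>2)"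
      using L2_integrable_power2[OF f] by simp
    show "(cmod (s k x * indicator (W k) x))\<^sup>2 \<le> 4 * (cmod (f x))\<^sup>2" for k x
      using power_mono[OF s(3)[of k x] norm_ge_zero, of 2]
      by (cases "x \<in> W k") (auto simp: power_mult_distrib)
    show "(\<lambda>k. s k x * indicator (W k) x) \<longlonglongrightarrow> f x" for x
    proof -
      obtain k0 where "x \<in> W k0"
        using W(3) by blast
      then have "x \<in> W k" if "k \<ge> k0" for k
        using W(2) that by (auto simp: incseq_def)
      then have "\<forall>\<^sub>F k in sequentially. s k x * indicator (W k) x = s k x"
        by (intro eventually_sequentiallyI[of k0]) auto
      then show ?thesis
        by (rule tendsto_cong[THEN iffD2, OF _ s(2)])
    qed
  qed measurable
  then show ?thesis by blast
qed

end
end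

section \<open>Measurable fields of Hilbert-Schmidt operators\<close>

lemma hs_norm2_measurable:
  assumes [measurable]: "\<And>i j. (\<lambda>z. F z (unitvec i) j) \<in> borel_measurable M"
  shows "(\<lambda>z. hs_norm2 (F z)) \<in> borel_measurable M"
  unfolding hs_norm2_def by measurable

lemma tr_adj_comp_measurable:
  assumes [measurable]: "\<And>i j. (\<lambda>z. F z (unitvec i) j) \<in> borel_measurable M"
    "\<And>i j. (\<lambda>z. K z (unitvec i) j) \<in> borel_measurable M"
    and HS: "\<And>z. z \<in> space M \<Longrightarrow> F z \<in> HS (d z)" "\<And>z. z \<in> space M \<Longrightarrow> K z \<in> HS (d z)"
  shows "(\<lambda>z. tr (d z) (adj (d z) (K z) \<circ> F z)) \<in> borel_measurable M"
proof -
  have "(\<lambda>z. \<Sum>i. \<Sum>j. F z (unitvec i) j * cnj (K z (unitvec i) j)) \<in> borel_measurable M"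
    by measurable
  then show ?thesis
    by (rule measurable_cong[THEN iffD2, rotated]) (rule HS_tr_adj_comp(1)[OF HS])
qed

lemma tr_adj_self_integrable_iff:
  assumes meas: "\<And>i j. (\<lambda>z. F z (unitvec i) j) \<in> borel_measurable M"
    and HS: "\<And>z. z \<in> space M \<Longrightarrow> F z \<in> HS (d z)"
  shows "integrable M (\<lambda>z. tr (d z) (adj (d z) (F z) \<circ> F z)) \<longleftrightarrow> (\<integral>\<^sup>+z. hs_norm2 (F z) \<partial>M) < \<infinity>"
    and "ennreal (Re (LINT z|M. tr (d z) (adj (d z) (F z) \<circ> F z))) =
      (if (\<integral>\<^sup>+z. hs_norm2 (F z) \<partial>M) < \<infinity> then \<integral>\<^sup>+z. hs_norm2 (F z) \<partial>M else 0)"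
proof -
  let ?t = "\<lambda>z. tr (d z) (adj (d z) (F z) \<circ> F z)"
  have t: "?t z = of_real (Re (?t z))" "ennreal (Re (?t z)) = hs_norm2 (F z)" "0 \<le> Re (?t z)" if "z \<in> space M" for z
    using HS_tr_self[OF HS[OF that]] by simp_all
  have tm: "?t \<in> borel_measurable M"
    by (rule tr_adj_comp_measurable[OF meas meas HS HS])
  have nn: "(\<integral>\<^sup>+z. ennreal (norm (?t z)) \<partial>M) = (\<integral>\<^sup>+z. hs_norm2 (F z) \<partial>M)"
  proof (rule nn_integral_cong)
    fix z assume z: "z \<in> space M"
    have "norm (?t z) = Re (?t z)"
      using t(1,3)[OF z] by (metis abs_of_nonneg norm_of_real)
    then show "ennreal (norm (?t z)) = hs_norm2 (F z)"
      using t(2)[OF z] by simp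
  qed
  show iff: "integrable M ?t \<longleftrightarrow> (\<integral>\<^sup>+z. hs_norm2 (F z) \<partial>M) < \<infinity>"
    using tm nn by (simp add: integrable_iff_bounded)
  show "ennreal (Re (LINT z|M. ?t z)) =
      (if (\<integral>\<^sup>+z. hs_norm2 (F z) \<partial>M) < \<infinity> then \<integral>\<^sup>+z. hs_norm2 (F z) \<partial>M else 0)"
  proof (cases "integrable M ?t")
    case True
    have "ennreal (Re (LINT z|M. ?t z)) = ennreal (LINT z|M. Re (?t z))"
      using True by simp
    also have "\<dots> = (\<integral>\<^sup>+z. ennreal (Re (?t z)) \<partial>M)"
      using True t(3) by (intro nn_integral_eq_integral[symmetric]) auto
    also have "\<dots> = (\<integral>\<^sup>+z. hs_norm2 (F z) \<partial>M)"
      using t(2) by (intro nn_integral_cong)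
    finally show ?thesis
      using True iff by simp
  next
    case False
    then show ?thesis
      using iff by (simp add: not_integrable_integral_eq)
  qed
qed

lemma tr_adj_comp_integrable:
  assumes F: "\<And>i j. (\<lambda>z. F z (unitvec i) j) \<in> borel_measurable M" "\<And>z. z \<in> space M \<Longrightarrow> F z \<in> HS (d z)"
    "(\<integral>\<^sup>+z. hs_norm2 (F z) \<partial>M) < \<infinity>"
    and K: "\<And>i j. (\<lambda>z. K z (unitvec i) j) \<in> borel_measurable M" "\<And>z. z \<in> space M \<Longrightarrow> K z \<in> HS (d z)"
    "(\<integral>\<^sup>+z. hs_norm2 (K z) \<partial>M) < \<infinity>"
  shows "integrable M (\<lambda>z. tr (d z) (adj (d z) (K z) \<circ> F z))"
proof (rule Bochner_Integration.integrable_bound)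
  let ?f = "\<lambda>z. tr (d z) (adj (d z) (F z) \<circ> F z)" and ?k = "\<lambda>z. tr (d z) (adj (d z) (K z) \<circ> K z)"
  have "integrable M ?f" "integrable M ?k"
    using tr_adj_self_integrable_iff(1)[OF F(1,2)] tr_adj_self_integrable_iff(1)[OF K(1,2)] F(3) K(3) by blast+
  then show "integrable M (\<lambda>z. (Re (?f z) + Re (?k z)) / 2)"
    by (intro integrable_divide Bochner_Integration.integrable_add integrable_Re)
  show "(\<lambda>z. tr (d z) (adj (d z) (K z) \<circ> F z)) \<in> borel_measurable M"
    by (rule tr_adj_comp_measurable[OF F(1) K(1) F(2) K(2)])
  show "AE z in M. norm (tr (d z) (adj (d z) (K z) \<circ> F z)) \<le> norm ((Re (?f z) + Re (?k z)) / 2)"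
  proof (rule AE_I2)
    fix z assume z: "z \<in> space M"
    show "norm (tr (d z) (adj (d z) (K z) \<circ> F z)) \<le> norm ((Re (?f z) + Re (?k z)) / 2)"
      using HS_tr_adj_comp_bound[OF F(2)[OF z] K(2)[OF z]] unfolding real_norm_def by linarith
  qed
qed

lemma integrable_complex_indicator:
  assumes "A \<in> sets M" "emeasure M A < \<infinity>"
  shows "integrable M (indicator A :: _ \<Rightarrow> complex)"
proof -
  have "integrable M (\<lambda>x. complex_of_real (indicat_real A x))"
    using assms by (intro integrable_of_real integrable_real_indicator)
  moreover have "(\<lambda>x. complex_of_real (indicat_real A x)) = indicator A"
    by (auto simp: indicator_def)
  ultimately show ?thesis
    by simp
qed

section \<open>The dual and its Plancherel measure\<close>

lemma space_mackey_borel: "space mackey_borel = dual_group"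
  unfolding mackey_borel_def by (rule space_measure_of) auto

lemma dual_group_subset_Irr: "p \<in> dual_group \<Longrightarrow> r \<in> p \<Longrightarrow> r \<in> Irr"
  unfolding dual_group_def quotient_def by auto

lemma space_Irr_borel: "space Irr_borel = Irr"
  unfolding Irr_borel_def by (rule space_measure_of) auto

lemma Irr_borel_generator:
  fixes x :: "'g::topological_group_add"
  assumes "u \<in> hil n" "v \<in> hil n" "open B"
  shows "{r \<in> Irr. fst r = n \<and> cinner (snd r x u) v \<in> B} \<in> sets Irr_borel"
proof -
  have "sets (Irr_borel :: 'g rep measure) = sigma_sets Irr {{r \<in> Irr. fst r = n \<and> cinner (snd r x u) v \<in> B} | n x u v B.
        u \<in> hil n \<and> v \<in> hil n \<and> open B}"
    unfolding Irr_borel_def by (rule sets_measure_of) auto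
  moreover have "\<exists>n' x' u' v' B'. {r \<in> Irr. fst r = n \<and> cinner (snd r x u) v \<in> B} =
      {r \<in> Irr. fst r = n' \<and> cinner (snd r x' u') v' \<in> B'} \<and> u' \<in> hil n' \<and> v' \<in> hil n' \<and> open B'"
    by (rule exI[of _ n], rule exI[of _ x], rule exI[of _ u], rule exI[of _ v], rule exI[of _ B]) (simp add: assms)
  ultimately show ?thesis
    by (simp only: sigma_sets.Basic mem_Collect_eq)
qed

lemma Irr_unitary: "r \<in> Irr \<Longrightarrow> unitary_rep (fst r, snd r)"
  by (simp add: Irr_def irreducible_rep_def)

text \<open>The dimension takes countably many values. Where it is too small for \<open>i\<close> or \<open>j\<close> the entry is 0, so
  that the set in question is either empty or consists of all representations of this dimension; the
  latter set is a generator with \<open>u = v = 0\<close> and \<open>B = UNIV\<close>.\<close>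

lemma rep_entry_measurable: "(\<lambda>r. snd r x (unitvec j) i) \<in> borel_measurable Irr_borel"
proof (rule borel_measurableI)
  fix S :: "complex set" assume S: "open S"
  define E where "E n = (if i \<in> ix n \<and> j \<in> ix n
    then {r \<in> Irr. fst r = n \<and> cinner (snd r x (unitvec j)) (unitvec i) \<in> S}
    else if 0 \<in> S then {r \<in> Irr. fst r = n \<and> cinner (snd r x (\<lambda>_. 0)) (\<lambda>_. 0) \<in> UNIV} else {})" for n
  have E: "E n \<in> sets Irr_borel" for n
    unfolding E_def using S Irr_borel_generator[of "unitvec j" n "unitvec i" S x]
      Irr_borel_generator[of "\<lambda>_. 0" n "\<lambda>_. 0" UNIV x] by simp
  have "(\<lambda>r. snd r x (unitvec j) i) -` S \<inter> space Irr_borel = (\<Union>n. E n)"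
  proof -
    have "r \<in> E (fst r) \<longleftrightarrow> snd r x (unitvec j) i \<in> S" if "r \<in> Irr" for r
      using that bounded_ops_entry_outside[OF rep_bounded_ops[OF Irr_unitary[OF that]], of j i x]
      by (auto simp: E_def)
    moreover have "r \<in> E n \<Longrightarrow> r \<in> Irr \<and> n = fst r" for r n
      by (auto simp: E_def split: if_splits)
    ultimately show ?thesis
      unfolding space_Irr_borel by blast
  qed
  also have "\<dots> \<in> sets Irr_borel"
    using E by (intro sets.countable_UN'') auto
  finally show "(\<lambda>r. snd r x (unitvec j) i) -` S \<inter> space Irr_borel \<in> sets Irr_borel" .
qed

locale plancherel_group = haar_group \<mu> for \<mu> :: "'g::{topological_group_add, t2_space, second_countable_topology} measure" +
  fixes \<rho> :: "'g rep set \<Rightarrow> 'g rep" and P :: "'g rep set measure"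
  assumes sect: "measurable_section \<rho>" and plancherel: "plancherel_measure \<mu> \<rho> P"
begin

lemma sets_P: "sets P = sets mackey_borel"
  using plancherel by (simp add: plancherel_measure_def)

lemma space_P: "space P = dual_group"
  using sets_eq_imp_space_eq[OF sets_P] by (simp add: space_mackey_borel)

lemma section_Irr: "p \<in> space P \<Longrightarrow> \<rho> p \<in> Irr"
  using sect dual_group_subset_Irr unfolding space_P measurable_section_def by blast

lemma section_unitary: "p \<in> space P \<Longrightarrow> unitary_rep (dual_dim \<rho> p, snd (\<rho> p))"
  unfolding dual_dim_def by (rule Irr_unitary[OF section_Irr])

lemma section_nonzero: "p \<in> space P \<Longrightarrow> dual_dim \<rho> p \<noteq> 0"
  using section_Irr[of p] unfolding dual_dim_def by (cases "\<rho> p") (simp add: Irr_def irreducible_rep_def)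

lemma section_measurable: "\<rho> \<in> measurable P Irr_borel"
  using sect measurable_cong_sets[OF sets_P refl] unfolding measurable_section_def by blast

text \<open>The matrix entries of \<open>\<pi>(y)\<^sup>*\<close>, against which functions are integrated to give the entries of the
  Fourier transform.\<close>

definition entry :: "nat \<Rightarrow> nat \<Rightarrow> 'g \<Rightarrow> 'g rep set \<Rightarrow> complex" where
  "entry i j y p = cnj (snd (\<rho> p) y (unitvec j) i)"

lemma cinner_unitvec_rep:
  assumes p: "p \<in> space P" and ij: "i \<in> ix (dual_dim \<rho> p)" "j \<in> ix (dual_dim \<rho> p)"
  shows "cinner (unitvec i) (snd (\<rho> p) y (unitvec j)) = entry i j y p"
  using cinner_commute[OF rep_in_hil[OF section_unitary[OF p]], of "unitvec i" y "unitvec j"] ij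
  by (simp add: entry_def)

lemma entry_outside:
  assumes p: "p \<in> space P" and ij: "i \<notin> ix (dual_dim \<rho> p) \<or> j \<notin> ix (dual_dim \<rho> p)"
  shows "entry i j y p = 0"
  using bounded_ops_entry_outside[OF rep_bounded_ops[OF section_unitary[OF p]], of j i y] ij
  by (auto simp: entry_def)

lemma entry_measurable [measurable]: "(\<lambda>(y, p). entry i j y p) \<in> borel_measurable (borel \<Otimes>\<^sub>M P)"
proof (rule borel_measurable_caratheodory)
  fix p assume p: "p \<in> space P"
  show "continuous_on UNIV (\<lambda>y. entry i j y p)"
  proof (cases "i \<in> ix (dual_dim \<rho> p) \<and> j \<in> ix (dual_dim \<rho> p)")
    case True
    then show ?thesis
      using rep_cinner_continuous[OF section_unitary[OF p], of "unitvec i" "unitvec j"]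
      by (simp add: cinner_unitvec_rep[OF p])
  next
    case False
    then have "entry i j y p = 0" for y
      using entry_outside[OF p] by blast
    then show ?thesis
      by simp
  qed
next
  fix y
  show "entry i j y \<in> borel_measurable P"
    unfolding entry_def[abs_def]
    by (intro borel_measurable_cnj measurable_compose[OF section_measurable rep_entry_measurable])
qed

lemma fourier_rep_integral:
  assumes "p \<in> space P" "integrable \<mu> a"
  shows "fourier \<mu> \<rho> a p = rep_integral (dual_dim \<rho> p) (snd (\<rho> p)) \<mu> a"
  unfolding fourier_def rep_integral_def[OF section_unitary[OF assms(1)] sets_haar assms(2)]
  by (simp add: dual_dim_def)

lemma fourier_bounded_ops:
  assumes "p \<in> space P" "integrable \<mu> a"
  shows "fourier \<mu> \<rho> a p \<in> bounded_ops (dual_dim \<rho> p)"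
  unfolding fourier_rep_integral[OF assms]
  by (rule rep_integral_bounded_ops[OF section_unitary[OF assms(1)] sets_haar assms(2)])

lemma cinner_fourier:
  assumes "p \<in> space P" "integrable \<mu> a" "u \<in> hil (dual_dim \<rho> p)" "v \<in> hil (dual_dim \<rho> p)"
  shows "cinner (fourier \<mu> \<rho> a p u) v = (LINT y|\<mu>. a y * cinner u (snd (\<rho> p) y v))"
  unfolding fourier_rep_integral[OF assms(1,2)]
  by (rule cinner_rep_integral[OF section_unitary[OF assms(1)] sets_haar assms(2-4)])

lemma fourier_entry:
  assumes p: "p \<in> space P" and a: "integrable \<mu> a"
  shows "fourier \<mu> \<rho> a p (unitvec i) j = (LINT y|\<mu>. a y * entry i j y p)"
proof (cases "i \<in> ix (dual_dim \<rho> p) \<and> j \<in> ix (dual_dim \<rho> p)")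
  case True
  then show ?thesis
    using cinner_fourier[OF p a, of "unitvec i" "unitvec j"] by (simp add: cinner_unitvec_rep[OF p])
next
  case False
  then show ?thesis
    using bounded_ops_entry_outside[OF fourier_bounded_ops[OF p a], of i j] entry_outside[OF p] by simp
qed

lemma fourier_lincomb:
  assumes p: "p \<in> space P" and a: "integrable \<mu> a" and b: "integrable \<mu> b"
  shows "fourier \<mu> \<rho> (\<lambda>y. c * a y + c' * b y) p = (\<lambda>u i. c * fourier \<mu> \<rho> a p u i + c' * fourier \<mu> \<rho> b p u i)"
proof (intro ext)
  fix u i
  let ?n = "dual_dim \<rho> p"
  have ab: "integrable \<mu> (\<lambda>y. c * a y + c' * b y)"
    using a b by simp
  note A = fourier_bounded_ops[OF p a] and B = fourier_bounded_ops[OF p b] and AB = fourier_bounded_ops[OF p ab]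
  consider "u \<notin> hil ?n" | "i \<notin> ix ?n" | "u \<in> hil ?n" "i \<in> ix ?n" by blast
  then show "fourier \<mu> \<rho> (\<lambda>y. c * a y + c' * b y) p u i = c * fourier \<mu> \<rho> a p u i + c' * fourier \<mu> \<rho> b p u i"
  proof cases
    case 1
    then show ?thesis
      by (simp add: bounded_ops_outside[OF A] bounded_ops_outside[OF B] bounded_ops_outside[OF AB])
  next
    case 2
    then show ?thesis
      by (simp add: hil_outside[OF bounded_ops_in_hil[OF A]] hil_outside[OF bounded_ops_in_hil[OF B]]
          hil_outside[OF bounded_ops_in_hil[OF AB]])
  next
    case 3
    then have e: "unitvec i \<in> hil ?n" by simp
    let ?c = "\<lambda>y. cinner u (snd (\<rho> p) y (unitvec i))"
    have "(LINT y|\<mu>. (c * a y + c' * b y) * ?c y) = (LINT y|\<mu>. c * (a y * ?c y) + c' * (b y * ?c y))"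
      by (simp add: algebra_simps)
    also have "\<dots> = c * (LINT y|\<mu>. a y * ?c y) + c' * (LINT y|\<mu>. b y * ?c y)"
      using rep_integrable[OF section_unitary[OF p] sets_haar a 3(1) e]
        rep_integrable[OF section_unitary[OF p] sets_haar b 3(1) e] by simp
    finally show ?thesis
      using cinner_fourier[OF p a 3(1) e] cinner_fourier[OF p b 3(1) e] cinner_fourier[OF p ab 3(1) e] by simp
  qed
qed

lemma fourier_entry_measurable:
  assumes a: "integrable \<mu> a"
  shows "(\<lambda>p. fourier \<mu> \<rho> a p (unitvec i) j) \<in> borel_measurable P"
proof -
  have [measurable]: "a \<in> borel_measurable borel"
    using borel_measurable_integrable[OF a] by simp
  have "(\<lambda>(y, p). entry i j y p) \<in> borel_measurable (\<mu> \<Otimes>\<^sub>M P)"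
    using entry_measurable measurable_cong_sets[OF sets_pair_measure_cong[OF sets_haar refl] refl] by blast
  then have [measurable]: "(\<lambda>z. entry i j (snd z) (fst z)) \<in> borel_measurable (P \<Otimes>\<^sub>M \<mu>)"
    using measurable_compose[OF measurable_pair_swap'] by (simp add: case_prod_unfold)
  have "(\<lambda>p. LINT y|\<mu>. a y * entry i j y p) \<in> borel_measurable P"
    by (rule borel_measurable_lebesgue_integral) (simp add: case_prod_unfold)
  then show ?thesis
    by (rule measurable_cong[THEN iffD2, rotated]) (rule fourier_entry[OF _ a])
qed

lemma plancherel_unitary:
  obtains U where
    "\<forall>f\<in>L2 \<mu>. (\<forall>p\<in>space P. U f p \<in> HS (dual_dim \<rho> p)) \<and>
      (\<forall>i j. (\<lambda>p. U f p (unitvec i) j) \<in> borel_measurable P) \<and>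
      integrable P (\<lambda>p. tr (dual_dim \<rho> p) (adj (dual_dim \<rho> p) (U f p) \<circ> U f p))"
    "\<forall>f\<in>L2 \<mu>. \<forall>g\<in>L2 \<mu>. (LINT p|P. tr (dual_dim \<rho> p) (adj (dual_dim \<rho> p) (U g p) \<circ> U f p)) = L2_inner \<mu> f g"
    "\<forall>f\<in>L1 \<mu> \<inter> L2 \<mu>. AE p in P. U f p = fourier \<mu> \<rho> f p"
  using plancherel unfolding plancherel_measure_def di_inner_def dual_L2_def direct_integral_def by auto

text \<open>The Plancherel isometry, restated for the Fourier integrals themselves. The norm identity is one
  between integrals in \<open>[0, \<infinity>]\<close>, so that it can be used before any integrability on the product space
  is known.\<close>

lemma
  assumes f: "f \<in> L1 \<mu> \<inter> L2 \<mu>"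
  shows AE_fourier_HS: "AE p in P. fourier \<mu> \<rho> f p \<in> HS (dual_dim \<rho> p)"
    and plancherel_fourier_norm:
      "(\<integral>\<^sup>+p. hs_norm2 (fourier \<mu> \<rho> f p) \<partial>P) = (\<integral>\<^sup>+y. ennreal ((cmod (f y))\<^sup>2) \<partial>\<mu>)"
proof -
  obtain U where U: "\<forall>f\<in>L2 \<mu>. (\<forall>p\<in>space P. U f p \<in> HS (dual_dim \<rho> p)) \<and>
      (\<forall>i j. (\<lambda>p. U f p (unitvec i) j) \<in> borel_measurable P) \<and>
      integrable P (\<lambda>p. tr (dual_dim \<rho> p) (adj (dual_dim \<rho> p) (U f p) \<circ> U f p))"
    "\<forall>f\<in>L2 \<mu>. \<forall>g\<in>L2 \<mu>. (LINT p|P. tr (dual_dim \<rho> p) (adj (dual_dim \<rho> p) (U g p) \<circ> U f p)) = L2_inner \<mu> f g"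
    "\<forall>f\<in>L1 \<mu> \<inter> L2 \<mu>. AE p in P. U f p = fourier \<mu> \<rho> f p"
    by (rule plancherel_unitary)
  have fU: "AE p in P. U f p = fourier \<mu> \<rho> f p" and fL: "f \<in> L2 \<mu>"
    using U(3) f by auto
  have HS: "U f p \<in> HS (dual_dim \<rho> p)" if "p \<in> space P" for p
    using U(1) fL that by blast
  have meas: "(\<lambda>p. U f p (unitvec i) j) \<in> borel_measurable P" for i j
    using U(1) fL by blast
  have int: "integrable P (\<lambda>p. tr (dual_dim \<rho> p) (adj (dual_dim \<rho> p) (U f p) \<circ> U f p))"
    using U(1) fL by blast
  show "AE p in P. fourier \<mu> \<rho> f p \<in> HS (dual_dim \<rho> p)"
    using fU AE_space
  proof eventually_elim
    case (elim p)
    then show ?case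
      using HS[of p] by simp
  qed
  have "(\<integral>\<^sup>+p. hs_norm2 (fourier \<mu> \<rho> f p) \<partial>P) = (\<integral>\<^sup>+p. hs_norm2 (U f p) \<partial>P)"
    using fU by (intro nn_integral_cong_AE) auto
  also have "\<dots> = ennreal (Re (LINT p|P. tr (dual_dim \<rho> p) (adj (dual_dim \<rho> p) (U f p) \<circ> U f p)))"
    using tr_adj_self_integrable_iff[of "U f" P "dual_dim \<rho>", OF meas HS] int by simp
  also have "\<dots> = ennreal (Re (L2_inner \<mu> f f))"
    using U(2) fL by simp
  also have "\<dots> = (\<integral>\<^sup>+y. ennreal ((cmod (f y))\<^sup>2) \<partial>\<mu>)"
    unfolding L2_inner_self Re_complex_of_real
    by (rule nn_integral_eq_integral[OF L2_integrable_power2[OF fL], symmetric]) auto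
  finally show "(\<integral>\<^sup>+p. hs_norm2 (fourier \<mu> \<rho> f p) \<partial>P) = (\<integral>\<^sup>+y. ennreal ((cmod (f y))\<^sup>2) \<partial>\<mu>)" .
qed

lemma plancherel_fourier_inner:
  assumes f: "f \<in> L1 \<mu> \<inter> L2 \<mu>" and g: "g \<in> L1 \<mu> \<inter> L2 \<mu>"
    and F: "AE p in P. F p = fourier \<mu> \<rho> f p" and G: "AE p in P. G p = fourier \<mu> \<rho> g p"
    and meas: "(\<lambda>p. tr (dual_dim \<rho> p) (adj (dual_dim \<rho> p) (G p) \<circ> F p)) \<in> borel_measurable P"
  shows "(LINT p|P. tr (dual_dim \<rho> p) (adj (dual_dim \<rho> p) (G p) \<circ> F p)) = L2_inner \<mu> f g"
proof -
  obtain U where U: "\<forall>f\<in>L2 \<mu>. (\<forall>p\<in>space P. U f p \<in> HS (dual_dim \<rho> p)) \<and>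
      (\<forall>i j. (\<lambda>p. U f p (unitvec i) j) \<in> borel_measurable P) \<and>
      integrable P (\<lambda>p. tr (dual_dim \<rho> p) (adj (dual_dim \<rho> p) (U f p) \<circ> U f p))"
    "\<forall>f\<in>L2 \<mu>. \<forall>g\<in>L2 \<mu>. (LINT p|P. tr (dual_dim \<rho> p) (adj (dual_dim \<rho> p) (U g p) \<circ> U f p)) = L2_inner \<mu> f g"
    "\<forall>f\<in>L1 \<mu> \<inter> L2 \<mu>. AE p in P. U f p = fourier \<mu> \<rho> f p"
    by (rule plancherel_unitary)
  have fU: "AE p in P. U f p = fourier \<mu> \<rho> f p" and gU: "AE p in P. U g p = fourier \<mu> \<rho> g p"
    using U(3) f g by auto
  have "(LINT p|P. tr (dual_dim \<rho> p) (adj (dual_dim \<rho> p) (G p) \<circ> F p)) =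
      (LINT p|P. tr (dual_dim \<rho> p) (adj (dual_dim \<rho> p) (U g p) \<circ> U f p))"
  proof (rule integral_cong_AE[OF meas])
    show "(\<lambda>p. tr (dual_dim \<rho> p) (adj (dual_dim \<rho> p) (U g p) \<circ> U f p)) \<in> borel_measurable P"
      by (rule tr_adj_comp_measurable) (use U(1) f g in auto)
    show "AE p in P. tr (dual_dim \<rho> p) (adj (dual_dim \<rho> p) (G p) \<circ> F p) =
        tr (dual_dim \<rho> p) (adj (dual_dim \<rho> p) (U g p) \<circ> U f p)"
      using F G fU gU by eventually_elim simp
  qed
  also have "\<dots> = L2_inner \<mu> f g"
    using U(2) f g by simp
  finally show ?thesis .
qed

text \<open>On a small neighbourhood \<open>V\<close> of the unit \<open>\<pi>\<close> is nearly the identity on a given unit vector, so the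
  diagonal entry at this vector of the transform of the indicator of \<open>V\<close> has real part at least
  \<open>\<mu>(V)/2\<close>.\<close>

lemma fourier_indicator_nonzero:
  assumes p: "p \<in> space P" and V: "\<And>k::nat. open (V k)" "\<And>k. 0 \<in> V k" "\<And>k. emeasure \<mu> (V k) < \<infinity>"
    and small: "\<And>S. open S \<Longrightarrow> 0 \<in> S \<Longrightarrow> \<exists>k. V k \<subseteq> S"
  shows "\<exists>k. hs_norm2 (fourier \<mu> \<rho> (indicator (V k)) p) > 0"
proof -
  let ?u = "unitvec 0" and ?n = "dual_dim \<rho> p"
  have 0: "0 \<in> ix ?n"
    using section_nonzero[OF p] by (simp add: ix_def zero_less_iff_neq_zero enat_0)
  then have u: "?u \<in> hil ?n"
    by simp
  define c where "c y = Re (cinner ?u (snd (\<rho> p) y ?u))" for y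
  have cont: "continuous_on UNIV c"
    unfolding c_def by (intro continuous_intros rep_cinner_continuous[OF section_unitary[OF p] u u])
  have c0: "c 0 = 1"
    unfolding c_def rep_zero[OF section_unitary[OF p] u] cinner_unitvec_right by (simp add: unitvec_def)
  have "open (c -` {1/2<..})"
    using cont by (intro open_vimage) auto
  then obtain k where k: "V k \<subseteq> c -` {1/2<..}"
    using small c0 by force
  have a: "integrable \<mu> (indicator (V k) :: 'g \<Rightarrow> complex)"
    using V(1,3)[of k] by (intro integrable_complex_indicator) auto
  have i: "integrable \<mu> (\<lambda>y. indicator (V k) y * cinner ?u (snd (\<rho> p) y ?u))"
    by (rule rep_integrable[OF section_unitary[OF p] sets_haar a u u])
  have "0 < 1/2 * measure \<mu> (V k)"
    using emeasure_open_pos[OF V(1,2)[of k]] V(3)[of k]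
    by (simp add: measure_def enn2real_positive_iff)
  also have "\<dots> = (LINT y|\<mu>. 1/2 * indicat_real (V k) y)"
    using V(1)[of k] by simp
  also have "\<dots> \<le> (LINT y|\<mu>. Re (indicator (V k) y * cinner ?u (snd (\<rho> p) y ?u)))"
  proof (rule integral_mono)
    show "integrable \<mu> (\<lambda>y. 1/2 * indicat_real (V k) y)"
      using V(1,3)[of k] by (intro integrable_mult_right integrable_real_indicator) auto
    show "integrable \<mu> (\<lambda>y. Re (indicator (V k) y * cinner ?u (snd (\<rho> p) y ?u)))"
      using i by (rule integrable_Re)
    show "1/2 * indicat_real (V k) y \<le> Re (indicator (V k) y * cinner ?u (snd (\<rho> p) y ?u))" for y
      using k by (cases "y \<in> V k") (auto simp: c_def)
  qed
  also have "\<dots> = Re (cinner (fourier \<mu> \<rho> (indicator (V k)) p ?u) ?u)"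
    unfolding cinner_fourier[OF p a u u] using i by (rule integral_Re)
  finally have "fourier \<mu> \<rho> (indicator (V k)) p ?u 0 \<noteq> 0"
    by auto
  then have "0 < ennreal ((cmod (fourier \<mu> \<rho> (indicator (V k)) p ?u 0))\<^sup>2)"
    by simp
  also have "\<dots> \<le> hs_norm2 (fourier \<mu> \<rho> (indicator (V k)) p)"
    by (rule entry_le_hs_norm2)
  finally show ?thesis by blast
qed

text \<open>The squared norms of the Fourier transforms of countably many indicators are integrable, and at each
  point of the dual one of them is positive. Hence the sets where one of them is at least \<open>1/m\<close> exhaust
  the dual, and they have finite measure by Markov's inequality.\<close>

lemma sigma_finite_plancherel: "sigma_finite_measure P"
proof
  obtain B :: "nat \<Rightarrow> 'g set" where B: "\<And>i. open (B i)" "\<And>i. 0 \<in> B i"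
    "\<And>S. open S \<Longrightarrow> 0 \<in> S \<Longrightarrow> eventually (\<lambda>i. B i \<subseteq> S) sequentially"
    using countable_basis_at_decseq[of "0::'g"] by metis
  obtain W where W: "open W" "(0::'g) \<in> W" "compact (closure W)"
    using compact_neighbourhood[OF locally_compact open_UNIV, of 0] by blast
  define V where "V k = B k \<inter> W" for k
  have V: "open (V k)" "0 \<in> V k" for k
    using B W by (auto simp: V_def)
  have Vfin: "emeasure \<mu> (V k) < \<infinity>" for k
  proof -
    have "V k \<subseteq> closure W"
      using closure_subset[of W] by (auto simp: V_def)
    then have "emeasure \<mu> (V k) \<le> emeasure \<mu> (closure W)"
      by (intro emeasure_mono) auto
    then show ?thesis
      using emeasure_compact_finite[OF W(3)] by (rule order.strict_trans1)
  qed
  have small: "\<exists>k. V k \<subseteq> S" if S: "open S" "0 \<in> S" for S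
  proof -
    obtain k where "B k \<subseteq> S"
      using eventually_happens[OF B(3)[OF S]] by auto
    then show ?thesis
      by (auto simp: V_def)
  qed
  have a: "integrable \<mu> (indicator (V k) :: 'g \<Rightarrow> complex)" for k
    using V(1)[of k] Vfin[of k] by (intro integrable_complex_indicator) auto
  have aL: "(indicator (V k) :: 'g \<Rightarrow> complex) \<in> L1 \<mu> \<inter> L2 \<mu>" for k
  proof -
    have "(\<lambda>x. (cmod (indicator (V k) x))\<^sup>2) = indicat_real (V k)"
      by (auto simp: indicator_def)
    then have "integrable \<mu> (\<lambda>x. (cmod (indicator (V k) x))\<^sup>2)"
      using V(1)[of k] Vfin[of k] by (simp add: integrable_indicator_iff)
    then show ?thesis
      using a[of k] by (simp add: L1_def L2_def)
  qed
  define h where "h k p = hs_norm2 (fourier \<mu> \<rho> (indicator (V k)) p)" for k p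
  have [measurable]: "h k \<in> borel_measurable P" for k
    unfolding h_def by (intro hs_norm2_measurable fourier_entry_measurable a)
  have hfin: "(\<integral>\<^sup>+p. h k p \<partial>P) < \<infinity>" for k
  proof -
    have "(\<integral>\<^sup>+p. h k p \<partial>P) = (\<integral>\<^sup>+y. ennreal ((cmod (indicator (V k) y))\<^sup>2) \<partial>\<mu>)"
      unfolding h_def by (rule plancherel_fourier_norm[OF aL])
    also have "\<dots> = (\<integral>\<^sup>+y. indicator (V k) y \<partial>\<mu>)"
      by (intro nn_integral_cong) (auto simp: indicator_def)
    finally show ?thesis
      using V(1)[of k] Vfin[of k] by simp
  qed
  define E where "E k m = {p \<in> space P. 1 \<le> of_nat (Suc m) * h k p}" for k m :: nat
  have "emeasure P (E k m) \<noteq> \<infinity>" for k m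
  proof -
    have "emeasure P (E k m) \<le> of_nat (Suc m) * (\<integral>\<^sup>+p. h k p \<partial>P)"
      using nn_integral_Markov_inequality[of "h k" "space P" P "of_nat (Suc m)"]
      by (simp add: E_def cong: nn_integral_cong)
    also have "\<dots> < \<infinity>"
      using hfin[of k] by (simp add: ennreal_mult_less_top ennreal_of_nat_eq_real_of_nat)
    finally show ?thesis by simp
  qed
  moreover have "E k m \<in> sets P" for k m
    unfolding E_def by measurable
  moreover have "\<exists>k m. p \<in> E k m" if p: "p \<in> space P" for p
  proof -
    obtain k where "h k p > 0"
      using fourier_indicator_nonzero[OF p V Vfin small] unfolding h_def by blast
    have "\<exists>m. 1 \<le> of_nat (Suc m) * h k p"
    proof (cases "h k p")
      case (real r)
      then have "r > 0"
        using \<open>h k p > 0\<close> by simp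
      then obtain m where "inverse (real (Suc m)) < r"
        using reals_Archimedean by blast
      then have "1 \<le> real (Suc m) * r"
        by (simp add: field_simps)
      then have "ennreal 1 \<le> ennreal (real (Suc m) * r)"
        by (rule ennreal_leI)
      then show ?thesis
        using real by (intro exI[of _ m]) (simp add: ennreal_mult ennreal_of_nat_eq_real_of_nat del: of_nat_Suc)
    qed (auto intro!: exI[of _ 0])
    then show ?thesis
      using p by (auto simp: E_def)
  qed
  ultimately show "\<exists>A. countable A \<and> A \<subseteq> sets P \<and> \<Union>A = space P \<and> (\<forall>a\<in>A. emeasure P a \<noteq> \<infinity>)"
    by (intro exI[of _ "range (\<lambda>(k, m). E k m)"]) (auto simp: E_def)
qed

end

section \<open>The Gabor transform and its orthogonality relation\<close>

lemma zero_op_HS: "(\<lambda>_ _. 0) \<in> HS n" and hs_norm2_zero_op [simp]: "hs_norm2 (\<lambda>_ _. 0) = 0"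
proof -
  show *: "hs_norm2 (\<lambda>_ _. 0) = 0"
    by (simp add: hs_norm2_def)
  have "(\<lambda>_ _. 0) \<in> bounded_ops n"
    by (auto simp: bounded_ops_def linear_on_hil_def hnorm_def cinner_def intro!: exI[of _ 0])
  then show "(\<lambda>_ _. 0) \<in> HS n"
    using * by (simp add: HS_iff)
qed

lemma L2_norm_nonneg: "0 \<le> L2_norm M f"
  by (simp add: L2_norm_def L2_inner_self)

text \<open>The function whose Fourier transform at \<open>\<pi>\<close> is the Gabor transform at \<open>(x, \<pi>)\<close>.\<close>

definition windowed :: "('g::group_add \<Rightarrow> complex) \<Rightarrow> ('g \<Rightarrow> complex) \<Rightarrow> 'g \<Rightarrow> 'g \<Rightarrow> complex" where
  "windowed \<psi> f x y = f y * cnj (\<psi> (- x + y))"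

context haar_group
begin

lemma integrable_left_translate:
  fixes h :: "'g \<Rightarrow> 'b::{banach, second_countable_topology}"
  assumes "integrable \<mu> h"
  shows "integrable \<mu> (\<lambda>y. h (a + y))"
  using integrable_distr[of "\<lambda>y. a + y" \<mu> borel h] assms by (simp add: left_translate_distr)

lemma L2_left_translate:
  assumes "\<psi> \<in> L2 \<mu>"
  shows "(\<lambda>y. \<psi> (a + y)) \<in> L2 \<mu>"
proof -
  have [measurable]: "\<psi> \<in> borel_measurable borel"
    using L2_measurable[OF assms] by simp
  have "(\<lambda>y. \<psi> (a + y)) \<in> borel_measurable borel"
    by measurable
  then show ?thesis
    using integrable_left_translate[OF L2_integrable_power2[OF assms], of a] by (simp add: L2_def)
qed

lemma windowed_integrable:
  assumes "\<psi> \<in> L2 \<mu>" "f \<in> L2 \<mu>"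
  shows "integrable \<mu> (windowed \<psi> f x)"
  unfolding windowed_def[abs_def] by (rule L2_mult_cnj_integrable[OF assms(2) L2_left_translate[OF assms(1)]])

lemma nn_integral_left_diff:
  assumes [measurable]: "v \<in> borel_measurable borel"
  shows "(\<integral>\<^sup>+x. v (- x + y) \<partial>\<mu>) = (\<integral>\<^sup>+x. v x \<partial>\<mu>)"
  using nn_integral_distr[of "\<lambda>x. - x + y" \<mu> borel v] by (simp add: left_diff_distr)

lemma nn_integral_windowed:
  assumes [measurable]: "u \<in> borel_measurable borel" "v \<in> borel_measurable borel"
  shows "(\<integral>\<^sup>+x. (\<integral>\<^sup>+y. u y * v (- x + y) \<partial>\<mu>) \<partial>\<mu>) = (\<integral>\<^sup>+y. u y \<partial>\<mu>) * (\<integral>\<^sup>+x. v x \<partial>\<mu>)"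
proof -
  interpret S: pair_sigma_finite \<mu> \<mu> ..
  have "(\<integral>\<^sup>+x. (\<integral>\<^sup>+y. u y * v (- x + y) \<partial>\<mu>) \<partial>\<mu>) = (\<integral>\<^sup>+y. (\<integral>\<^sup>+x. u y * v (- x + y) \<partial>\<mu>) \<partial>\<mu>)"
    by (rule S.Fubini'[symmetric]) measurable
  also have "\<dots> = (\<integral>\<^sup>+y. u y * (\<integral>\<^sup>+x. v x \<partial>\<mu>) \<partial>\<mu>)"
    by (simp add: nn_integral_cmult nn_integral_left_diff)
  also have "\<dots> = (\<integral>\<^sup>+y. u y \<partial>\<mu>) * (\<integral>\<^sup>+x. v x \<partial>\<mu>)"
    by (simp add: nn_integral_multc)
  finally show ?thesis .
qed

lemma nn_integral_windowed_power2:
  assumes \<psi>: "\<psi> \<in> L2 \<mu>" and f: "f \<in> L2 \<mu>"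
  shows "(\<integral>\<^sup>+x. (\<integral>\<^sup>+y. ennreal ((cmod (windowed \<psi> f x y))\<^sup>2) \<partial>\<mu>) \<partial>\<mu>) =
    ennreal ((L2_norm \<mu> f)\<^sup>2 * (L2_norm \<mu> \<psi>)\<^sup>2)"
proof -
  have [measurable]: "f \<in> borel_measurable borel" "\<psi> \<in> borel_measurable borel"
    using L2_measurable[OF f] L2_measurable[OF \<psi>] by simp_all
  have N: "(\<integral>\<^sup>+y. ennreal ((cmod (h y))\<^sup>2) \<partial>\<mu>) = ennreal ((L2_norm \<mu> h)\<^sup>2)" if "h \<in> L2 \<mu>" for h
    unfolding L2_norm_power2 by (rule nn_integral_eq_integral[OF L2_integrable_power2[OF that]]) simp
  have "(\<integral>\<^sup>+x. (\<integral>\<^sup>+y. ennreal ((cmod (windowed \<psi> f x y))\<^sup>2) \<partial>\<mu>) \<partial>\<mu>) =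
      (\<integral>\<^sup>+x. (\<integral>\<^sup>+y. ennreal ((cmod (f y))\<^sup>2) * ennreal ((cmod (\<psi> (- x + y)))\<^sup>2) \<partial>\<mu>) \<partial>\<mu>)"
    by (simp add: windowed_def norm_mult power_mult_distrib ennreal_mult)
  also have "\<dots> = (\<integral>\<^sup>+y. ennreal ((cmod (f y))\<^sup>2) \<partial>\<mu>) * (\<integral>\<^sup>+y. ennreal ((cmod (\<psi> y))\<^sup>2) \<partial>\<mu>)"
    by (rule nn_integral_windowed) measurable
  finally show ?thesis
    by (simp add: N[OF f] N[OF \<psi>] ennreal_mult)
qed

lemma windowed_measurable:
  assumes "\<psi> \<in> L2 \<mu>" "f \<in> L2 \<mu>"
  shows "windowed \<psi> f x \<in> borel_measurable borel"
    and "(\<lambda>(x, y). windowed \<psi> f x y) \<in> borel_measurable (\<mu> \<Otimes>\<^sub>M \<mu>)"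
proof -
  have [measurable]: "f \<in> borel_measurable borel" "\<psi> \<in> borel_measurable borel"
    using L2_measurable[OF assms(1)] L2_measurable[OF assms(2)] by simp_all
  show "windowed \<psi> f x \<in> borel_measurable borel"
    unfolding windowed_def[abs_def] by measurable
  show "(\<lambda>(x, y). windowed \<psi> f x y) \<in> borel_measurable (\<mu> \<Otimes>\<^sub>M \<mu>)"
    unfolding windowed_def[abs_def] by measurable
qed

text \<open>By Tonelli, almost every slice is also in \<open>L2\<close>, so that Plancherel applies to it.\<close>

lemma AE_windowed_L1_L2:
  assumes "\<psi> \<in> L2 \<mu>" "f \<in> L2 \<mu>"
  shows "AE x in \<mu>. windowed \<psi> f x \<in> L1 \<mu> \<inter> L2 \<mu>"
proof -
  note [measurable] = windowed_measurable[OF assms]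
  have "(\<lambda>(x, y). ennreal ((cmod (windowed \<psi> f x y))\<^sup>2)) \<in> borel_measurable (\<mu> \<Otimes>\<^sub>M \<mu>)"
    by measurable
  then have "(\<lambda>x. \<integral>\<^sup>+y. ennreal ((cmod (windowed \<psi> f x y))\<^sup>2) \<partial>\<mu>) \<in> borel_measurable \<mu>"
    by (rule borel_measurable_nn_integral)
  then have "AE x in \<mu>. (\<integral>\<^sup>+y. ennreal ((cmod (windowed \<psi> f x y))\<^sup>2) \<partial>\<mu>) \<noteq> \<infinity>"
    by (rule nn_integral_PInf_AE) (simp add: nn_integral_windowed_power2[OF assms])
  then show ?thesis
  proof eventually_elim
    case (elim x)
    have "integrable \<mu> (\<lambda>y. (cmod (windowed \<psi> f x y))\<^sup>2)"
    proof (rule integrableI_bounded)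
      show "(\<integral>\<^sup>+y. ennreal (norm ((cmod (windowed \<psi> f x y))\<^sup>2)) \<partial>\<mu>) < \<infinity>"
        using elim by (simp add: less_top)
    qed measurable
    then show ?case
      using windowed_integrable[OF assms, of x] windowed_measurable(1)[OF assms, of x]
      by (simp add: L1_def L2_def)
  qed
qed

text \<open>The orthogonality relation before the Fourier transform is taken.\<close>

lemma integral_windowed_inner:
  assumes \<psi>: "\<psi> \<in> L2 \<mu>" and f: "f \<in> L2 \<mu>" and \<phi>: "\<phi> \<in> L2 \<mu>" and g: "g \<in> L2 \<mu>"
  shows "(LINT x|\<mu>. L2_inner \<mu> (windowed \<psi> f x) (windowed \<phi> g x)) = L2_inner \<mu> f g * L2_inner \<mu> \<phi> \<psi>"
proof -
  interpret S: pair_sigma_finite \<mu> \<mu> ..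
  have [measurable]: "f \<in> borel_measurable borel" "\<psi> \<in> borel_measurable borel"
    "g \<in> borel_measurable borel" "\<phi> \<in> borel_measurable borel"
    using L2_measurable[OF f] L2_measurable[OF \<psi>] L2_measurable[OF g] L2_measurable[OF \<phi>] by simp_all
  define u where "u y = f y * cnj (g y)" for y
  define v where "v y = \<phi> y * cnj (\<psi> y)" for y
  have u: "integrable \<mu> u" and v: "integrable \<mu> v"
    unfolding u_def[abs_def] v_def[abs_def] by (rule L2_mult_cnj_integrable[OF f g] L2_mult_cnj_integrable[OF \<phi> \<psi>])+
  have [measurable]: "u \<in> borel_measurable borel" "v \<in> borel_measurable borel"
    unfolding u_def[abs_def] v_def[abs_def] by measurable
  have int: "integrable (\<mu> \<Otimes>\<^sub>M \<mu>) (\<lambda>(x, y). u y * v (- x + y))"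
  proof (rule integrableI_bounded)
    have "(\<integral>\<^sup>+z. ennreal (norm (case z of (x, y) \<Rightarrow> u y * v (- x + y))) \<partial>(\<mu> \<Otimes>\<^sub>M \<mu>)) =
        (\<integral>\<^sup>+x. (\<integral>\<^sup>+y. ennreal (norm (u y)) * ennreal (norm (v (- x + y))) \<partial>\<mu>) \<partial>\<mu>)"
      by (subst nn_integral_fst[symmetric]) (auto simp: norm_mult ennreal_mult)
    also have "\<dots> = (\<integral>\<^sup>+y. ennreal (norm (u y)) \<partial>\<mu>) * (\<integral>\<^sup>+y. ennreal (norm (v y)) \<partial>\<mu>)"
      by (rule nn_integral_windowed) measurable
    also have "\<dots> < \<infinity>"
      using u v by (simp add: integrable_iff_bounded ennreal_mult_less_top)
    finally show "(\<integral>\<^sup>+z. ennreal (norm (case z of (x, y) \<Rightarrow> u y * v (- x + y))) \<partial>(\<mu> \<Otimes>\<^sub>M \<mu>)) < \<infinity>" .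
  qed measurable
  have "(LINT x|\<mu>. L2_inner \<mu> (windowed \<psi> f x) (windowed \<phi> g x)) = (LINT x|\<mu>. LINT y|\<mu>. u y * v (- x + y))"
    by (simp add: L2_inner_def windowed_def u_def v_def mult_ac)
  also have "\<dots> = (LINT y|\<mu>. LINT x|\<mu>. u y * v (- x + y))"
    using S.Fubini_integral[OF int] by simp
  also have "\<dots> = (LINT y|\<mu>. u y * (LINT x|\<mu>. v x))"
  proof (rule Bochner_Integration.integral_cong[OF refl])
    fix y
    have "(LINT x|\<mu>. v (- x + y)) = (LINT x|\<mu>. v x)"
      using integral_distr[of "\<lambda>x. - x + y" \<mu> borel v] by (simp add: left_diff_distr)
    then show "(LINT x|\<mu>. u y * v (- x + y)) = u y * (LINT x|\<mu>. v x)"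
      by simp
  qed
  also have "\<dots> = L2_inner \<mu> f g * L2_inner \<mu> \<phi> \<psi>"
    by (simp add: u_def v_def L2_inner_def)
  finally show ?thesis .
qed

end

context plancherel_group
begin

sublocale P: sigma_finite_measure P
  by (rule sigma_finite_plancherel)

sublocale \<sigma>: pair_sigma_finite \<mu> P ..

lemma space_product: "z \<in> space (\<mu> \<Otimes>\<^sub>M P) \<longleftrightarrow> snd z \<in> space P"
  by (cases z) (simp add: space_pair_measure)

lemma gabor_dim_eq: "gabor_dim \<rho> z = dual_dim \<rho> (snd z)"
  by (simp add: gabor_dim_def dual_dim_def)

lemma gabor_fibre_eq:
  assumes "z \<in> space (\<mu> \<Otimes>\<^sub>M P)"
  shows "gabor_fibre \<rho> z = HS (gabor_dim \<rho> z)"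
  using rep_comp_HS_eq[OF section_unitary[of "snd z"]] assms unfolding space_product
  by (cases z) (simp add: gabor_fibre_def gabor_dim_def dual_dim_def)

lemma gabor_Cc_fourier: "gabor_Cc \<mu> \<rho> \<psi> f z = fourier \<mu> \<rho> (windowed \<psi> f (fst z)) (snd z)"
  by (cases z) (simp add: gabor_Cc_def fourier_def windowed_def)

lemma H2_space_iff: "K \<in> H2_space \<mu> \<rho> P \<longleftrightarrow>
    (\<forall>z\<in>space (\<mu> \<Otimes>\<^sub>M P). K z \<in> HS (gabor_dim \<rho> z)) \<and>
    (\<forall>i j. (\<lambda>z. K z (unitvec i) j) \<in> borel_measurable (\<mu> \<Otimes>\<^sub>M P)) \<and>
    (\<integral>\<^sup>+z. hs_norm2 (K z) \<partial>(\<mu> \<Otimes>\<^sub>M P)) < \<infinity>"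
  unfolding H2_space_def direct_integral_def mem_Collect_eq
  using tr_adj_self_integrable_iff(1)[of K "\<mu> \<Otimes>\<^sub>M P" "gabor_dim \<rho>"] by (simp add: gabor_fibre_eq cong: conj_cong)

lemma H2_norm:
  assumes "K \<in> H2_space \<mu> \<rho> P"
  shows "ennreal ((di_norm (\<mu> \<Otimes>\<^sub>M P) (gabor_dim \<rho>) K)\<^sup>2) = (\<integral>\<^sup>+z. hs_norm2 (K z) \<partial>(\<mu> \<Otimes>\<^sub>M P))"
    and "0 \<le> di_norm (\<mu> \<Otimes>\<^sub>M P) (gabor_dim \<rho>) K"
proof -
  let ?t = "\<lambda>z. tr (gabor_dim \<rho> z) (adj (gabor_dim \<rho> z) (K z) \<circ> K z)"
  have K: "\<And>z. z \<in> space (\<mu> \<Otimes>\<^sub>M P) \<Longrightarrow> K z \<in> HS (gabor_dim \<rho> z)"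
    "\<And>i j. (\<lambda>z. K z (unitvec i) j) \<in> borel_measurable (\<mu> \<Otimes>\<^sub>M P)"
    "(\<integral>\<^sup>+z. hs_norm2 (K z) \<partial>(\<mu> \<Otimes>\<^sub>M P)) < \<infinity>"
    using assms unfolding H2_space_iff by auto
  have "integrable (\<mu> \<Otimes>\<^sub>M P) ?t"
    using tr_adj_self_integrable_iff(1)[of K "\<mu> \<Otimes>\<^sub>M P" "gabor_dim \<rho>", OF K(2,1)] K(3) by blast
  then have "Re (LINT z|(\<mu> \<Otimes>\<^sub>M P). ?t z) = (LINT z|(\<mu> \<Otimes>\<^sub>M P). Re (?t z))"
    by simp
  also have "\<dots> \<ge> 0"
    by (rule Bochner_Integration.integral_nonneg) (simp add: HS_tr_self(1)[OF K(1)])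
  finally have nonneg: "0 \<le> Re (LINT z|(\<mu> \<Otimes>\<^sub>M P). ?t z)" .
  then show "0 \<le> di_norm (\<mu> \<Otimes>\<^sub>M P) (gabor_dim \<rho>) K"
    by (simp add: di_norm_def di_inner_def)
  show "ennreal ((di_norm (\<mu> \<Otimes>\<^sub>M P) (gabor_dim \<rho>) K)\<^sup>2) = (\<integral>\<^sup>+z. hs_norm2 (K z) \<partial>(\<mu> \<Otimes>\<^sub>M P))"
    using tr_adj_self_integrable_iff(2)[of K "\<mu> \<Otimes>\<^sub>M P" "gabor_dim \<rho>", OF K(2,1)] K(3) nonneg
    by (simp add: di_norm_def di_inner_def)
qed

text \<open>The defining formula of the transform makes sense for every \<open>f\<close> in \<open>L2\<close>, as
  the windowed function is integrable by Cauchy-Schwarz. It yields a Hilbert-Schmidt operator almost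
  everywhere; elsewhere the value is reset to 0.\<close>

definition gabor_field :: "('g \<Rightarrow> complex) \<Rightarrow> ('g \<Rightarrow> complex) \<Rightarrow> 'g \<times> 'g rep set \<Rightarrow> cop" where
  "gabor_field \<psi> f z = (if gabor_Cc \<mu> \<rho> \<psi> f z \<in> HS (gabor_dim \<rho> z) then gabor_Cc \<mu> \<rho> \<psi> f z else (\<lambda>_ _. 0))"

context
  fixes \<psi> f :: "'g \<Rightarrow> complex"
  assumes \<psi>: "\<psi> \<in> L2 \<mu>" and f: "f \<in> L2 \<mu>"
begin

lemma gabor_Cc_bounded_ops:
  assumes "z \<in> space (\<mu> \<Otimes>\<^sub>M P)"
  shows "gabor_Cc \<mu> \<rho> \<psi> f z \<in> bounded_ops (gabor_dim \<rho> z)"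
  using assms fourier_bounded_ops[OF _ windowed_integrable[OF \<psi> f]]
  by (simp add: gabor_Cc_fourier gabor_dim_eq space_product)

lemma gabor_Cc_entry_measurable: "(\<lambda>z. gabor_Cc \<mu> \<rho> \<psi> f z (unitvec i) j) \<in> borel_measurable (\<mu> \<Otimes>\<^sub>M P)"
proof -
  have [measurable]: "f \<in> borel_measurable borel" "\<psi> \<in> borel_measurable borel"
    using L2_measurable[OF f] L2_measurable[OF \<psi>] by simp_all
  have [measurable]: "(\<lambda>w. entry i j (snd w) (snd (fst w))) \<in> borel_measurable ((\<mu> \<Otimes>\<^sub>M P) \<Otimes>\<^sub>M \<mu>)"
  proof -
    have "(\<lambda>w. (snd w, snd (fst w))) \<in> measurable ((\<mu> \<Otimes>\<^sub>M P) \<Otimes>\<^sub>M \<mu>) (borel \<Otimes>\<^sub>M P)"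
      by measurable
    from measurable_compose[OF this entry_measurable] show ?thesis
      by simp
  qed
  have "(\<lambda>z. LINT y|\<mu>. windowed \<psi> f (fst z) y * entry i j y (snd z)) \<in> borel_measurable (\<mu> \<Otimes>\<^sub>M P)"
    unfolding windowed_def by (rule borel_measurable_lebesgue_integral) (simp add: case_prod_unfold)
  then show ?thesis
    by (rule measurable_cong[THEN iffD2, rotated])
      (simp add: gabor_Cc_fourier space_product fourier_entry[OF _ windowed_integrable[OF \<psi> f]])
qed

lemma hs_norm2_gabor_Cc_measurable: "(\<lambda>z. hs_norm2 (gabor_Cc \<mu> \<rho> \<psi> f z)) \<in> borel_measurable (\<mu> \<Otimes>\<^sub>M P)"
  by (rule hs_norm2_measurable) (rule gabor_Cc_entry_measurable)

lemma nn_integral_gabor_Cc: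
  "(\<integral>\<^sup>+z. hs_norm2 (gabor_Cc \<mu> \<rho> \<psi> f z) \<partial>(\<mu> \<Otimes>\<^sub>M P)) = ennreal ((L2_norm \<mu> f)\<^sup>2 * (L2_norm \<mu> \<psi>)\<^sup>2)"
proof -
  have "(\<integral>\<^sup>+z. hs_norm2 (gabor_Cc \<mu> \<rho> \<psi> f z) \<partial>(\<mu> \<Otimes>\<^sub>M P)) =
      (\<integral>\<^sup>+x. (\<integral>\<^sup>+p. hs_norm2 (gabor_Cc \<mu> \<rho> \<psi> f (x, p)) \<partial>P) \<partial>\<mu>)"
    by (rule P.nn_integral_fst[symmetric]) (rule hs_norm2_gabor_Cc_measurable)
  also have "\<dots> = (\<integral>\<^sup>+x. (\<integral>\<^sup>+y. ennreal ((cmod (windowed \<psi> f x y))\<^sup>2) \<partial>\<mu>) \<partial>\<mu>)"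
    using AE_windowed_L1_L2[OF \<psi> f]
    by (intro nn_integral_cong_AE) (auto simp: gabor_Cc_fourier plancherel_fourier_norm)
  also have "\<dots> = ennreal ((L2_norm \<mu> f)\<^sup>2 * (L2_norm \<mu> \<psi>)\<^sup>2)"
    by (rule nn_integral_windowed_power2[OF \<psi> f])
  finally show ?thesis .
qed

lemma AE_gabor_field_eq: "AE z in \<mu> \<Otimes>\<^sub>M P. gabor_field \<psi> f z = gabor_Cc \<mu> \<rho> \<psi> f z"
proof -
  have "AE z in \<mu> \<Otimes>\<^sub>M P. hs_norm2 (gabor_Cc \<mu> \<rho> \<psi> f z) \<noteq> \<infinity>"
    by (rule nn_integral_PInf_AE[OF hs_norm2_gabor_Cc_measurable])
      (simp add: nn_integral_gabor_Cc)
  then show ?thesis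
    using AE_space
  proof eventually_elim
    case (elim z)
    then show ?case
      using gabor_Cc_bounded_ops[of z] by (simp add: gabor_field_def HS_iff less_top)
  qed
qed

lemma gabor_field_HS: "gabor_field \<psi> f z \<in> HS (gabor_dim \<rho> z)"
  by (simp add: gabor_field_def zero_op_HS)

lemma gabor_field_entry_measurable: "(\<lambda>z. gabor_field \<psi> f z (unitvec i) j) \<in> borel_measurable (\<mu> \<Otimes>\<^sub>M P)"
proof -
  note [measurable] = hs_norm2_gabor_Cc_measurable gabor_Cc_entry_measurable
  have "(\<lambda>z. if hs_norm2 (gabor_Cc \<mu> \<rho> \<psi> f z) < \<infinity> then gabor_Cc \<mu> \<rho> \<psi> f z (unitvec i) j else 0)
      \<in> borel_measurable (\<mu> \<Otimes>\<^sub>M P)"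
    by measurable
  then show ?thesis
    by (rule measurable_cong[THEN iffD2, rotated]) (simp add: gabor_field_def HS_iff gabor_Cc_bounded_ops)
qed

lemma nn_integral_gabor_field:
  "(\<integral>\<^sup>+z. hs_norm2 (gabor_field \<psi> f z) \<partial>(\<mu> \<Otimes>\<^sub>M P)) = ennreal ((L2_norm \<mu> f)\<^sup>2 * (L2_norm \<mu> \<psi>)\<^sup>2)"
  unfolding nn_integral_gabor_Cc[symmetric]
  using AE_gabor_field_eq by (intro nn_integral_cong_AE) auto

lemma gabor_field_H2: "gabor_field \<psi> f \<in> H2_space \<mu> \<rho> P"
  unfolding H2_space_iff by (auto simp: gabor_field_HS gabor_field_entry_measurable nn_integral_gabor_field)

lemma AE_AE_gabor_field: "AE x in \<mu>. AE p in P. gabor_field \<psi> f (x, p) = fourier \<mu> \<rho> (windowed \<psi> f x) p"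
  using AE_windowed_L1_L2[OF \<psi> f]
proof eventually_elim
  case (elim x)
  show ?case
    using AE_fourier_HS[OF elim]
    by eventually_elim (simp add: gabor_field_def gabor_Cc_fourier gabor_dim_eq)
qed

end

text \<open>For almost every \<open>x\<close> the Plancherel isometry turns the integral over the dual into the \<open>L2\<close> inner product
  of the windowed functions, and integration over \<open>x\<close> separates signals and windows.\<close>

lemma gabor_field_inner:
  assumes \<psi>: "\<psi> \<in> L2 \<mu>" and f: "f \<in> L2 \<mu>" and \<phi>: "\<phi> \<in> L2 \<mu>" and g: "g \<in> L2 \<mu>"
  shows "di_inner (\<mu> \<Otimes>\<^sub>M P) (gabor_dim \<rho>) (gabor_field \<psi> f) (gabor_field \<phi> g) = L2_inner \<mu> f g * L2_inner \<mu> \<phi> \<psi>"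
proof -
  let ?t = "\<lambda>z. tr (gabor_dim \<rho> z) (adj (gabor_dim \<rho> z) (gabor_field \<phi> g z) \<circ> gabor_field \<psi> f z)"
  have int: "integrable (\<mu> \<Otimes>\<^sub>M P) ?t"
    by (rule tr_adj_comp_integrable)
      (simp_all add: gabor_field_HS gabor_field_entry_measurable nn_integral_gabor_field assms)
  have "di_inner (\<mu> \<Otimes>\<^sub>M P) (gabor_dim \<rho>) (gabor_field \<psi> f) (gabor_field \<phi> g) = (LINT x|\<mu>. LINT p|P. ?t (x, p))"
    unfolding di_inner_def by (rule \<sigma>.integral_fst'[OF int, symmetric])
  also have "\<dots> = (LINT x|\<mu>. L2_inner \<mu> (windowed \<psi> f x) (windowed \<phi> g x))"
  proof (rule integral_cong_AE)
    show "(\<lambda>x. LINT p|P. ?t (x, p)) \<in> borel_measurable \<mu>"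
      using borel_measurable_integrable[OF int] by (intro P.borel_measurable_lebesgue_integral) simp
    note [measurable] = windowed_measurable(2)[OF \<psi> f] windowed_measurable(2)[OF \<phi> g]
    show "(\<lambda>x. L2_inner \<mu> (windowed \<psi> f x) (windowed \<phi> g x)) \<in> borel_measurable \<mu>"
      unfolding L2_inner_def by measurable
    show "AE x in \<mu>. (LINT p|P. ?t (x, p)) = L2_inner \<mu> (windowed \<psi> f x) (windowed \<phi> g x)"
      using AE_windowed_L1_L2[OF \<psi> f] AE_windowed_L1_L2[OF \<phi> g] AE_AE_gabor_field[OF \<psi> f] AE_AE_gabor_field[OF \<phi> g]
    proof eventually_elim
      case (elim x)
      have "(\<lambda>p. ?t (x, p)) \<in> borel_measurable P"
        using measurable_Pair2[OF borel_measurable_integrable[OF int], of x] by simp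
      then show ?case
        using plancherel_fourier_inner[OF elim(1,2) elim(3,4)] by (simp add: gabor_dim_eq)
    qed
  qed
  also have "\<dots> = L2_inner \<mu> f g * L2_inner \<mu> \<phi> \<psi>"
    by (rule integral_windowed_inner[OF \<psi> f \<phi> g])
  finally show ?thesis .
qed

lemma gabor_extension_gabor_field:
  assumes \<psi>: "\<psi> \<in> L2 \<mu>"
  shows "gabor_extension \<mu> \<rho> P \<psi> (gabor_field \<psi>)"
  unfolding gabor_extension_def
proof (intro conjI ballI)
  show "gabor_field \<psi> f \<in> H2_space \<mu> \<rho> P" if "f \<in> L2 \<mu>" for f
    by (rule gabor_field_H2[OF \<psi> that])
  show "linear_L2_fields \<mu> (\<mu> \<Otimes>\<^sub>M P) (gabor_field \<psi>)"
    unfolding linear_L2_fields_def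
  proof (intro ballI allI)
    fix f g a b assume f: "f \<in> L2 \<mu>" and g: "g \<in> L2 \<mu>"
    show "AE z in \<mu> \<Otimes>\<^sub>M P. gabor_field \<psi> (\<lambda>x. a * f x + b * g x) z =
        (\<lambda>u i. a * gabor_field \<psi> f z u i + b * gabor_field \<psi> g z u i)"
      using AE_gabor_field_eq[OF \<psi> f] AE_gabor_field_eq[OF \<psi> g] AE_gabor_field_eq[OF \<psi> L2_lincomb[OF f g, of a b]] AE_space
    proof eventually_elim
      case (elim z)
      have w: "windowed \<psi> (\<lambda>x. a * f x + b * g x) x = (\<lambda>y. a * windowed \<psi> f x y + b * windowed \<psi> g x y)" for x
        by (auto simp: windowed_def algebra_simps)
      have "snd z \<in> space P"
        using elim(4) by (simp add: space_product)
      then show ?case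
        unfolding elim(1-3) gabor_Cc_fourier w
        by (rule fourier_lincomb[OF _ windowed_integrable[OF \<psi> f] windowed_integrable[OF \<psi> g]])
    qed
  qed
  show "\<exists>C. \<forall>f\<in>L2 \<mu>. di_norm (\<mu> \<Otimes>\<^sub>M P) (gabor_dim \<rho>) (gabor_field \<psi> f) \<le> C * L2_norm \<mu> f"
  proof (intro exI ballI)
    fix f assume f: "f \<in> L2 \<mu>"
    have "ennreal ((di_norm (\<mu> \<Otimes>\<^sub>M P) (gabor_dim \<rho>) (gabor_field \<psi> f))\<^sup>2) = ennreal ((L2_norm \<mu> \<psi> * L2_norm \<mu> f)\<^sup>2)"
      unfolding H2_norm(1)[OF gabor_field_H2[OF \<psi> f]] nn_integral_gabor_field[OF \<psi> f]
      by (simp add: power_mult_distrib mult.commute)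
    then have "(di_norm (\<mu> \<Otimes>\<^sub>M P) (gabor_dim \<rho>) (gabor_field \<psi> f))\<^sup>2 = (L2_norm \<mu> \<psi> * L2_norm \<mu> f)\<^sup>2"
      by simp
    then show "di_norm (\<mu> \<Otimes>\<^sub>M P) (gabor_dim \<rho>) (gabor_field \<psi> f) \<le> L2_norm \<mu> \<psi> * L2_norm \<mu> f"
      by (rule power2_le_imp_le[OF eq_refl]) (intro mult_nonneg_nonneg L2_norm_nonneg)
  qed
  show "AE z in \<mu> \<Otimes>\<^sub>M P. gabor_field \<psi> f z = gabor_Cc \<mu> \<rho> \<psi> f z" if "f \<in> Cc" for f
    by (rule AE_gabor_field_eq[OF \<psi> Cc_L2[OF that]])
qed

text \<open>Two extensions agree on \<open>Cc\<close>, both are linear and bounded, and so the induction rule for \<open>L2\<close> applies.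
  In the limit step each matrix entry of the difference is estimated by the norms of both transforms
  of the error \<open>f - s k\<close>.\<close>

lemma gabor_extension_unique:
  assumes G: "gabor_extension \<mu> \<rho> P \<psi> \<Gamma>" and D: "gabor_extension \<mu> \<rho> P \<psi> \<Delta>" and f: "f \<in> L2 \<mu>"
  shows "AE z in \<mu> \<Otimes>\<^sub>M P. \<Gamma> f z = \<Delta> f z"
  using f
proof (rule L2_induct_Cc[rotated 3])
  show "AE z in \<mu> \<Otimes>\<^sub>M P. \<Gamma> f z = \<Delta> f z" if "f \<in> Cc" for f
  proof -
    have "AE z in \<mu> \<Otimes>\<^sub>M P. \<Gamma> f z = gabor_Cc \<mu> \<rho> \<psi> f z" "AE z in \<mu> \<Otimes>\<^sub>M P. \<Delta> f z = gabor_Cc \<mu> \<rho> \<psi> f z"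
      using G D that unfolding gabor_extension_def by blast+
    then show ?thesis
      by eventually_elim simp
  qed
next
  fix f g a b
  assume fg: "f \<in> L2 \<mu>" "g \<in> L2 \<mu>" and eq: "AE z in \<mu> \<Otimes>\<^sub>M P. \<Gamma> f z = \<Delta> f z" "AE z in \<mu> \<Otimes>\<^sub>M P. \<Gamma> g z = \<Delta> g z"
  have "AE z in \<mu> \<Otimes>\<^sub>M P. \<Gamma> (\<lambda>x. a * f x + b * g x) z = (\<lambda>u i. a * \<Gamma> f z u i + b * \<Gamma> g z u i)"
    "AE z in \<mu> \<Otimes>\<^sub>M P. \<Delta> (\<lambda>x. a * f x + b * g x) z = (\<lambda>u i. a * \<Delta> f z u i + b * \<Delta> g z u i)"
    using G D fg unfolding gabor_extension_def linear_L2_fields_def by blast+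
  with eq show "AE z in \<mu> \<Otimes>\<^sub>M P. \<Gamma> (\<lambda>x. a * f x + b * g x) z = \<Delta> (\<lambda>x. a * f x + b * g x) z"
    by eventually_elim simp
next
  fix s :: "nat \<Rightarrow> 'g \<Rightarrow> complex" and f
  assume s: "\<And>k. s k \<in> L2 \<mu>" "\<And>k. AE z in \<mu> \<Otimes>\<^sub>M P. \<Gamma> (s k) z = \<Delta> (s k) z" and f: "f \<in> L2 \<mu>"
    and lim: "(\<lambda>k. LINT x|\<mu>. (cmod (f x - s k x))\<^sup>2) \<longlonglongrightarrow> 0"
  define d where "d k = (\<lambda>x. 1 * f x + (-1) * s k x)" for k
  have d: "d k \<in> L2 \<mu>" for k
    unfolding d_def by (rule L2_lincomb[OF f s(1)])
  have H2: "\<Gamma> h \<in> H2_space \<mu> \<rho> P" "\<Delta> h \<in> H2_space \<mu> \<rho> P" if "h \<in> L2 \<mu>" for h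
    using G D that unfolding gabor_extension_def by blast+
  have HS: "\<Gamma> h z \<in> HS (gabor_dim \<rho> z)" "\<Delta> h z \<in> HS (gabor_dim \<rho> z)" if "h \<in> L2 \<mu>" "z \<in> space (\<mu> \<Otimes>\<^sub>M P)" for h z
    using H2[OF that(1)] that(2) unfolding H2_space_iff by blast+
  have meas: "(\<lambda>z. \<Gamma> h z (unitvec i) j) \<in> borel_measurable (\<mu> \<Otimes>\<^sub>M P)"
    "(\<lambda>z. \<Delta> h z (unitvec i) j) \<in> borel_measurable (\<mu> \<Otimes>\<^sub>M P)" if "h \<in> L2 \<mu>" for h i j
    using H2[OF that] unfolding H2_space_iff by blast+
  have bound: "\<exists>C. \<forall>h\<in>L2 \<mu>. (\<integral>\<^sup>+z. hs_norm2 (\<Theta> h z) \<partial>(\<mu> \<Otimes>\<^sub>M P)) \<le> ennreal (C * (LINT x|\<mu>. (cmod (h x))\<^sup>2))"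
    if T: "gabor_extension \<mu> \<rho> P \<psi> \<Theta>" for \<Theta>
  proof -
    obtain C where C: "\<forall>h\<in>L2 \<mu>. di_norm (\<mu> \<Otimes>\<^sub>M P) (gabor_dim \<rho>) (\<Theta> h) \<le> C * L2_norm \<mu> h"
      using T unfolding gabor_extension_def by blast
    have "(\<integral>\<^sup>+z. hs_norm2 (\<Theta> h z) \<partial>(\<mu> \<Otimes>\<^sub>M P)) \<le> ennreal (C\<^sup>2 * (LINT x|\<mu>. (cmod (h x))\<^sup>2))" if h: "h \<in> L2 \<mu>" for h
    proof -
      have \<Theta>: "\<Theta> h \<in> H2_space \<mu> \<rho> P"
        using T h unfolding gabor_extension_def by blast
      have "(di_norm (\<mu> \<Otimes>\<^sub>M P) (gabor_dim \<rho>) (\<Theta> h))\<^sup>2 \<le> (C * L2_norm \<mu> h)\<^sup>2"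
        using C h H2_norm(2)[OF \<Theta>] by (intro power_mono) auto
      then show ?thesis
        unfolding H2_norm(1)[OF \<Theta>, symmetric] by (intro ennreal_leI) (simp add: power_mult_distrib L2_norm_power2)
    qed
    then show ?thesis by blast
  qed
  obtain A where A: "\<forall>h\<in>L2 \<mu>. (\<integral>\<^sup>+z. hs_norm2 (\<Gamma> h z) \<partial>(\<mu> \<Otimes>\<^sub>M P)) \<le> ennreal (A * (LINT x|\<mu>. (cmod (h x))\<^sup>2))"
    using bound[OF G] by blast
  obtain B where B: "\<forall>h\<in>L2 \<mu>. (\<integral>\<^sup>+z. hs_norm2 (\<Delta> h z) \<partial>(\<mu> \<Otimes>\<^sub>M P)) \<le> ennreal (B * (LINT x|\<mu>. (cmod (h x))\<^sup>2))"
    using bound[OF D] by blast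
  have "AE z in \<mu> \<Otimes>\<^sub>M P. \<Gamma> f z (unitvec i) j = \<Delta> f z (unitvec i) j" for i j
  proof -
    define e where "e z = ennreal ((cmod (\<Gamma> f z (unitvec i) j - \<Delta> f z (unitvec i) j))\<^sup>2)" for z
    note [measurable] = meas[OF f]
    have hs_meas: "(\<lambda>z. hs_norm2 (\<Gamma> (d k) z)) \<in> borel_measurable (\<mu> \<Otimes>\<^sub>M P)"
      "(\<lambda>z. hs_norm2 (\<Delta> (d k) z)) \<in> borel_measurable (\<mu> \<Otimes>\<^sub>M P)" for k
      by (rule hs_norm2_measurable, rule meas[OF d])+
    have e_meas [measurable]: "e \<in> borel_measurable (\<mu> \<Otimes>\<^sub>M P)"
      unfolding e_def[abs_def] by measurable
    define r where "r k = (LINT x|\<mu>. (cmod (f x - s k x))\<^sup>2)" for k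
    have le: "(\<integral>\<^sup>+z. e z \<partial>(\<mu> \<Otimes>\<^sub>M P)) \<le> 2 * ennreal (A * r k) + 2 * ennreal (B * r k)" for k
    proof -
      have "AE z in \<mu> \<Otimes>\<^sub>M P. \<Gamma> (d k) z = (\<lambda>u i. 1 * \<Gamma> f z u i + (-1) * \<Gamma> (s k) z u i)"
        "AE z in \<mu> \<Otimes>\<^sub>M P. \<Delta> (d k) z = (\<lambda>u i. 1 * \<Delta> f z u i + (-1) * \<Delta> (s k) z u i)"
        using G D f s(1) unfolding gabor_extension_def linear_L2_fields_def d_def by blast+
      then have "AE z in \<mu> \<Otimes>\<^sub>M P. e z \<le> 2 * hs_norm2 (\<Gamma> (d k) z) + 2 * hs_norm2 (\<Delta> (d k) z)"
        using s(2)[of k]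
      proof eventually_elim
        case (elim z)
        have "\<Gamma> f z (unitvec i) j - \<Delta> f z (unitvec i) j = 1 * \<Gamma> (d k) z (unitvec i) j + (-1) * \<Delta> (d k) z (unitvec i) j"
          using elim by simp
        then have "(cmod (\<Gamma> f z (unitvec i) j - \<Delta> f z (unitvec i) j))\<^sup>2 \<le>
            2 * (cmod (\<Gamma> (d k) z (unitvec i) j))\<^sup>2 + 2 * (cmod (\<Delta> (d k) z (unitvec i) j))\<^sup>2"
          using norm_lincomb_power2_le[of 1 "\<Gamma> (d k) z (unitvec i) j" "-1" "\<Delta> (d k) z (unitvec i) j"] by simp
        then have "e z \<le> 2 * ennreal ((cmod (\<Gamma> (d k) z (unitvec i) j))\<^sup>2) + 2 * ennreal ((cmod (\<Delta> (d k) z (unitvec i) j))\<^sup>2)"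
          unfolding e_def by (simp add: ennreal_leI flip: ennreal_mult'' ennreal_plus ennreal_numeral)
        also have "\<dots> \<le> 2 * hs_norm2 (\<Gamma> (d k) z) + 2 * hs_norm2 (\<Delta> (d k) z)"
          by (intro add_mono mult_left_mono entry_le_hs_norm2) auto
        finally show ?case .
      qed
      then have "(\<integral>\<^sup>+z. e z \<partial>(\<mu> \<Otimes>\<^sub>M P)) \<le> (\<integral>\<^sup>+z. 2 * hs_norm2 (\<Gamma> (d k) z) + 2 * hs_norm2 (\<Delta> (d k) z) \<partial>(\<mu> \<Otimes>\<^sub>M P))"
        by (rule nn_integral_mono_AE)
      also have "\<dots> = 2 * (\<integral>\<^sup>+z. hs_norm2 (\<Gamma> (d k) z) \<partial>(\<mu> \<Otimes>\<^sub>M P)) + 2 * (\<integral>\<^sup>+z. hs_norm2 (\<Delta> (d k) z) \<partial>(\<mu> \<Otimes>\<^sub>M P))"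
      proof -
        note [measurable] = hs_meas[of k]
        show ?thesis
          by (subst nn_integral_add) (simp_all add: nn_integral_cmult)
      qed
      also have "\<dots> \<le> 2 * ennreal (A * r k) + 2 * ennreal (B * r k)"
      proof -
        have "(LINT x|\<mu>. (cmod (d k x))\<^sup>2) = r k"
          by (simp add: d_def r_def)
        then show ?thesis
          using A B d[of k] by (intro add_mono mult_left_mono) (auto dest!: bspec[of _ _ "d k"])
      qed
      finally show ?thesis .
    qed
    have "r \<longlonglongrightarrow> 0"
      using lim by (simp add: r_def[abs_def])
    then have "(\<lambda>k. ennreal (A * r k)) \<longlonglongrightarrow> ennreal (A * 0)" "(\<lambda>k. ennreal (B * r k)) \<longlonglongrightarrow> ennreal (B * 0)"
      by (intro tendsto_ennrealI tendsto_mult_left; assumption)+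
    then have "(\<lambda>k. 2 * ennreal (A * r k) + 2 * ennreal (B * r k)) \<longlonglongrightarrow> 2 * ennreal (A * 0) + 2 * ennreal (B * 0)"
      by (intro tendsto_add ennreal_tendsto_cmult) auto
    then have "(\<integral>\<^sup>+z. e z \<partial>(\<mu> \<Otimes>\<^sub>M P)) \<le> 2 * ennreal (A * 0) + 2 * ennreal (B * 0)"
      by (rule LIMSEQ_le_const) (use le in auto)
    then have "(\<integral>\<^sup>+z. e z \<partial>(\<mu> \<Otimes>\<^sub>M P)) = 0"
      by simp
    then have "AE z in \<mu> \<Otimes>\<^sub>M P. e z = 0"
      by (simp add: nn_integral_0_iff_AE)
    then show ?thesis
      by eventually_elim (simp add: e_def)
  qed
  then have "AE z in \<mu> \<Otimes>\<^sub>M P. \<forall>i j. \<Gamma> f z (unitvec i) j = \<Delta> f z (unitvec i) j"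
    by (simp add: AE_all_countable)
  then show "AE z in \<mu> \<Otimes>\<^sub>M P. \<Gamma> f z = \<Delta> f z"
    using AE_space
  proof eventually_elim
    case (elim z)
    show ?case
      by (rule bounded_ops_eqI[OF HS_bounded_ops[OF HS(1)[OF f elim(2)]] HS_bounded_ops[OF HS(2)[OF f elim(2)]]])
        (use elim(1) in blast)
  qed
qed

lemma gabor_extension_gabor: "\<psi> \<in> L2 \<mu> \<Longrightarrow> gabor_extension \<mu> \<rho> P \<psi> (gabor \<mu> \<rho> P \<psi>)"
  unfolding gabor_def by (rule someI[of "gabor_extension \<mu> \<rho> P \<psi>", OF gabor_extension_gabor_field])

lemma AE_gabor: "\<psi> \<in> L2 \<mu> \<Longrightarrow> f \<in> L2 \<mu> \<Longrightarrow> AE z in \<mu> \<Otimes>\<^sub>M P. gabor \<mu> \<rho> P \<psi> f z = gabor_field \<psi> f z"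
  by (rule gabor_extension_unique[OF gabor_extension_gabor gabor_extension_gabor_field])

lemma gabor_orthogonality:
  assumes \<psi>: "\<psi> \<in> L2 \<mu>" and f: "f \<in> L2 \<mu>" and \<phi>: "\<phi> \<in> L2 \<mu>" and g: "g \<in> L2 \<mu>"
  shows "(LINT z|(\<mu> \<Otimes>\<^sub>M P). tr (gabor_dim \<rho> z) (gabor \<mu> \<rho> P \<psi> f z \<circ> adj (gabor_dim \<rho> z) (gabor \<mu> \<rho> P \<phi> g z))) =
    L2_inner \<mu> f g * L2_inner \<mu> \<phi> \<psi>"
proof -
  have H2: "gabor \<mu> \<rho> P \<psi> f \<in> H2_space \<mu> \<rho> P" "gabor \<mu> \<rho> P \<phi> g \<in> H2_space \<mu> \<rho> P"
    using gabor_extension_gabor[OF \<psi>] gabor_extension_gabor[OF \<phi>] f g unfolding gabor_extension_def by blast+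
  have HS: "gabor \<mu> \<rho> P \<psi> f z \<in> HS (gabor_dim \<rho> z)" "gabor \<mu> \<rho> P \<phi> g z \<in> HS (gabor_dim \<rho> z)"
    if "z \<in> space (\<mu> \<Otimes>\<^sub>M P)" for z
    using H2 that unfolding H2_space_iff by blast+
  have meas: "(\<lambda>z. gabor \<mu> \<rho> P \<psi> f z (unitvec i) j) \<in> borel_measurable (\<mu> \<Otimes>\<^sub>M P)"
    "(\<lambda>z. gabor \<mu> \<rho> P \<phi> g z (unitvec i) j) \<in> borel_measurable (\<mu> \<Otimes>\<^sub>M P)" for i j
    using H2 unfolding H2_space_iff by blast+
  have "(LINT z|(\<mu> \<Otimes>\<^sub>M P). tr (gabor_dim \<rho> z) (gabor \<mu> \<rho> P \<psi> f z \<circ> adj (gabor_dim \<rho> z) (gabor \<mu> \<rho> P \<phi> g z))) =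
      (LINT z|(\<mu> \<Otimes>\<^sub>M P). tr (gabor_dim \<rho> z) (adj (gabor_dim \<rho> z) (gabor \<mu> \<rho> P \<phi> g z) \<circ> gabor \<mu> \<rho> P \<psi> f z))"
    by (rule Bochner_Integration.integral_cong[OF refl HS_tr_adj_comp(2)[OF HS]])
  also have "\<dots> = di_inner (\<mu> \<Otimes>\<^sub>M P) (gabor_dim \<rho>) (gabor_field \<psi> f) (gabor_field \<phi> g)"
    unfolding di_inner_def
  proof (rule integral_cong_AE)
    show "(\<lambda>z. tr (gabor_dim \<rho> z) (adj (gabor_dim \<rho> z) (gabor \<mu> \<rho> P \<phi> g z) \<circ> gabor \<mu> \<rho> P \<psi> f z)) \<in> borel_measurable (\<mu> \<Otimes>\<^sub>M P)"
      by (rule tr_adj_comp_measurable[OF meas HS])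
    show "(\<lambda>z. tr (gabor_dim \<rho> z) (adj (gabor_dim \<rho> z) (gabor_field \<phi> g z) \<circ> gabor_field \<psi> f z)) \<in> borel_measurable (\<mu> \<Otimes>\<^sub>M P)"
      by (rule tr_adj_comp_measurable) (simp_all add: gabor_field_HS gabor_field_entry_measurable assms)
    show "AE z in \<mu> \<Otimes>\<^sub>M P. tr (gabor_dim \<rho> z) (adj (gabor_dim \<rho> z) (gabor \<mu> \<rho> P \<phi> g z) \<circ> gabor \<mu> \<rho> P \<psi> f z) =
        tr (gabor_dim \<rho> z) (adj (gabor_dim \<rho> z) (gabor_field \<phi> g z) \<circ> gabor_field \<psi> f z)"
      using AE_gabor[OF \<psi> f] AE_gabor[OF \<phi> g] by eventually_elim simp
  qed
  also have "\<dots> = L2_inner \<mu> f g * L2_inner \<mu> \<phi> \<psi>"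
    by (rule gabor_field_inner[OF \<psi> f \<phi> g])
  finally show ?thesis .
qed

text \<open>By the orthogonality relation \<open>\<langle>\<phi>,\<psi>\<rangle> f\<close> has the inner products that specify the weak integral, and
  inner products determine a function up to null sets.\<close>

lemma weak_gabor_integral_gabor:
  assumes \<psi>: "\<psi> \<in> L2 \<mu>" and f: "f \<in> L2 \<mu>" and \<phi>: "\<phi> \<in> L2 \<mu>"
  shows "AE x in \<mu>. weak_gabor_integral \<mu> \<rho> P \<phi> (gabor \<mu> \<rho> P \<psi> f) x = L2_inner \<mu> \<phi> \<psi> * f x"
proof -
  define c where "c = L2_inner \<mu> \<phi> \<psi>"
  define spec where "spec h \<longleftrightarrow> h \<in> L2 \<mu> \<and> (\<forall>g\<in>L2 \<mu>. L2_inner \<mu> h g = L2_inner \<mu> f g * c)" for h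
  have cf: "(\<lambda>x. c * f x) \<in> L2 \<mu>"
    using L2_lincomb[OF f f, of c 0] by simp
  have "spec (\<lambda>x. c * f x)"
    using cf by (simp add: spec_def L2_inner_def mult.assoc)
  then have "spec (SOME h. spec h)"
    by (rule someI[of spec])
  moreover have "weak_gabor_integral \<mu> \<rho> P \<phi> (gabor \<mu> \<rho> P \<psi> f) = (SOME h. spec h)"
    unfolding weak_gabor_integral_def spec_def c_def
    by (rule arg_cong[of _ _ Eps]) (auto simp: gabor_orthogonality[OF \<psi> f \<phi>])
  ultimately have h: "spec (weak_gabor_integral \<mu> \<rho> P \<phi> (gabor \<mu> \<rho> P \<psi> f))"
    by simp
  define h where "h = weak_gabor_integral \<mu> \<rho> P \<phi> (gabor \<mu> \<rho> P \<psi> f)"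
  define d where "d x = 1 * h x + (-1) * (c * f x)" for x
  have hL: "h \<in> L2 \<mu>"
    using h by (simp add: h_def spec_def)
  have d: "d \<in> L2 \<mu>"
    unfolding d_def[abs_def] by (rule L2_lincomb[OF hL cf])
  have "L2_inner \<mu> d d = L2_inner \<mu> h d - L2_inner \<mu> (\<lambda>x. c * f x) d"
    using L2_mult_cnj_integrable[OF hL d] L2_mult_cnj_integrable[OF cf d]
    unfolding L2_inner_def by (subst Bochner_Integration.integral_diff[symmetric]) (auto simp: d_def algebra_simps)
  also have "\<dots> = 0"
    using h \<open>spec (\<lambda>x. c * f x)\<close> d by (simp add: spec_def h_def)
  finally have "AE x in \<mu>. d x = 0"
    by (rule L2_orthogonal_imp_AE_0[OF d])
  then show ?thesis
    by eventually_elim (simp add: d_def h_def c_def)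
qed

end

theorem theorem3p7:
  fixes \<mu> :: "'g::{topological_group_add, t2_space, second_countable_topology} measure"
    and \<rho> :: "'g rep set \<Rightarrow> 'g rep"
    and P :: "'g rep set measure"
    and \<psi> \<phi> f :: "'g \<Rightarrow> complex"
  assumes "locally_compact_space (euclidean :: 'g topology)"
    and "\<exists>x y :: 'g. x + y \<noteq> y + x"
    and "unimodular TYPE('g)"
    and "type_I_group TYPE('g)"
    and "haar_measure \<mu>"
    and "measurable_section \<rho>"
    and "plancherel_measure \<mu> \<rho> P"
    and "\<psi> \<in> L2 \<mu>" and "\<not> (AE x in \<mu>. \<psi> x = 0)"
    and "\<phi> \<in> L2 \<mu>" and "\<not> (AE x in \<mu>. \<phi> x = 0)"
    and "L2_inner \<mu> \<phi> \<psi> \<noteq> 0"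
    and "f \<in> L2 \<mu>"
  shows "AE x in \<mu>. f x =
    inverse (L2_inner \<mu> \<phi> \<psi>) * weak_gabor_integral \<mu> \<rho> P \<phi> (gabor \<mu> \<rho> P \<psi> f) x"
proof -
  interpret plancherel_group \<mu> \<rho> P
    using assms(1,3,5-7) by unfold_locales (simp_all add: unimodular_def)
  show ?thesis
    using weak_gabor_integral_gabor[OF assms(8,13,10)]
  proof eventually_elim
    case (elim x)
    then show ?case
      using assms(12) by simp
  qed
qed

end
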